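(* Let $n\ge 1$ and let $P$ be a poset on $[n]=\{1,\dots,n\}$. Then $P$ is a Baxter poset if and only if $P$ is the adjacency poset of a diagonal rectangulation (of size $n$).
   Context: **Posets.** For a poset $P$ on $[n]$, $<_P$ is its strict order and $<$ the usual numerical order. $x\lessdot_P y$ means $x<_P y$ and there is no $z$ with $x<_P z<_P y$ (a cover relation; $y$ covers $x$). $P$ is bounded if it has an element greater than all other elements and an element less than all other elements. $(x,y)=\{z: x<_P z<_P y\}$ is the open interval; it is disconnected if it has at least two connected components as a poset. **Chains.** For numbers $a<b<c<d$ in $[n]$: a 2-14-3 chain is $b<_P a\lessdot_P d<_P c$; a 3-14-2 chain is $c<_P a\lessdot_P d<_P b$; a 2-41-3 chain is $b<_P d\lessdot_P a<_P c$; a 3-41-2 chain is $c<_P d\lessdot_P a<_P b$. **Planar embeddings.** A Hasse diagram for $P$ is an embedding in $\mathbb{R}^2$ of the graph of cover relations in which, whenever $x\lessdot_P y$, the vertex $y$ is above the vertex $x$, and each edge is a line segment. A planar embedding of $P$ is a Hasse diagram in which no two edges intersect (except at common endpoints). A finite bounded poset with a planar embedding is a lattice. In a planar embedding of a lattice, let $S(x)$ be the union of the chains of $P$ containing $x$ (as drawn) and the horizontal line segments whose endpoints are contained in these chains. Then $x$ is left of $y$ if $y\notin S(x)$ and the left-pointing horizontal ray starting at $y$ passes through $S(x)$. **Baxter posets.** A poset $P$ on $[n]$ is a Baxter poset if and only if it satisfies the following conditions: 1. $P$ is bounded. 2. If $x\in P$, then $x$ is covered by at most two elements and covers at most two elements.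 3. $P$ contains no 2-14-3, no 3-14-2, no 2-41-3 and no 3-41-2 chains. 4. If $[x,y]$ is an interval of $P$ such that the open interval $(x,y)$ is disconnected, then $|x-y|=1$. 5. There exists a planar embedding of $P$ such that for every interval $[x,y]$ of $P$ with $(x,y)$ disconnected, if $w,z\in(x,y)$ and $w$ is left of $z$, then $w<x<z$ in numerical order. **Diagonal rectangulations.** A rectangulation of size $n$ is an equivalence class of decompositions of a square $S$ into $n$ rectangles, two decompositions being equivalent if some homeomorphism of the square fixing its vertices takes one to the other. It is a diagonal rectangulation if, for some representative, the top-left to bottom-right diagonal of $S$ contains an interior point of each rectangle. A diagonal rectangulation is referred to by its distinguished representative whose edges meet this diagonal in equally spaced points. Its rectangles are labeled $1,\dots,n$ in the order in which they appear along the diagonal starting from the upper left; the one labeled $i$ is called rectangle $i$. **Adjacency poset.** The adjacency poset of a diagonal rectangulation of size $n$ is the poset on $[n]$ obtained by declaring $x<y$ whenever the interior of the bottom or left side of rectangle $y$ intersects the interior of the top or right side of rectangle $x$, and then taking the reflexive and transitive closure (these relations are acyclic, so this is a partial order).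
   Formalization: Condition 5 of a Baxter poset is required only for w and z in different connected components of (x,y); for all w, z in (x,y) the claim fails, e.g. n=7 with covers 5<2, 5<7, 2<1, 2<4, 1<3, 4<3, 3<6, 7<6. *)

theory Defs
  imports "HOL-Analysis.Analysis"
begin

section \<open>Posets on a finite set\<close>

text \<open>A poset on \<open>A\<close> is a relation \<open>r\<close> with \<open>partial_order_on A r\<close>; \<open>(x, y) \<in> r\<close> means that
  \<open>x\<close> is weakly below \<open>y\<close>.\<close>

definition less_P :: "'a rel \<Rightarrow> 'a \<Rightarrow> 'a \<Rightarrow> bool" where
  "less_P r x y \<longleftrightarrow> (x, y) \<in> r \<and> x \<noteq> y"

definition covers_P :: "'a rel \<Rightarrow> 'a \<Rightarrow> 'a \<Rightarrow> bool" where
  "covers_P r x y \<longleftrightarrow> less_P r x y \<and> (\<nexists>z. less_P r x z \<and> less_P r z y)"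

definition bounded_poset :: "'a set \<Rightarrow> 'a rel \<Rightarrow> bool" where
  "bounded_poset A r \<longleftrightarrow>
     (\<exists>t\<in>A. \<forall>x\<in>A - {t}. less_P r x t) \<and> (\<exists>b\<in>A. \<forall>x\<in>A - {b}. less_P r b x)"

definition open_interval :: "'a rel \<Rightarrow> 'a \<Rightarrow> 'a \<Rightarrow> 'a set" where
  "open_interval r x y = {z. less_P r x z \<and> less_P r z y}"

definition comparability :: "'a rel \<Rightarrow> 'a set \<Rightarrow> 'a rel" where
  "comparability r I = {(u, v). u \<in> I \<and> v \<in> I \<and> ((u, v) \<in> r \<or> (v, u) \<in> r)}"

text \<open>The connected components of the subposet on \<open>I\<close> are those of its comparability graph.\<close>

definition same_component :: "'a rel \<Rightarrow> 'a set \<Rightarrow> 'a \<Rightarrow> 'a \<Rightarrow> bool" where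
  "same_component r I u v \<longleftrightarrow> u \<in> I \<and> v \<in> I \<and> (u, v) \<in> (comparability r I)\<^sup>*"

definition disconnected_subposet :: "'a rel \<Rightarrow> 'a set \<Rightarrow> bool" where
  "disconnected_subposet r I \<longleftrightarrow> (\<exists>u\<in>I. \<exists>v\<in>I. \<not> same_component r I u v)"

definition chain_2_14_3 :: "nat rel \<Rightarrow> nat \<Rightarrow> nat \<Rightarrow> nat \<Rightarrow> nat \<Rightarrow> bool" where
  "chain_2_14_3 r a b c d \<longleftrightarrow> a < b \<and> b < c \<and> c < d \<and> less_P r b a \<and> covers_P r a d \<and> less_P r d c"

definition chain_3_14_2 :: "nat rel \<Rightarrow> nat \<Rightarrow> nat \<Rightarrow> nat \<Rightarrow> nat \<Rightarrow> bool" where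
  "chain_3_14_2 r a b c d \<longleftrightarrow> a < b \<and> b < c \<and> c < d \<and> less_P r c a \<and> covers_P r a d \<and> less_P r d b"

definition chain_2_41_3 :: "nat rel \<Rightarrow> nat \<Rightarrow> nat \<Rightarrow> nat \<Rightarrow> nat \<Rightarrow> bool" where
  "chain_2_41_3 r a b c d \<longleftrightarrow> a < b \<and> b < c \<and> c < d \<and> less_P r b d \<and> covers_P r d a \<and> less_P r a c"

definition chain_3_41_2 :: "nat rel \<Rightarrow> nat \<Rightarrow> nat \<Rightarrow> nat \<Rightarrow> nat \<Rightarrow> bool" where
  "chain_3_41_2 r a b c d \<longleftrightarrow> a < b \<and> b < c \<and> c < d \<and> less_P r c d \<and> covers_P r d a \<and> less_P r a b"


section \<open>Planar embeddings and the left-of relation\<close>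

text \<open>A drawing is given by the positions \<open>pos\<close> of the vertices; the edges are then determined,
  being line segments.\<close>

definition edge :: "('a \<Rightarrow> real \<times> real) \<Rightarrow> 'a \<Rightarrow> 'a \<Rightarrow> (real \<times> real) set" where
  "edge pos x y = closed_segment (pos x) (pos y)"

definition hasse_diagram :: "'a set \<Rightarrow> 'a rel \<Rightarrow> ('a \<Rightarrow> real \<times> real) \<Rightarrow> bool" where
  "hasse_diagram A r pos \<longleftrightarrow>
     inj_on pos A \<and>
     (\<forall>x y. covers_P r x y \<longrightarrow> snd (pos x) < snd (pos y)) \<and>
     (\<forall>x y. \<forall>z\<in>A. covers_P r x y \<and> pos z \<in> edge pos x y \<longrightarrow> z = x \<or> z = y)"

definition planar_embedding :: "'a set \<Rightarrow> 'a rel \<Rightarrow> ('a \<Rightarrow> real \<times> real) \<Rightarrow> bool" where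
  "planar_embedding A r pos \<longleftrightarrow>
     hasse_diagram A r pos \<and>
     (\<forall>x y x' y'. covers_P r x y \<and> covers_P r x' y' \<and> (x, y) \<noteq> (x', y') \<longrightarrow>
        edge pos x y \<inter> edge pos x' y' \<subseteq> pos ` ({x, y} \<inter> {x', y'}))"

definition drawn_chain :: "'a rel \<Rightarrow> ('a \<Rightarrow> real \<times> real) \<Rightarrow> 'a set \<Rightarrow> (real \<times> real) set" where
  "drawn_chain r pos C = pos ` C \<union> \<Union>{edge pos u v |u v. u \<in> C \<and> v \<in> C \<and> covers_P r u v}"

definition drawn_chains_through :: "'a rel \<Rightarrow> ('a \<Rightarrow> real \<times> real) \<Rightarrow> 'a \<Rightarrow> (real \<times> real) set" where
  "drawn_chains_through r pos x = \<Union>{drawn_chain r pos C |C. C \<in> Chains r \<and> x \<in> C}"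

definition S_region :: "'a rel \<Rightarrow> ('a \<Rightarrow> real \<times> real) \<Rightarrow> 'a \<Rightarrow> (real \<times> real) set" where
  "S_region r pos x = drawn_chains_through r pos x \<union>
     \<Union>{closed_segment p q |p q. p \<in> drawn_chains_through r pos x \<and>
         q \<in> drawn_chains_through r pos x \<and> snd p = snd q}"

definition left_of :: "'a rel \<Rightarrow> ('a \<Rightarrow> real \<times> real) \<Rightarrow> 'a \<Rightarrow> 'a \<Rightarrow> bool" where
  "left_of r pos x y \<longleftrightarrow> pos y \<notin> S_region r pos x \<and>
     (\<exists>t\<ge>0. (fst (pos y) - t, snd (pos y)) \<in> S_region r pos x)"


section \<open>Baxter posets\<close>

text \<open>The final condition compares \<open>w\<close> and \<open>z\<close> only when they lie in different connected
  components of the open interval from \<open>x\<close> to \<open>y\<close>. Without this restriction the condition would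
  fail for adjacency posets of some diagonal rectangulations, because one component may itself
  contain incomparable elements. Such examples exist from size 7 on; one of them has the cover
  relations 5 < 2, 5 < 7, 2 < 1, 2 < 4, 1 < 3, 4 < 3, 3 < 6, 7 < 6. There the open interval from
  5 to 6 has the components {1, 2, 3, 4} and {7}, and in every planar embedding one of the
  incomparable elements 1 and 4 is left of the other, although 5 is not numerically between
  them.\<close>

definition baxter_poset :: "nat \<Rightarrow> nat rel \<Rightarrow> bool" where
  "baxter_poset n r \<longleftrightarrow>
     partial_order_on {1..n} r \<and>
     bounded_poset {1..n} r \<and>
     (\<forall>x\<in>{1..n}. card {y. covers_P r x y} \<le> 2 \<and> card {y. covers_P r y x} \<le> 2) \<and>
     (\<nexists>a b c d. chain_2_14_3 r a b c d \<or> chain_3_14_2 r a b c d \<or>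
                chain_2_41_3 r a b c d \<or> chain_3_41_2 r a b c d) \<and>
     (\<forall>x y. (x, y) \<in> r \<and> disconnected_subposet r (open_interval r x y) \<longrightarrow>
        \<bar>int x - int y\<bar> = 1) \<and>
     (\<exists>pos. planar_embedding {1..n} r pos \<and>
        (\<forall>x y. (x, y) \<in> r \<and> disconnected_subposet r (open_interval r x y) \<longrightarrow>
          (\<forall>w\<in>open_interval r x y. \<forall>z\<in>open_interval r x y.
             \<not> same_component r (open_interval r x y) w z \<and> left_of r pos w z \<longrightarrow>
             w < x \<and> x < z)))"


section \<open>Diagonal rectangulations\<close>

definition unit_square :: "(real \<times> real) set" where
  "unit_square = cbox (0, 0) (1, 1)"

definition square_vertices :: "(real \<times> real) set" where
  "square_vertices = {(0, 0), (1, 0), (0, 1), (1, 1)}"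

definition main_diagonal :: "(real \<times> real) set" where
  "main_diagonal = closed_segment (0, 1) (1, 0)"

text \<open>\<open>division_of\<close> allows degenerate boxes, which are excluded here.\<close>

definition decomposition :: "nat \<Rightarrow> (real \<times> real) set set \<Rightarrow> bool" where
  "decomposition n D \<longleftrightarrow>
     D division_of unit_square \<and> card D = n \<and> (\<forall>K\<in>D. interior K \<noteq> {})"

definition equivalent_decompositions ::
    "(real \<times> real) set set \<Rightarrow> (real \<times> real) set set \<Rightarrow> bool" where
  "equivalent_decompositions D E \<longleftrightarrow>
     (\<exists>f g. homeomorphism unit_square unit_square f g \<and>
        (\<forall>v\<in>square_vertices. f v = v) \<and> (\<lambda>K. f ` K) ` D = E)"

definition rectangulation :: "nat \<Rightarrow> (real \<times> real) set set set \<Rightarrow> bool" where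
  "rectangulation n R \<longleftrightarrow>
     (\<exists>D. decomposition n D \<and> R = {E. decomposition n E \<and> equivalent_decompositions D E})"

definition meets_all_rectangles :: "(real \<times> real) set set \<Rightarrow> bool" where
  "meets_all_rectangles D \<longleftrightarrow> (\<forall>K\<in>D. main_diagonal \<inter> interior K \<noteq> {})"

definition diagonal_rectangulation :: "nat \<Rightarrow> (real \<times> real) set set set \<Rightarrow> bool" where
  "diagonal_rectangulation n R \<longleftrightarrow> rectangulation n R \<and> (\<exists>D\<in>R. meets_all_rectangles D)"

text \<open>The edges of a decomposition, the sides of the square included, form the union of the
  frontiers of its rectangles.\<close>

definition distinguished_representative ::
    "nat \<Rightarrow> (real \<times> real) set set set \<Rightarrow> (real \<times> real) set set \<Rightarrow> bool" where
  "distinguished_representative n R D \<longleftrightarrow>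
     D \<in> R \<and> meets_all_rectangles D \<and>
     (\<Union>K\<in>D. frontier K) \<inter> main_diagonal = (\<lambda>i. (real i / real n, 1 - real i / real n)) ` {0..n}"

text \<open>\<open>\<rho> i\<close> is rectangle \<open>i\<close>. Moving along the diagonal from the upper left, the first
  coordinate increases.\<close>

definition diagonal_labeling ::
    "nat \<Rightarrow> (real \<times> real) set set \<Rightarrow> (nat \<Rightarrow> (real \<times> real) set) \<Rightarrow> bool" where
  "diagonal_labeling n D \<rho> \<longleftrightarrow>
     bij_betw \<rho> {1..n} D \<and>
     (\<forall>i\<in>{1..n}. \<forall>j\<in>{1..n}. i < j \<longrightarrow>
        (\<forall>p\<in>main_diagonal \<inter> interior (\<rho> i). \<forall>q\<in>main_diagonal \<inter> interior (\<rho> j). fst p < fst q))"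

definition left_side :: "(real \<times> real) set \<Rightarrow> (real \<times> real) set" where
  "left_side K = {p\<in>K. \<forall>q\<in>K. fst p \<le> fst q}"

definition right_side :: "(real \<times> real) set \<Rightarrow> (real \<times> real) set" where
  "right_side K = {p\<in>K. \<forall>q\<in>K. fst q \<le> fst p}"

definition bottom_side :: "(real \<times> real) set \<Rightarrow> (real \<times> real) set" where
  "bottom_side K = {p\<in>K. \<forall>q\<in>K. snd p \<le> snd q}"

definition top_side :: "(real \<times> real) set \<Rightarrow> (real \<times> real) set" where
  "top_side K = {p\<in>K. \<forall>q\<in>K. snd q \<le> snd p}"

definition adjacency :: "nat \<Rightarrow> (nat \<Rightarrow> (real \<times> real) set) \<Rightarrow> nat rel" where
  "adjacency n \<rho> = {(x, y). x \<in> {1..n} \<and> y \<in> {1..n} \<and>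
     (rel_interior (bottom_side (\<rho> y)) \<union> rel_interior (left_side (\<rho> y))) \<inter>
     (rel_interior (top_side (\<rho> x)) \<union> rel_interior (right_side (\<rho> x))) \<noteq> {}}"

definition is_adjacency_poset_of :: "nat \<Rightarrow> nat rel \<Rightarrow> (real \<times> real) set set set \<Rightarrow> bool" where
  "is_adjacency_poset_of n r R \<longleftrightarrow>
     (\<exists>D \<rho>. distinguished_representative n R D \<and> diagonal_labeling n D \<rho> \<and>
        r = Id_on {1..n} \<union> (adjacency n \<rho>)\<^sup>+)"

end

(* Both sides are equivalent to a third condition on a bounded poset P: every cover x <. y is
   uniform, i.e. either all labels strictly between x and y lie below x in P, or all of them lie
   above y in P.

   Baxter => uniform.  In a planar embedding, two maximal chains that change sides share a vertex;
   hence P is a lattice and of two incomparable elements one is left of the other.  For two covers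
   m1, m2 of m with join s, the interval (m, s) is disconnected, so m separates the labels of its
   two sides and |m - s| = 1.  An induction from the top then shows that the meet (dually, the
   join) of two incomparable elements always has a label between theirs.  This forces every label
   between x and y, for a cover x <. y, to be below x or above y; the forbidden chains exclude a
   mixture of the two.

   Uniform => Baxter.  A chain from x to z must jump over each label k between them by a cover, and
   that cover compares k with x or z.  So breaking the ties of incomparable elements by increasing,
   resp. decreasing, label gives two linear extensions, and P is their intersection.  The dominance
   drawing of this realizer is planar because P is a lattice, and in it left-of agrees with the
   order of the labels.

   Uniform <=> adjacency poset.  If rows are numbered downwards, the unit cell in column p and row q
   of a diagonal rectangulation belongs to the rectangle min {p..q} (p <= q) or max {q..p}
   (q <= p), the extrema being taken in P.  Read from right to left this constructs the
   rectangulation; the covers of P are adjacencies of rectangles, whence their uniformity. *)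
theory Submission
  imports Defs
begin

section \<open>Finite posets\<close>

text \<open>Being a lattice is not among the hypotheses: for a Baxter poset it has to come from the
  drawing, for a uniform one from the labels. Hence maximal lower and minimal upper bounds take the
  place of meets and joins until \<open>interpolating\<close>, a self-dual form of the lattice
  property, is available. Uniformity speaks of covers only and is invariant under reversal of the
  order and of the number line, so facts are proved once and carried over by
  \<open>r\<inverse>\<close> or by an orientation \<open>f\<close>. In a given drawing a maximal
  chain is the graph of a continuous function of the height, and planarity is used through the
  intermediate value theorem for two such functions. On the uniform side the recurring fact is that
  the bounds of two incomparable elements have labels between theirs. It limits the number of
  covers, makes minimal upper bounds unique and gives every interval of labels a least element in P,
  which is what the rectangulation is built from.\<close>

lemma less_P_converse [simp]: "less_P (r\<inverse>) x y \<longleftrightarrow> less_P r y x"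
  by (auto simp: less_P_def)

lemma covers_P_converse [simp]: "covers_P (r\<inverse>) x y \<longleftrightarrow> covers_P r y x"
  by (auto simp: covers_P_def)

lemma open_interval_converse [simp]: "open_interval (r\<inverse>) x y = open_interval r y x"
  by (auto simp: open_interval_def)

lemma comparability_converse [simp]: "comparability (r\<inverse>) I = comparability r I"
  by (auto simp: comparability_def)

lemma same_component_converse [simp]: "same_component (r\<inverse>) I = same_component r I"
  by (simp add: same_component_def fun_eq_iff)

lemma disconnected_subposet_converse [simp]:
  "disconnected_subposet (r\<inverse>) I = disconnected_subposet r I"
  by (simp add: disconnected_subposet_def)

lemma bounded_poset_converse [simp]: "bounded_poset A (r\<inverse>) \<longleftrightarrow> bounded_poset A r"
  by (auto simp: bounded_poset_def)

locale finite_poset =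
  fixes A :: "'a set" and r :: "'a rel"
  assumes partial_order: "partial_order_on A r" and finite_carrier: "finite A"
begin

abbreviation le (infix "\<sqsubseteq>" 50) where "x \<sqsubseteq> y \<equiv> (x, y) \<in> r"
abbreviation lt (infix "\<sqsubset>" 50) where "x \<sqsubset> y \<equiv> less_P r x y"

definition par (infix "\<parallel>" 50) where
  "x \<parallel> y \<longleftrightarrow> x \<in> A \<and> y \<in> A \<and> \<not> x \<sqsubseteq> y \<and> \<not> y \<sqsubseteq> x"

lemma dual: "finite_poset A (r\<inverse>)"
  using partial_order finite_carrier by (simp add: finite_poset_def)

lemma le_carrier: assumes "x \<sqsubseteq> y" shows "x \<in> A" "y \<in> A"
  using partial_order_onD(4)[OF partial_order] assms by auto

lemma le_refl: "x \<in> A \<Longrightarrow> x \<sqsubseteq> x"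
  using partial_order_onD(1)[OF partial_order] by (auto simp: refl_on_def)

lemma le_trans: "x \<sqsubseteq> y \<Longrightarrow> y \<sqsubseteq> z \<Longrightarrow> x \<sqsubseteq> z"
  using partial_order_onD(2)[OF partial_order] by (meson transD)

lemma le_antisym: "x \<sqsubseteq> y \<Longrightarrow> y \<sqsubseteq> x \<Longrightarrow> x = y"
  using partial_order_onD(3)[OF partial_order] by (meson antisymD)

lemma lt_le: "x \<sqsubset> y \<Longrightarrow> x \<sqsubseteq> y" and lt_neq: "x \<sqsubset> y \<Longrightarrow> x \<noteq> y"
  and lt_carrier: "x \<sqsubset> y \<Longrightarrow> x \<in> A" "x \<sqsubset> y \<Longrightarrow> y \<in> A"
  using le_carrier by (auto simp: less_P_def)

lemma lt_le_trans: "x \<sqsubset> y \<Longrightarrow> y \<sqsubseteq> z \<Longrightarrow> x \<sqsubset> z"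
  and le_lt_trans: "x \<sqsubseteq> y \<Longrightarrow> y \<sqsubset> z \<Longrightarrow> x \<sqsubset> z"
  and lt_trans: "x \<sqsubset> y \<Longrightarrow> y \<sqsubset> z \<Longrightarrow> x \<sqsubset> z"
  using le_trans le_antisym unfolding less_P_def by blast+

lemma lt_irrefl: "\<not> x \<sqsubset> x" and lt_not_le: "x \<sqsubset> y \<Longrightarrow> \<not> y \<sqsubseteq> x"
  using le_antisym by (auto simp: less_P_def)

lemma le_imp_lt_or_eq: "x \<sqsubseteq> y \<Longrightarrow> x \<sqsubset> y \<or> x = y"
  by (auto simp: less_P_def)

lemma cases_le: "x \<in> A \<Longrightarrow> y \<in> A \<Longrightarrow> x \<sqsubset> y \<or> x = y \<or> y \<sqsubset> x \<or> x \<parallel> y"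
  by (auto simp: less_P_def par_def)

lemma par_sym: "x \<parallel> y \<Longrightarrow> y \<parallel> x"
  by (auto simp: par_def)

lemma par_neq: "x \<parallel> y \<Longrightarrow> x \<noteq> y"
  using le_refl by (auto simp: par_def)

lemma par_converse: "finite_poset.par A (r\<inverse>) x y \<longleftrightarrow> x \<parallel> y"
  by (auto simp: finite_poset.par_def[OF dual] par_def)

lemma ex_maximal:
  assumes "S \<subseteq> A" "S \<noteq> {}"
  obtains m where "m \<in> S" "\<And>x. x \<in> S \<Longrightarrow> \<not> m \<sqsubset> x"
proof -
  have "finite S" using assms finite_carrier finite_subset by blast
  moreover have "asymp_on S (less_P r)" "transp_on S (less_P r)"
    using lt_trans lt_irrefl unfolding asymp_on_def transp_on_def by blast+
  ultimately obtain m where "m \<in> S" "\<forall>x\<in>S. x \<noteq> m \<longrightarrow> \<not> m \<sqsubset> x"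
    using Finite_Set.bex_max_element[of S "less_P r"] assms by blast
  then show ?thesis using that lt_irrefl by metis
qed

lemma ex_maximal_above:
  assumes "S \<subseteq> A" "x \<in> S"
  obtains m where "m \<in> S" "x \<sqsubseteq> m" "\<And>z. z \<in> S \<Longrightarrow> \<not> m \<sqsubset> z"
proof -
  obtain m where m: "m \<in> {z\<in>S. x \<sqsubseteq> z}" "\<And>z. z \<in> {z\<in>S. x \<sqsubseteq> z} \<Longrightarrow> \<not> m \<sqsubset> z"
    using ex_maximal[of "{z\<in>S. x \<sqsubseteq> z}"] assms le_refl by blast
  then show ?thesis using that le_trans lt_le by blast
qed

lemma ex_minimal_below:
  assumes "S \<subseteq> A" "x \<in> S"
  obtains m where "m \<in> S" "m \<sqsubseteq> x" "\<And>z. z \<in> S \<Longrightarrow> \<not> z \<sqsubset> m"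
  using finite_poset.ex_maximal_above[OF dual assms] by simp blast

lemma lower_cover:
  assumes "x \<sqsubset> y"
  obtains u where "x \<sqsubseteq> u" "covers_P r u y"
proof -
  obtain u where u: "u \<in> {z. x \<sqsubseteq> z \<and> z \<sqsubset> y}" "\<And>z. z \<in> {z. x \<sqsubseteq> z \<and> z \<sqsubset> y} \<Longrightarrow> \<not> u \<sqsubset> z"
    using ex_maximal[of "{z. x \<sqsubseteq> z \<and> z \<sqsubset> y}"] assms le_refl lt_carrier by blast
  then have "covers_P r u y" using le_trans lt_le unfolding covers_P_def by blast
  then show ?thesis using that u by blast
qed

lemma upper_cover:
  assumes "x \<sqsubset> y"
  obtains u where "covers_P r x u" "u \<sqsubseteq> y"
  using finite_poset.lower_cover[OF dual, of y x] assms by auto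

lemma cover_lt: "covers_P r x y \<Longrightarrow> x \<sqsubset> y"
  by (simp add: covers_P_def)

lemma cover_between: "covers_P r x y \<Longrightarrow> x \<sqsubseteq> z \<Longrightarrow> z \<sqsubseteq> y \<Longrightarrow> z = x \<or> z = y"
  by (auto simp: covers_P_def less_P_def)

lemma covers_antichain: "covers_P r x y \<Longrightarrow> covers_P r x z \<Longrightarrow> y \<noteq> z \<Longrightarrow> y \<parallel> z"
  using cases_le lt_carrier unfolding covers_P_def by blast

text \<open>Maximal instead of greatest: existence then needs only finiteness and one common lower
  bound. \<open>max_lb_greatest\<close> upgrades it once interpolation is known.\<close>

definition max_lb where
  "max_lb m x y \<longleftrightarrow> m \<sqsubseteq> x \<and> m \<sqsubseteq> y \<and> (\<forall>l. l \<sqsubseteq> x \<and> l \<sqsubseteq> y \<longrightarrow> \<not> m \<sqsubset> l)"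

definition min_ub where
  "min_ub m x y \<longleftrightarrow> x \<sqsubseteq> m \<and> y \<sqsubseteq> m \<and> (\<forall>l. x \<sqsubseteq> l \<and> y \<sqsubseteq> l \<longrightarrow> \<not> l \<sqsubset> m)"

lemma max_lb_converse: "finite_poset.max_lb (r\<inverse>) m x y \<longleftrightarrow> min_ub m x y"
  by (auto simp: finite_poset.max_lb_def[OF dual] min_ub_def)

lemma min_ub_converse: "finite_poset.min_ub (r\<inverse>) m x y \<longleftrightarrow> max_lb m x y"
  by (auto simp: finite_poset.min_ub_def[OF dual] max_lb_def)

lemma ex_max_lb:
  assumes "l \<sqsubseteq> x" "l \<sqsubseteq> y" obtains m where "l \<sqsubseteq> m" "max_lb m x y"
proof -
  obtain m where m: "m \<in> {l. l \<sqsubseteq> x \<and> l \<sqsubseteq> y}" "l \<sqsubseteq> m" "\<And>z. z \<in> {l. l \<sqsubseteq> x \<and> l \<sqsubseteq> y} \<Longrightarrow> \<not> m \<sqsubset> z"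
    using ex_maximal_above[of "{l. l \<sqsubseteq> x \<and> l \<sqsubseteq> y}" l] assms le_carrier by blast
  then show ?thesis using that unfolding max_lb_def by blast
qed

lemma ex_min_ub:
  assumes "x \<sqsubseteq> l" "y \<sqsubseteq> l" obtains m where "m \<sqsubseteq> l" "min_ub m x y"
  using finite_poset.ex_max_lb[OF dual, of l x y] assms unfolding max_lb_converse by auto

lemma max_lb_sym: "max_lb m x y \<Longrightarrow> max_lb m y x" and min_ub_sym: "min_ub m x y \<Longrightarrow> min_ub m y x"
  by (auto simp: max_lb_def min_ub_def)

lemma top_exists:
  assumes "bounded_poset A r" obtains t where "t \<in> A" "\<And>x. x \<in> A \<Longrightarrow> x \<sqsubseteq> t"
  using assms le_refl lt_le unfolding bounded_poset_def by (metis Diff_iff singletonD)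

lemma bot_exists:
  assumes "bounded_poset A r" obtains t where "t \<in> A" "\<And>x. x \<in> A \<Longrightarrow> t \<sqsubseteq> x"
  using assms le_refl lt_le unfolding bounded_poset_def by (metis Diff_iff singletonD)

lemma diff_component_par:
  assumes "u \<in> open_interval r x y" "v \<in> open_interval r x y"
    "\<not> same_component r (open_interval r x y) u v"
  shows "u \<parallel> v"
proof -
  have "(u, v) \<notin> comparability r (open_interval r x y)"
    using assms by (auto simp: same_component_def)
  then show ?thesis using assms lt_carrier by (auto simp: comparability_def par_def open_interval_def)
qed

lemma same_component_sym: "same_component r I u v \<Longrightarrow> same_component r I v u"
proof -
  have "sym ((comparability r I)\<^sup>*)" by (rule sym_rtrancl) (auto simp: sym_def comparability_def)
  then show "same_component r I u v \<Longrightarrow> same_component r I v u"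
    by (auto simp: same_component_def dest: symD)
qed

lemma same_component_trans:
  "same_component r I u v \<Longrightarrow> same_component r I v w \<Longrightarrow> same_component r I u w"
  by (auto simp: same_component_def)

lemma comparable_same_component:
  "u \<in> I \<Longrightarrow> v \<in> I \<Longrightarrow> u \<sqsubseteq> v \<Longrightarrow> same_component r I u v"
  by (auto simp: same_component_def comparability_def)

text \<open>A common bound inside the open interval would connect the two components.\<close>

lemma diff_component_max_lb:
  assumes "w \<in> open_interval r x y" "z \<in> open_interval r x y"
    "\<not> same_component r (open_interval r x y) w z"
  shows "max_lb x w z"
proof -
  have "\<not> x \<sqsubset> l" if "l \<sqsubseteq> w" "l \<sqsubseteq> z" for l
  proof
    assume "x \<sqsubset> l"
    then have "l \<in> open_interval r x y"
      using that assms le_lt_trans by (auto simp: open_interval_def)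
    then show False
      using that assms comparable_same_component same_component_sym same_component_trans by meson
  qed
  then show ?thesis using assms lt_le by (auto simp: max_lb_def open_interval_def)
qed

lemma diff_component_min_ub:
  assumes "w \<in> open_interval r x y" "z \<in> open_interval r x y"
    "\<not> same_component r (open_interval r x y) w z"
  shows "min_ub y w z"
  using finite_poset.diff_component_max_lb[OF dual, of w y x z] assms
  by (simp add: max_lb_converse)

text \<open>For a finite bounded poset this is equivalent to being a lattice. Unlike the usual
  definition it is literally invariant under reversal of the order, and two crossing chains supply
  it directly.\<close>

definition interpolating where
  "interpolating \<longleftrightarrow> (\<forall>a b c d. a \<sqsubseteq> b \<and> a \<sqsubseteq> d \<and> c \<sqsubseteq> b \<and> c \<sqsubseteq> d \<longrightarrow>
     (\<exists>j. a \<sqsubseteq> j \<and> c \<sqsubseteq> j \<and> j \<sqsubseteq> b \<and> j \<sqsubseteq> d))"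

text \<open>If the two lower or the two upper elements are comparable, one of the four elements is
  itself the interpolant.\<close>

lemma interpolatingI:
  assumes "\<And>a b c d. a \<parallel> c \<Longrightarrow> b \<parallel> d \<Longrightarrow> a \<sqsubseteq> b \<Longrightarrow> a \<sqsubseteq> d \<Longrightarrow> c \<sqsubseteq> b \<Longrightarrow> c \<sqsubseteq> d \<Longrightarrow>
    \<exists>j. a \<sqsubseteq> j \<and> c \<sqsubseteq> j \<and> j \<sqsubseteq> b \<and> j \<sqsubseteq> d"
  shows interpolating
  unfolding interpolating_def
proof (intro allI impI, elim conjE)
  fix a b c d assume le: "a \<sqsubseteq> b" "a \<sqsubseteq> d" "c \<sqsubseteq> b" "c \<sqsubseteq> d"
  have mem: "a \<in> A" "b \<in> A" "c \<in> A" "d \<in> A" using le le_carrier by auto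
  then consider "a \<parallel> c \<and> b \<parallel> d" | "a \<sqsubseteq> c" | "c \<sqsubseteq> a" | "b \<sqsubseteq> d" | "d \<sqsubseteq> b"
    by (auto simp: par_def)
  then show "\<exists>j. a \<sqsubseteq> j \<and> c \<sqsubseteq> j \<and> j \<sqsubseteq> b \<and> j \<sqsubseteq> d"
  proof cases
    case 1 then show ?thesis using assms le by blast
  next
    case 2 then show ?thesis using le le_refl[OF mem(3)] by blast
  next
    case 3 then show ?thesis using le le_refl[OF mem(1)] by blast
  next
    case 4 then show ?thesis using le le_refl[OF mem(2)] by blast
  next
    case 5 then show ?thesis using le le_refl[OF mem(4)] by blast
  qed
qed

lemma interpolating_converse: "finite_poset.interpolating (r\<inverse>) \<longleftrightarrow> interpolating"
proof -
  have "finite_poset.interpolating (s\<inverse>)"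
    if "finite_poset B s" "finite_poset.interpolating s" for B and s :: "'a rel"
    unfolding finite_poset.interpolating_def[OF finite_poset.dual[OF that(1)]] converse_iff
  proof (intro allI impI)
    fix a b c d assume "(b, a) \<in> s \<and> (d, a) \<in> s \<and> (b, c) \<in> s \<and> (d, c) \<in> s"
    then show "\<exists>j. (j, a) \<in> s \<and> (j, c) \<in> s \<and> (b, j) \<in> s \<and> (d, j) \<in> s"
      using that(2)[unfolded finite_poset.interpolating_def[OF that(1)], rule_format, of b a c d] by blast
  qed
  from this[OF finite_poset_axioms] this[OF dual] show ?thesis by auto
qed

lemma max_lb_greatest:
  assumes "interpolating" "max_lb m x y" "l \<sqsubseteq> x" "l \<sqsubseteq> y" shows "l \<sqsubseteq> m"
proof -
  obtain j where "l \<sqsubseteq> j" "m \<sqsubseteq> j" "j \<sqsubseteq> x" "j \<sqsubseteq> y"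
    using assms unfolding interpolating_def max_lb_def by meson
  then show ?thesis using assms le_imp_lt_or_eq unfolding max_lb_def by metis
qed

lemma min_ub_least:
  assumes "interpolating" "min_ub m x y" "x \<sqsubseteq> l" "y \<sqsubseteq> l" shows "m \<sqsubseteq> l"
  using finite_poset.max_lb_greatest[OF dual, of m x y l] assms
  by (simp add: max_lb_converse interpolating_converse)

end

definition btw :: "nat \<Rightarrow> nat \<Rightarrow> nat \<Rightarrow> bool" where
  "btw k x y \<longleftrightarrow> x < k \<and> k < y \<or> y < k \<and> k < x"

lemma btw_sym: "btw k x y \<Longrightarrow> btw k y x"
  by (auto simp: btw_def)

locale nat_poset = finite_poset A r for A :: "nat set" and r

section \<open>Planar embeddings\<close>

text \<open>A segment that is not horizontal is a graph over the height, which is affine in the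
  parameter.\<close>

lemma segment_height:
  fixes a b :: "real \<times> real"
  assumes "snd a < snd b" "p \<in> closed_segment a b"
  shows "snd a \<le> snd p" "snd p \<le> snd b"
    "snd p = snd a \<Longrightarrow> p = a" "snd p = snd b \<Longrightarrow> p = b"
    "q \<in> closed_segment a b \<Longrightarrow> snd q = snd p \<Longrightarrow> q = p"
proof -
  obtain t where t: "0 \<le> t" "t \<le> 1" "p = (1 - t) *\<^sub>R a + t *\<^sub>R b"
    using assms by (auto simp: in_segment)
  have h: "snd p = snd a + t * (snd b - snd a)" unfolding t(3) by (simp add: algebra_simps)
  show "snd a \<le> snd p" using h t assms by simp
  have "t * (snd b - snd a) \<le> 1 * (snd b - snd a)" using t assms by (intro mult_right_mono) auto
  then show "snd p \<le> snd b" using h by simp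
  show "p = a" if "snd p = snd a" using h that assms t by simp
  show "p = b" if "snd p = snd b"
  proof -
    have "(t - 1) * (snd b - snd a) = 0" using h that by (simp add: algebra_simps)
    then show ?thesis using assms t by simp
  qed
  show "q = p" if q: "q \<in> closed_segment a b" "snd q = snd p"
  proof -
    obtain s where s: "q = (1 - s) *\<^sub>R a + s *\<^sub>R b" using q by (auto simp: in_segment)
    have "snd q = snd a + s * (snd b - snd a)" unfolding s by (simp add: algebra_simps)
    then have "s = t" using h q assms by simp
    then show ?thesis using s t by simp
  qed
qed

lemma segment_at_height:
  fixes a b :: "real \<times> real"
  assumes "snd a < snd b" "snd a \<le> t" "t \<le> snd b"
  shows "\<exists>x. (x, t) \<in> closed_segment a b"
proof -
  define s where "s = (t - snd a) / (snd b - snd a)"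
  have s: "0 \<le> s" "s \<le> 1" "s * (snd b - snd a) = t - snd a" using assms by (auto simp: s_def)
  have "snd ((1 - s) *\<^sub>R a + s *\<^sub>R b) = t" using s(3) by (simp add: algebra_simps)
  moreover have "(1 - s) *\<^sub>R a + s *\<^sub>R b \<in> closed_segment a b" using s by (auto simp: in_segment)
  ultimately show ?thesis by (metis prod.collapse)
qed

locale planar_poset = finite_poset +
  fixes pos :: "'a \<Rightarrow> real \<times> real"
  assumes planar: "planar_embedding A r pos" and bounded: "bounded_poset A r"
begin

abbreviation height where "height x \<equiv> snd (pos x)"
abbreviation drawn where "drawn C \<equiv> drawn_chain r pos C"

lemma inj_pos: "inj_on pos A"
  using planar by (simp add: planar_embedding_def hasse_diagram_def)

lemma cover_height: "covers_P r x y \<Longrightarrow> height x < height y"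
  using planar by (simp add: planar_embedding_def hasse_diagram_def)

lemma vertex_on_edge: "covers_P r x y \<Longrightarrow> z \<in> A \<Longrightarrow> pos z \<in> edge pos x y \<Longrightarrow> z = x \<or> z = y"
  using planar unfolding planar_embedding_def hasse_diagram_def by blast

lemma edges_cross:
  "covers_P r x y \<Longrightarrow> covers_P r x' y' \<Longrightarrow> (x, y) \<noteq> (x', y') \<Longrightarrow>
    p \<in> edge pos x y \<Longrightarrow> p \<in> edge pos x' y' \<Longrightarrow> \<exists>z. z \<in> {x, y} \<and> z \<in> {x', y'} \<and> p = pos z"
  using planar unfolding planar_embedding_def by blast

text \<open>A drawing constrains covers only. Among the violations above \<open>x\<close> take a
  minimal one \<open>z\<close>; a lower cover of \<open>z\<close> towards \<open>x\<close> is no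
  violation, yet lies below \<open>z\<close> in the drawing.\<close>

lemma lt_height: "x \<sqsubset> y \<Longrightarrow> height x < height y"
proof (rule ccontr)
  assume "x \<sqsubset> y" "\<not> height x < height y"
  then obtain z where z: "z \<in> {y. x \<sqsubset> y \<and> \<not> height x < height y}"
      "\<And>w. w \<in> {y. x \<sqsubset> y \<and> \<not> height x < height y} \<Longrightarrow> \<not> w \<sqsubset> z"
    by - (rule ex_minimal_below[of "{y. x \<sqsubset> y \<and> \<not> height x < height y}" y],
      auto dest: lt_carrier)
  then obtain u where "x \<sqsubseteq> u" "covers_P r u z" using lower_cover by blast
  moreover have "height x \<le> height u"
  proof (cases "x = u")
    case False
    then have "x \<sqsubset> u" using \<open>x \<sqsubseteq> u\<close> by (simp add: less_P_def)
    then show ?thesis using z(2)[of u] cover_lt[OF \<open>covers_P r u z\<close>] by fastforce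
  qed simp
  ultimately show False using z cover_height[of u z] by simp
qed

lemma le_height: "x \<sqsubseteq> y \<Longrightarrow> height x \<le> height y"
  using lt_height le_imp_lt_or_eq by fastforce

lemma drawn_cases:
  assumes "p \<in> drawn C"
  obtains u where "u \<in> C" "p = pos u"
  | u v where "u \<in> C" "v \<in> C" "covers_P r u v" "p \<in> edge pos u v"
  using assms unfolding drawn_chain_def by blast

lemma edge_drawn: "u \<in> C \<Longrightarrow> v \<in> C \<Longrightarrow> covers_P r u v \<Longrightarrow> p \<in> edge pos u v \<Longrightarrow> p \<in> drawn C"
  unfolding drawn_chain_def by blast

lemma pos_drawn: "u \<in> C \<Longrightarrow> pos u \<in> drawn C"
  unfolding drawn_chain_def by blast

lemma edge_height:
  assumes "covers_P r u v" "p \<in> edge pos u v"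
  shows "height u \<le> snd p" "snd p \<le> height v"
    "snd p = height u \<Longrightarrow> p = pos u" "snd p = height v \<Longrightarrow> p = pos v"
    "q \<in> edge pos u v \<Longrightarrow> snd q = snd p \<Longrightarrow> q = p"
  using segment_height[OF cover_height[OF assms(1)]] assms(2) unfolding edge_def by blast+

section \<open>Drawn chains as graphs over the height\<close>

lemma chainD: "C \<in> Chains r \<Longrightarrow> u \<in> C \<Longrightarrow> v \<in> C \<Longrightarrow> u \<sqsubseteq> v \<or> v \<sqsubseteq> u"
  by (auto simp: Chains_def)

lemma chain_height_le: "C \<in> Chains r \<Longrightarrow> u \<in> C \<Longrightarrow> v \<in> C \<Longrightarrow> height u < height v \<Longrightarrow> u \<sqsubset> v"
  using chainD le_height le_imp_lt_or_eq by fastforce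

lemma chain_subset: "C \<in> Chains r \<Longrightarrow> C \<subseteq> A"
  using chainD le_carrier by blast

lemma vertex_drawn: "C \<in> Chains r \<Longrightarrow> x \<in> A \<Longrightarrow> pos x \<in> drawn C \<Longrightarrow> x \<in> C"
proof (erule drawn_cases)
  fix u assume "C \<in> Chains r" "x \<in> A" "u \<in> C" "pos x = pos u"
  then show "x \<in> C" using chain_subset inj_onD[OF inj_pos] by blast
next
  fix u v assume "x \<in> A" "u \<in> C" "v \<in> C" "covers_P r u v" "pos x \<in> edge pos u v"
  then show "x \<in> C" using vertex_on_edge by blast
qed

lemma chain_vertex_edge:
  assumes C: "C \<in> Chains r" "u \<in> C" "v \<in> C" "w \<in> C" "covers_P r u v"
  shows "w \<sqsubseteq> u \<or> v \<sqsubseteq> w"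
proof -
  have "w \<sqsubseteq> u \<or> u \<sqsubseteq> w" "w \<sqsubseteq> v \<or> v \<sqsubseteq> w" using C chainD by blast+
  then show ?thesis using cover_between[OF C(5), of w] C le_refl chain_subset by blast
qed

lemma vertex_edge_unique:
  assumes C: "C \<in> Chains r" "u \<in> C" "v \<in> C" "w \<in> C" "covers_P r u v" "p \<in> edge pos u v"
    and "snd p = height w"
  shows "p = pos w"
proof -
  consider "w \<sqsubseteq> u" | "v \<sqsubseteq> w" using chain_vertex_edge[OF C(1-5)] by blast
  then show ?thesis
  proof cases
    case 1
    then have "snd p = height u" using le_height[OF 1] edge_height(1)[OF C(5,6)] assms by simp
    moreover from this have "w = u" using 1 le_imp_lt_or_eq lt_height assms by fastforce
    ultimately show ?thesis using edge_height(3)[OF C(5,6)] by simp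
  next
    case 2
    then have "snd p = height v" using le_height[OF 2] edge_height(2)[OF C(5,6)] assms by simp
    moreover from this have "w = v" using 2 le_imp_lt_or_eq lt_height assms by fastforce
    ultimately show ?thesis using edge_height(4)[OF C(5,6)] by simp
  qed
qed

text \<open>The vertices of a chain are ordered by height, and two different edges of a chain share
  a height at most at a common vertex.\<close>

lemma drawn_unique:
  assumes C: "C \<in> Chains r" and p: "p \<in> drawn C" and q: "q \<in> drawn C" and pq: "snd p = snd q"
  shows "p = q"
  using p
proof (cases rule: drawn_cases)
  case (1 u)
  note u = this
  show ?thesis using q
  proof (cases rule: drawn_cases)
    case (1 u')
    then have "\<not> u \<sqsubset> u'" "\<not> u' \<sqsubset> u" using u pq lt_height by fastforce+
    then have "u = u'" using chainD[OF C] u 1 le_imp_lt_or_eq by metis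
    then show ?thesis using u 1 by simp
  next
    case (2 u' v')
    then show ?thesis using vertex_edge_unique[OF C 2(1,2) u(1) 2(3,4)] u pq by simp
  qed
next
  case (2 u v)
  note uv = this
  show ?thesis using q
  proof (cases rule: drawn_cases)
    case (1 u')
    then show ?thesis using vertex_edge_unique[OF C uv(1,2) 1(1) uv(3,4)] pq by simp
  next
    case (2 u' v')
    consider "u = u'" | "u' \<sqsubset> u" | "u \<sqsubset> u'" using chainD[OF C uv(1) 2(1)] le_imp_lt_or_eq by blast
    then show ?thesis
    proof cases
      case 1
      have "v = v'"
        using chain_vertex_edge[OF C uv(1,2) 2(2) uv(3)] chain_vertex_edge[OF C 2(1,2) uv(2) 2(3)]
          1 uv(3) 2(3) cover_lt lt_not_le le_antisym by blast
      then show ?thesis using edge_height(5)[OF uv(3,4)] 1 2 pq by simp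
    next
      case b: 2
      then have "v' \<sqsubseteq> u" using chain_vertex_edge[OF C 2(1,2) uv(1) 2(3)] lt_not_le by blast
      then have "height v' \<le> height u" by (rule le_height)
      then have "snd q = height v'" "snd p = height u"
        using edge_height(1,2)[OF uv(3,4)] edge_height(1,2)[OF 2(3,4)] pq by auto
      then show ?thesis
        using edge_height(4)[OF 2(3,4)] vertex_edge_unique[OF C uv(1,2) 2(2) uv(3,4)] pq by simp
    next
      case b: 3
      then have "v \<sqsubseteq> u'" using chain_vertex_edge[OF C uv(1,2) 2(1) uv(3)] lt_not_le by blast
      then have "height v \<le> height u'" by (rule le_height)
      then have "snd p = height v" "snd q = height u'"
        using edge_height(1,2)[OF uv(3,4)] edge_height(1,2)[OF 2(3,4)] pq by auto
      then show ?thesis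
        using edge_height(4)[OF uv(3,4)] vertex_edge_unique[OF C 2(1,2) uv(2) 2(3,4)] pq by simp
    qed
  qed
qed

lemma compact_drawn:
  assumes "C \<in> Chains r" shows "compact (drawn C)"
proof -
  have fin: "finite C" using chain_subset[OF assms] finite_carrier finite_subset by blast
  have "{edge pos u v |u v. u \<in> C \<and> v \<in> C \<and> covers_P r u v} \<subseteq> (\<lambda>(u, v). edge pos u v) ` (C \<times> C)"
    by auto
  then have "finite {edge pos u v |u v. u \<in> C \<and> v \<in> C \<and> covers_P r u v}"
    using fin by (meson finite_SigmaI finite_imageI finite_subset)
  then have "compact (\<Union>{edge pos u v |u v. u \<in> C \<and> v \<in> C \<and> covers_P r u v})"
    by (rule compact_Union) (auto simp: edge_def)
  moreover have "compact (pos ` C)" using fin by (simp add: finite_imp_compact)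
  ultimately show ?thesis unfolding drawn_chain_def by (simp add: compact_Un)
qed

section \<open>Maximal chains as continuous paths from bottom to top\<close>

definition top_el where "top_el = (SOME t. t \<in> A \<and> (\<forall>x\<in>A. x \<sqsubseteq> t))"
definition bot_el where "bot_el = (SOME t. t \<in> A \<and> (\<forall>x\<in>A. t \<sqsubseteq> x))"

lemma top_el: "top_el \<in> A" "x \<in> A \<Longrightarrow> x \<sqsubseteq> top_el"
  and bot_el: "bot_el \<in> A" "x \<in> A \<Longrightarrow> bot_el \<sqsubseteq> x"
proof -
  have "\<exists>t. t \<in> A \<and> (\<forall>x\<in>A. x \<sqsubseteq> t)" by (rule top_exists[OF bounded]) auto
  from someI_ex[OF this] show "top_el \<in> A" "x \<in> A \<Longrightarrow> x \<sqsubseteq> top_el" by (auto simp: top_el_def)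
  have "\<exists>t. t \<in> A \<and> (\<forall>x\<in>A. t \<sqsubseteq> x)" by (rule bot_exists[OF bounded]) auto
  from someI_ex[OF this] show "bot_el \<in> A" "x \<in> A \<Longrightarrow> bot_el \<sqsubseteq> x" by (auto simp: bot_el_def)
qed

abbreviation levels where "levels \<equiv> {height bot_el..height top_el}"

text \<open>These are the inclusion-maximal chains. Only for them does the drawing have no gaps:
  neighbours in the chain form a cover, and both extreme elements belong to it.\<close>

definition full_chain where
  "full_chain C \<longleftrightarrow> C \<in> Chains r \<and> (\<forall>z\<in>A. (\<forall>c\<in>C. z \<sqsubseteq> c \<or> c \<sqsubseteq> z) \<longrightarrow> z \<in> C)"

lemma full_chain_extends:
  assumes "C \<in> Chains r" obtains D where "full_chain D" "C \<subseteq> D"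
proof -
  have "finite {D. D \<in> Chains r \<and> C \<subseteq> D}"
    by (rule finite_subset[of _ "Pow A"]) (use chain_subset finite_carrier in auto)
  then obtain D where D: "D \<in> {D. D \<in> Chains r \<and> C \<subseteq> D}"
      "\<forall>E\<in>{D. D \<in> Chains r \<and> C \<subseteq> D}. D \<subseteq> E \<longrightarrow> D = E"
    using finite_has_maximal[of "{D. D \<in> Chains r \<and> C \<subseteq> D}"] assms by blast
  have "z \<in> D" if "z \<in> A" "\<forall>c\<in>D. z \<sqsubseteq> c \<or> c \<sqsubseteq> z" for z
  proof -
    have "insert z D \<in> Chains r" using D that le_refl by (auto simp: Chains_def)
    then show ?thesis using D by blast
  qed
  then have "full_chain D" using D by (simp add: full_chain_def)
  then show ?thesis using that D by blast
qed

lemma full_chain_through: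
  assumes "x \<sqsubseteq> y" obtains C where "full_chain C" "x \<in> C" "y \<in> C"
proof -
  have "{x, y} \<in> Chains r" using assms le_refl le_carrier by (auto simp: Chains_def)
  then show ?thesis using full_chain_extends that by (metis insert_subset)
qed

lemma full_chain_levels:
  assumes "full_chain C" shows "snd ` drawn C = levels"
proof
  have C: "C \<in> Chains r" using assms by (simp add: full_chain_def)
  show "snd ` drawn C \<subseteq> levels"
  proof
    fix t assume "t \<in> snd ` drawn C"
    then obtain p where p: "p \<in> drawn C" "t = snd p" by blast
    from p(1) show "t \<in> levels"
    proof (cases rule: drawn_cases)
      case (1 u)
      then show ?thesis using chain_subset[OF C] top_el bot_el le_height p by auto
    next
      case (2 u v)
      have "height bot_el \<le> height u" "height v \<le> height top_el"
        using 2 chain_subset[OF C] top_el bot_el le_height by blast+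
      then show ?thesis using edge_height(1,2)[OF 2(3,4)] p by auto
    qed
  qed
  show "levels \<subseteq> snd ` drawn C"
  proof
    fix t assume t: "t \<in> levels"
    have bt: "bot_el \<in> C" "top_el \<in> C"
      using assms top_el bot_el chain_subset[OF C] unfolding full_chain_def by blast+
    obtain u where u: "u \<in> {u\<in>C. height u \<le> t}" "\<And>z. z \<in> {u\<in>C. height u \<le> t} \<Longrightarrow> \<not> u \<sqsubset> z"
      using ex_maximal[of "{u\<in>C. height u \<le> t}"] chain_subset[OF C] bt t by auto
    show "t \<in> snd ` drawn C"
    proof (cases "height u = t")
      case True
      then show ?thesis using u pos_drawn by force
    next
      case False
      then have "u \<noteq> top_el" using u t by auto
      then have ut: "u \<sqsubset> top_el" using u top_el chain_subset[OF C] by (auto simp: less_P_def)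
      obtain v where v: "v \<in> {v\<in>C. u \<sqsubset> v}" "\<And>z. z \<in> {v\<in>C. u \<sqsubset> v} \<Longrightarrow> \<not> z \<sqsubset> v"
        by (rule ex_minimal_below[of "{v\<in>C. u \<sqsubset> v}" top_el]) (use ut bt lt_carrier in auto)
      \<comment> \<open>\<open>u\<close> and \<open>v\<close> are neighbours in the chain. An
        element strictly between them would be comparable with the whole chain and hence belong to
        it.\<close>
      have "\<not> (u \<sqsubset> z \<and> z \<sqsubset> v)" for z
      proof
        assume z: "u \<sqsubset> z \<and> z \<sqsubset> v"
        have "z \<sqsubseteq> c \<or> c \<sqsubseteq> z" if c: "c \<in> C" for c
        proof (cases "c \<sqsubseteq> u")
          case True then show ?thesis using z le_trans lt_le by blast
        next
          case False
          then have "u \<sqsubset> c" using chainD[OF C c, of u] u by (auto simp: less_P_def)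
          then have "\<not> c \<sqsubset> v" using v c by blast
          then have "v \<sqsubseteq> c" using chainD[OF C c, of v] v by (auto simp: less_P_def)
          then show ?thesis using z le_trans lt_le by blast
        qed
        then have "z \<in> C" using assms z lt_carrier by (auto simp: full_chain_def)
        then show False using z v by blast
      qed
      then have cov: "covers_P r u v" using v by (auto simp: covers_P_def)
      have "t < height v" using v u by force
      then obtain x where "(x, t) \<in> edge pos u v"
        using segment_at_height[OF cover_height[OF cov], of t] u unfolding edge_def by auto
      then have "(x, t) \<in> drawn C" using edge_drawn u v cov by blast
      then show ?thesis by force
    qed
  qed
qed

definition path_x where "path_x C t = fst (inv_into (drawn C) snd t)"

lemma inj_on_snd_drawn: "C \<in> Chains r \<Longrightarrow> inj_on snd (drawn C)"
  using drawn_unique by (intro inj_onI) blast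

lemma path_x_drawn:
  assumes "full_chain C" "t \<in> levels" shows "(path_x C t, t) \<in> drawn C"
proof -
  have "t \<in> snd ` drawn C" using assms full_chain_levels by blast
  then have "inv_into (drawn C) snd t \<in> drawn C" "snd (inv_into (drawn C) snd t) = t"
    by (auto intro: inv_into_into f_inv_into_f)
  then show ?thesis unfolding path_x_def by (metis prod.collapse)
qed

lemma path_x_eq:
  assumes "C \<in> Chains r" "(x, t) \<in> drawn C" shows "path_x C t = x"
  using inv_into_f_f[OF inj_on_snd_drawn assms(2)] assms(1) by (simp add: path_x_def)

lemma path_x_vertex: "C \<in> Chains r \<Longrightarrow> x \<in> C \<Longrightarrow> path_x C (height x) = fst (pos x)"
  using path_x_eq[of C "fst (pos x)" "height x"] pos_drawn by simp

text \<open>The height is a continuous injection on the compact drawn chain, so its inverse is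
  continuous.\<close>

lemma continuous_path_x:
  assumes "full_chain C" shows "continuous_on levels (path_x C)"
proof -
  have C: "C \<in> Chains r" using assms by (simp add: full_chain_def)
  have "continuous_on (snd ` drawn C) (inv_into (drawn C) snd)"
    by (rule continuous_on_inv)
      (auto intro: continuous_intros compact_drawn[OF C] inv_into_f_f inj_on_snd_drawn[OF C])
  then show ?thesis unfolding path_x_def full_chain_levels[OF assms, symmetric]
    by (intro continuous_intros)
qed

lemma height_levels: "x \<in> A \<Longrightarrow> height x \<in> levels"
  using le_height top_el bot_el by simp

text \<open>Distinct edges meet only at vertices, and a drawn chain passes only through its own
  vertices.\<close>

lemma common_point:
  assumes C: "C \<in> Chains r" "D \<in> Chains r" and p: "p \<in> drawn C" "p \<in> drawn D"
  shows "(\<exists>v. v \<in> C \<and> v \<in> D \<and> pos v = p) \<or>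
    (\<exists>u v. u \<in> C \<and> v \<in> C \<and> u \<in> D \<and> v \<in> D \<and> covers_P r u v \<and> p \<in> edge pos u v)"
proof (cases "\<exists>v\<in>A. p = pos v")
  case True
  then show ?thesis using vertex_drawn C p by blast
next
  case False
  then obtain u v where uv: "u \<in> C" "v \<in> C" "covers_P r u v" "p \<in> edge pos u v"
    using p(1) chain_subset[OF C(1)] by (elim drawn_cases) auto
  obtain u' v' where uv': "u' \<in> D" "v' \<in> D" "covers_P r u' v'" "p \<in> edge pos u' v'"
    using p(2) False chain_subset[OF C(2)] by (elim drawn_cases) auto
  show ?thesis
  proof (cases "(u, v) = (u', v')")
    case True then show ?thesis using uv uv' by blast
  next
    case neq: False
    then show ?thesis
      using edges_cross[OF uv(3) uv'(3) neq uv(4) uv'(4)] False uv chain_subset[OF C(1)] by blast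
  qed
qed

text \<open>The intermediate value theorem gives a meeting point strictly between the two heights.
  If it lies inside a shared edge, an end of that edge also lies strictly between them: otherwise
  the edge would reach down to height \<open>t\<close>, where the paths differ.\<close>

lemma crossing:
  assumes C: "full_chain C" and D: "full_chain D"
    and t: "t \<in> levels" "t' \<in> levels" "t < t'"
    and less: "path_x C t < path_x D t" "path_x D t' < path_x C t'"
  obtains v where "v \<in> C" "v \<in> D" "t < height v" "height v < t'"
proof -
  have C': "C \<in> Chains r" and D': "D \<in> Chains r" using C D by (auto simp: full_chain_def)
  have sub: "{t..t'} \<subseteq> levels" using t by auto
  have "continuous_on {t..t'} (\<lambda>s. path_x C s - path_x D s)"
    using continuous_on_subset[OF continuous_path_x[OF C] sub]
      continuous_on_subset[OF continuous_path_x[OF D] sub] by (intro continuous_intros)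
  then obtain s where s: "t \<le> s" "s \<le> t'" "path_x C s - path_x D s = 0"
    using IVT'[of "\<lambda>s. path_x C s - path_x D s" t 0 t'] t less by auto
  then have st: "t < s" "s < t'" using less by (auto simp: order_le_less)
  have sl: "s \<in> levels" using sub st by auto
  have p: "(path_x C s, s) \<in> drawn C" "(path_x C s, s) \<in> drawn D"
    using path_x_drawn[OF C sl] path_x_drawn[OF D sl] s by auto
  from common_point[OF C' D' p] show ?thesis
  proof (elim disjE exE conjE)
    fix v assume "v \<in> C" "v \<in> D" "pos v = (path_x C s, s)"
    then show ?thesis using that st by auto
  next
    fix u v assume uv: "u \<in> C" "v \<in> C" "u \<in> D" "v \<in> D" "covers_P r u v" "(path_x C s, s) \<in> edge pos u v"
    note h = edge_height(1,2)[OF uv(5,6)]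
    consider "t < height u" | "height v < t'" | "height u \<le> t" "t' \<le> height v" by linarith
    then show ?thesis
    proof cases
      case 1 then show ?thesis using that[of u] uv h st by auto
    next
      case 2 then show ?thesis using that[of v] uv h st by auto
    next
      case 3
      then obtain x where "(x, t) \<in> edge pos u v"
        using segment_at_height[OF cover_height[OF uv(5)], of t] t unfolding edge_def by auto
      then have "(x, t) \<in> drawn C" "(x, t) \<in> drawn D" using edge_drawn uv by blast+
      then have "path_x C t = path_x D t" using path_x_eq C' D' by simp
      then show ?thesis using less by simp
    qed
  qed
qed

section \<open>Sides of incomparable elements\<close>

lemma path_x_par_neq:
  assumes "x \<parallel> y" "full_chain C" "x \<in> C" shows "path_x C (height y) \<noteq> fst (pos y)"
proof
  assume "path_x C (height y) = fst (pos y)"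
  then have "pos y \<in> drawn C"
    using path_x_drawn[OF assms(2), of "height y"] height_levels assms(1) by (simp add: par_def)
  then have "y \<in> C" using vertex_drawn assms by (simp add: full_chain_def par_def)
  then show False using assms chainD by (auto simp: full_chain_def par_def)
qed

text \<open>If the two comparisons disagreed, the chains would share a vertex \<open>v\<close>
  strictly between the heights of \<open>x\<close> and \<open>y\<close>; then \<open>x\<close> is
  below \<open>v\<close> along \<open>C\<close> and \<open>v\<close> is below \<open>y\<close> along
  \<open>D\<close>.\<close>

lemma sides_agree_aux:
  assumes xy: "x \<parallel> y" and C: "full_chain C" "x \<in> C" and D: "full_chain D" "y \<in> D"
    and le: "height x \<le> height y"
  shows "path_x C (height y) < fst (pos y) \<longleftrightarrow> fst (pos x) < path_x D (height x)"
proof -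
  have C': "C \<in> Chains r" and D': "D \<in> Chains r" using C D by (auto simp: full_chain_def)
  have px: "path_x C (height x) = fst (pos x)" and py: "path_x D (height y) = fst (pos y)"
    using path_x_vertex C' D' C D by auto
  note ne = path_x_par_neq[OF xy C] path_x_par_neq[OF par_sym[OF xy] D]
  note lev = height_levels[of x] height_levels[of y]
  show ?thesis
  proof (cases "height x = height y")
    case True then show ?thesis using px py by simp
  next
    case False
    then have lt: "height x < height y" using le by simp
    have no: False if "v \<in> C" "v \<in> D" "height x < height v" "height v < height y" for v
      using chain_height_le[OF C' C(2) that(1,3)] chain_height_le[OF D' that(2) D(2) that(4)]
        lt_le le_trans xy unfolding par_def by blast
    show ?thesis
    proof (rule ccontr)
      assume "\<not> ?thesis"
      then consider "path_x C (height y) < path_x D (height y)" "path_x D (height x) < path_x C (height x)"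
        | "path_x D (height y) < path_x C (height y)" "path_x C (height x) < path_x D (height x)"
        using ne px py by fastforce
      then show False
      proof cases
        case 1 then show ?thesis
          using crossing[OF D(1) C(1) _ _ lt] no lev xy unfolding par_def by metis
      next
        case 2 then show ?thesis
          using crossing[OF C(1) D(1) _ _ lt] no lev xy unfolding par_def by metis
      qed
    qed
  qed
qed

lemma sides_agree:
  assumes xy: "x \<parallel> y" and C: "full_chain C" "x \<in> C" and D: "full_chain D" "y \<in> D"
  shows "path_x C (height y) < fst (pos y) \<longleftrightarrow> fst (pos x) < path_x D (height x)"
proof (cases "height x \<le> height y")
  case True then show ?thesis using sides_agree_aux assms by blast
next
  case False
  then show ?thesis using sides_agree_aux[OF par_sym[OF xy] D C]
      path_x_par_neq[OF xy C] path_x_par_neq[OF par_sym[OF xy] D] by linarith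
qed

text \<open>Quantified over all maximal chains, so that it may be applied to whichever chains
  through \<open>x\<close> and \<open>y\<close> also pass through other prescribed elements.\<close>

definition lefts where
  "lefts x y \<longleftrightarrow> x \<parallel> y \<and> (\<forall>C. full_chain C \<and> x \<in> C \<longrightarrow> path_x C (height y) < fst (pos y)) \<and>
    (\<forall>D. full_chain D \<and> y \<in> D \<longrightarrow> fst (pos x) < path_x D (height x))"

text \<open>By \<open>sides_agree\<close> a single chain through \<open>x\<close> decides the
  comparison for all chains through \<open>y\<close>, and conversely. So one pair \<open>C\<close>,
  \<open>D\<close> decides it for all.\<close>

lemma lefts_total:
  assumes "x \<parallel> y" shows "lefts x y \<or> lefts y x"
proof -
  obtain C where C: "full_chain C" "x \<in> C"
    using full_chain_through[of x x] le_refl assms by (auto simp: par_def)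
  obtain D where D: "full_chain D" "y \<in> D"
    using full_chain_through[of y y] le_refl assms by (auto simp: par_def)
  show ?thesis
  proof (cases "path_x C (height y) < fst (pos y)")
    case True
    then show ?thesis using sides_agree[OF assms] C D assms unfolding lefts_def by blast
  next
    case False
    then have "fst (pos y) < path_x C (height y)" using path_x_par_neq[OF assms C] by simp
    then show ?thesis
      using sides_agree[OF par_sym[OF assms]] C D par_sym[OF assms] unfolding lefts_def by blast
  qed
qed

text \<open>At the height of \<open>y\<close>, every chain through \<open>x\<close> runs strictly to
  the left of \<open>y\<close> (extend it to a maximal one), and then so do the horizontal segments
  between such chains.\<close>

lemma lefts_imp_left_of:
  assumes "lefts x y" shows "left_of r pos x y"
proof -
  have through: "fst p < fst (pos y)"
    if p: "p \<in> drawn_chains_through r pos x" "snd p = height y" for p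
  proof -
    obtain C where C: "C \<in> Chains r" "x \<in> C" "p \<in> drawn C"
      using p unfolding drawn_chains_through_def by blast
    obtain D where D: "full_chain D" "C \<subseteq> D" using full_chain_extends C by blast
    have "p \<in> drawn D" using C D unfolding drawn_chain_def by blast
    moreover have "p = (fst p, height y)" using p(2) by (simp add: prod_eq_iff)
    ultimately have "path_x D (height y) = fst p"
      using path_x_eq[of D "fst p" "height y"] D(1) unfolding full_chain_def by metis
    then show ?thesis using assms C D unfolding lefts_def by (metis subsetD)
  qed
  have "pos y \<notin> S_region r pos x"
  proof
    assume "pos y \<in> S_region r pos x"
    then consider "pos y \<in> drawn_chains_through r pos x"
      | p q where "p \<in> drawn_chains_through r pos x" "q \<in> drawn_chains_through r pos x"
          "snd p = snd q" "pos y \<in> closed_segment p q"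
      unfolding S_region_def by blast
    then show False
    proof cases
      case 1 then show ?thesis using through by blast
    next
      case 2
      obtain t where t: "0 \<le> t" "t \<le> 1" "pos y = (1 - t) *\<^sub>R p + t *\<^sub>R q"
        using 2 by (auto simp: in_segment)
      have "height y = snd p" unfolding t(3) using 2(3) by (simp add: algebra_simps)
      then have "fst p < fst (pos y)" "fst q < fst (pos y)" using through 2 by auto
      moreover have "fst (pos y) \<in> closed_segment (fst p) (fst q)"
        using t by (auto simp: in_segment)
      ultimately show False by (auto simp: closed_segment_eq_real_ivl split: if_splits)
    qed
  qed
  moreover obtain C where C: "full_chain C" "x \<in> C"
    using full_chain_through[of x x] le_refl assms by (auto simp: par_def lefts_def)
  have lev: "height y \<in> levels" using assms height_levels by (auto simp: lefts_def par_def)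
  have "(path_x C (height y), height y) \<in> S_region r pos x"
    using path_x_drawn[OF C(1) lev] C
    unfolding S_region_def drawn_chains_through_def full_chain_def by blast
  moreover have "path_x C (height y) < fst (pos y)" using assms C by (auto simp: lefts_def)
  ultimately show ?thesis unfolding left_of_def
    by (intro conjI exI[of _ "fst (pos y) - path_x C (height y)"]) auto
qed

lemma left_of_total: "x \<parallel> y \<Longrightarrow> left_of r pos x y \<or> left_of r pos y x"
  using lefts_total lefts_imp_left_of by blast

text \<open>A chain through \<open>a\<close> and \<open>b\<close> and one through \<open>c\<close>
  and \<open>d\<close> have swapped sides between the higher of \<open>a\<close>, \<open>c\<close>
  and the lower of \<open>b\<close>, \<open>d\<close>. A vertex where they cross is the
  interpolant.\<close>

lemma interpolate_aux:
  assumes ac: "lefts a c" and db: "lefts d b"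
    and le: "a \<sqsubseteq> b" "a \<sqsubseteq> d" "c \<sqsubseteq> b" "c \<sqsubseteq> d"
  shows "\<exists>j. a \<sqsubseteq> j \<and> c \<sqsubseteq> j \<and> j \<sqsubseteq> b \<and> j \<sqsubseteq> d"
proof -
  have par: "a \<parallel> c" "d \<parallel> b" using ac db by (auto simp: lefts_def)
  have lts: "a \<sqsubset> b" "a \<sqsubset> d" "c \<sqsubset> b" "c \<sqsubset> d" using le par by (auto simp: par_def less_P_def)
  obtain C where C: "full_chain C" "a \<in> C" "b \<in> C" using full_chain_through le by blast
  obtain D where D: "full_chain D" "c \<in> D" "d \<in> D" using full_chain_through le by blast
  have C': "C \<in> Chains r" and D': "D \<in> Chains r" using C D by (auto simp: full_chain_def)
  have "path_x C (height c) < path_x D (height c)" "path_x C (height a) < path_x D (height a)"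
    using ac C D path_x_vertex[OF C' C(2)] path_x_vertex[OF D' D(2)] by (auto simp: lefts_def)
  then have 1: "path_x C (max (height a) (height c)) < path_x D (max (height a) (height c))"
    by (simp add: max_def)
  have "path_x D (height b) < path_x C (height b)" "path_x D (height d) < path_x C (height d)"
    using db C D path_x_vertex[OF C' C(3)] path_x_vertex[OF D' D(3)] by (auto simp: lefts_def)
  then have 2: "path_x D (min (height b) (height d)) < path_x C (min (height b) (height d))"
    by (simp add: min_def)
  have lev: "max (height a) (height c) \<in> levels" "min (height b) (height d) \<in> levels"
    using par height_levels by (auto simp: par_def max_def min_def)
  have "max (height a) (height c) < min (height b) (height d)" using lts lt_height by simp
  then obtain v where v: "v \<in> C" "v \<in> D" "max (height a) (height c) < height v"
      "height v < min (height b) (height d)"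
    using crossing[OF C(1) D(1) lev _ 1 2] by blast
  then show ?thesis
    using chain_height_le[OF C'] chain_height_le[OF D'] C D lt_le by (metis max_less_iff_conj min_less_iff_conj)
qed

lemma interpolating: interpolating
proof (rule interpolatingI)
  fix a b c d assume par: "a \<parallel> c" "b \<parallel> d"
    and le: "a \<sqsubseteq> b" "a \<sqsubseteq> d" "c \<sqsubseteq> b" "c \<sqsubseteq> d"
  then consider "lefts a c" "lefts d b" | "lefts a c" "lefts b d"
    | "lefts c a" "lefts d b" | "lefts c a" "lefts b d"
    using lefts_total by blast
  then show "\<exists>j. a \<sqsubseteq> j \<and> c \<sqsubseteq> j \<and> j \<sqsubseteq> b \<and> j \<sqsubseteq> d"
  proof cases
    case 1 then show ?thesis using interpolate_aux[OF 1 le] by blast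
  next
    case 2 then show ?thesis using interpolate_aux[OF 2 le(2,1,4,3)] by blast
  next
    case 3 then show ?thesis using interpolate_aux[OF 3 le(3,4,1,2)] by blast
  next
    case 4 then show ?thesis using interpolate_aux[OF 4 le(4,3,2,1)] by blast
  qed
qed

end

section \<open>Meets and joins in a Baxter poset\<close>

context nat_poset
begin

text \<open>The Baxter conditions on disconnected intervals with the drawing eliminated: one of
  \<open>w\<close>, \<open>z\<close> is left of the other, and in either case \<open>x\<close>
  separates their labels.\<close>

definition facets_ordered where
  "facets_ordered \<longleftrightarrow> (\<forall>x y. x \<sqsubseteq> y \<and> disconnected_subposet r (open_interval r x y) \<longrightarrow>
     \<bar>int x - int y\<bar> = 1 \<and>
     (\<forall>w\<in>open_interval r x y. \<forall>z\<in>open_interval r x y.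
        \<not> same_component r (open_interval r x y) w z \<longrightarrow> btw x w z))"

end

locale ordered_facet_lattice = nat_poset +
  assumes bounded: "bounded_poset A r" and interpolating: interpolating
    and card_covers: "x \<in> A \<Longrightarrow> card {y. covers_P r x y} \<le> 2"
      "x \<in> A \<Longrightarrow> card {y. covers_P r y x} \<le> 2"
    and facets: facets_ordered
begin

lemma facet_dist:
  "x \<sqsubseteq> y \<Longrightarrow> disconnected_subposet r (open_interval r x y) \<Longrightarrow> \<bar>int x - int y\<bar> = 1"
  using facets unfolding facets_ordered_def by blast

lemma facet_btw:
  assumes "w \<in> open_interval r x y" "z \<in> open_interval r x y"
    "\<not> same_component r (open_interval r x y) w z"
  shows "btw x w z" "\<bar>int x - int y\<bar> = 1"
proof -
  have "x \<sqsubseteq> y" "disconnected_subposet r (open_interval r x y)"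
    using assms lt_trans lt_le unfolding open_interval_def disconnected_subposet_def by blast+
  then show "btw x w z" "\<bar>int x - int y\<bar> = 1"
    using facets assms unfolding facets_ordered_def by blast+
qed

text \<open>The condition names only the lower endpoint \<open>x\<close>. As the labels of
  \<open>x\<close> and \<open>y\<close> are adjacent and \<open>w\<close>, \<open>z\<close> differ
  from \<open>y\<close>, the label of \<open>y\<close> separates \<open>w\<close> and
  \<open>z\<close> as well.\<close>

lemma dual_lattice: "ordered_facet_lattice A (r\<inverse>)"
proof -
  interpret d: nat_poset A "r\<inverse>" using dual by (simp add: nat_poset_def)
  have "btw y w z" if w: "w \<in> open_interval r x y" "z \<in> open_interval r x y"
    "\<not> same_component r (open_interval r x y) w z" for w z x y
  proof -
    have "w \<noteq> y" "z \<noteq> y" using w by (auto simp: open_interval_def less_P_def)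
    then show ?thesis using facet_btw[OF w] by (auto simp: btw_def)
  qed
  moreover have "\<bar>int y - int x\<bar> = 1"
    if "x \<sqsubseteq> y" "disconnected_subposet r (open_interval r x y)" for x y
    using facet_dist[OF that] by linarith
  ultimately have "d.facets_ordered"
    unfolding d.facets_ordered_def by simp
  then show ?thesis
    using bounded interpolating card_covers
    by unfold_locales (auto simp: interpolating_converse)
qed

lemma two_covers:
  assumes "covers_P r m m1" "covers_P r m m2" "m1 \<noteq> m2" "covers_P r m z"
  shows "z = m1 \<or> z = m2"
proof (rule ccontr)
  assume "\<not> ?thesis"
  then have "card {m1, m2, z} = 3" using assms by auto
  moreover have "{m1, m2, z} \<subseteq> {y. covers_P r m y}" using assms by auto
  moreover have "finite {y. covers_P r m y}"
    by (rule finite_subset[OF _ finite_carrier]) (auto dest!: cover_lt lt_carrier)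
  ultimately have "3 \<le> card {y. covers_P r m y}" using card_mono by metis
  then show False using card_covers(1)[of m] cover_lt[OF assms(1)] lt_carrier by fastforce
qed

text \<open>A path in the open interval that starts above \<open>m1\<close> stays above
  \<open>m1\<close>. If a step leads down from \<open>u\<close> to an element above the other cover
  \<open>m2\<close>, then \<open>u\<close> is above both covers and hence above their join
  \<open>s\<close>, which is outside the interval.\<close>

lemma facet:
  assumes m12: "covers_P r m m1" "covers_P r m m2" "m1 \<noteq> m2"
  obtains s where "min_ub s m1 m2" "m1 \<sqsubset> s" "m2 \<sqsubset> s" "\<bar>int m - int s\<bar> = 1"
    "\<And>w z. m1 \<sqsubseteq> w \<Longrightarrow> w \<sqsubset> s \<Longrightarrow> m2 \<sqsubseteq> z \<Longrightarrow> z \<sqsubset> s \<Longrightarrow> btw m w z"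
proof -
  have par: "m1 \<parallel> m2" using covers_antichain assms by blast
  obtain t where "t \<in> A" "\<And>x. x \<in> A \<Longrightarrow> x \<sqsubseteq> t" by (rule top_exists[OF bounded]) blast
  then have "m1 \<sqsubseteq> t" "m2 \<sqsubseteq> t" using par by (auto simp: par_def)
  then obtain s where s: "min_ub s m1 m2" by (rule ex_min_ub) blast
  have lts: "m1 \<sqsubset> s" "m2 \<sqsubset> s" using s par by (auto simp: min_ub_def par_def less_P_def)
  let ?I = "open_interval r m s"
  have comp: "\<not> same_component r ?I w z" if wz: "m1 \<sqsubseteq> w" "w \<sqsubset> s" "m2 \<sqsubseteq> z" "z \<sqsubset> s" for w z
  proof
    assume "same_component r ?I w z"
    then have "(w, z) \<in> (comparability r ?I)\<^sup>*" by (simp add: same_component_def)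
    then have "m1 \<sqsubseteq> z"
    proof (induction rule: rtrancl_induct)
      case base
      show ?case using wz by simp
    next
      case (step u v)
      then consider "u \<sqsubseteq> v" | "v \<sqsubseteq> u" "m \<sqsubset> v" "u \<sqsubset> s"
        by (auto simp: comparability_def open_interval_def)
      then show ?case
      proof cases
        case 1 then show ?thesis using step le_trans by blast
      next
        case 2
        obtain c where c: "covers_P r m c" "c \<sqsubseteq> v" using upper_cover[OF 2(2)] by blast
        then consider "c = m1" | "c = m2" using two_covers[OF m12] by blast
        then show ?thesis
        proof cases
          case 1 then show ?thesis using c by simp
        next
          case b: 2
          then have "m2 \<sqsubseteq> u" using c 2 le_trans by blast
          then have "s \<sqsubseteq> u" using min_ub_least[OF interpolating s] step.IH by blast
          then show ?thesis using 2 lt_not_le by blast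
        qed
      qed
    qed
    then have "s \<sqsubseteq> z" using min_ub_least[OF interpolating s] wz by blast
    then show False using wz lt_not_le by blast
  qed
  have mem: "w \<in> ?I" if "m1 \<sqsubseteq> w \<or> m2 \<sqsubseteq> w" "w \<sqsubset> s" for w
    using that lt_le_trans[OF cover_lt[OF m12(1)]] lt_le_trans[OF cover_lt[OF m12(2)]]
    by (auto simp: open_interval_def)
  have mm: "m1 \<sqsubseteq> m1" "m2 \<sqsubseteq> m2" using le_refl par by (auto simp: par_def)
  show ?thesis
  proof (rule that[OF s lts])
    show "\<bar>int m - int s\<bar> = 1"
      using facet_btw(2)[OF mem mem comp] mm lts by blast
    show "btw m w z" if "m1 \<sqsubseteq> w" "w \<sqsubset> s" "m2 \<sqsubseteq> z" "z \<sqsubset> s" for w z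
      using facet_btw(1)[OF mem mem comp] that by blast
  qed
qed

lemma covers_btw:
  assumes "covers_P r m m1" "covers_P r m m2" "m1 \<noteq> m2" shows "btw m m1 m2"
proof (rule facet[OF assms])
  fix s assume "m1 \<sqsubset> s" "m2 \<sqsubset> s"
    "\<And>w z. m1 \<sqsubseteq> w \<Longrightarrow> w \<sqsubset> s \<Longrightarrow> m2 \<sqsubseteq> z \<Longrightarrow> z \<sqsubset> s \<Longrightarrow> btw m w z"
  then show ?thesis using le_refl lt_carrier by blast
qed

text \<open>By induction on \<open>m\<close> from the top: if the claim failed for \<open>x\<close>, then the meet of \<open>x\<close> with the
  join \<open>s\<close> of the two covers would violate it for \<open>x\<close> or for \<open>s\<close>.\<close>

lemma side_of_meet:
  assumes "x \<parallel> y" "max_lb m x y" "covers_P r m m1" "m1 \<sqsubseteq> x"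
  shows "(m < m1 \<longrightarrow> m < x) \<and> (m1 < m \<longrightarrow> x < m)"
  using assms
proof (induction "card {z. m \<sqsubset> z}" arbitrary: x y m m1 rule: less_induct)
  case less
  have my: "m \<sqsubset> y" "m \<sqsubset> x" using less.prems by (auto simp: max_lb_def par_def less_P_def)
  obtain m2 where m2: "covers_P r m m2" "m2 \<sqsubseteq> y" using upper_cover[OF my(1)] by blast
  have glb: "l \<sqsubseteq> m" if "l \<sqsubseteq> x" "l \<sqsubseteq> y" for l
    using max_lb_greatest[OF interpolating less.prems(2)] that by blast
  have nm2: "\<not> m2 \<sqsubseteq> x" using glb[of m2] m2 cover_lt lt_not_le by blast
  then have ne: "m1 \<noteq> m2" using less.prems by blast
  obtain s where s: "min_ub s m1 m2" "m1 \<sqsubset> s" "m2 \<sqsubset> s" "\<bar>int m - int s\<bar> = 1"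
      and b: "\<And>w z. m1 \<sqsubseteq> w \<Longrightarrow> w \<sqsubset> s \<Longrightarrow> m2 \<sqsubseteq> z \<Longrightarrow> z \<sqsubset> s \<Longrightarrow> btw m w z"
    using facet[OF less.prems(3) m2(1) ne] by blast
  have m2r: "m2 \<sqsubseteq> m2" and m1r: "m1 \<sqsubseteq> m1"
    using m2 less.prems(3) cover_lt lt_carrier le_refl by blast+
  have b1: "btw m w m2" if "m1 \<sqsubseteq> w" "w \<sqsubset> s" for w using b that m2r s by blast
  have b0: "btw m m1 m2" using b1 m1r s by blast
  show ?case
  proof (cases "x \<sqsubset> s")
    case True
    then show ?thesis using b1[OF less.prems(4)] b0 by (auto simp: btw_def)
  next
    case False
    have "\<not> s \<sqsubseteq> x" using nm2 s lt_le le_trans by blast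
    then have xs: "x \<parallel> s" using False cases_le[of x s] my s lt_carrier lt_le le_refl by blast
    obtain m' where m': "m1 \<sqsubseteq> m'" "max_lb m' x s"
      using ex_max_lb[of m1 x s] less.prems s lt_le by blast
    have m's: "m' \<sqsubset> s" "m' \<sqsubset> x" "m' \<sqsubseteq> s" "m' \<sqsubseteq> x" using m' xs by (auto simp: max_lb_def par_def less_P_def)
    have bm': "btw m m' m2" using b1 m' m's by blast
    obtain p where p: "covers_P r m' p" "p \<sqsubseteq> x" using upper_cover[OF m's(2)] by blast
    obtain q where q: "covers_P r m' q" "q \<sqsubseteq> s" using upper_cover[OF m's(1)] by blast
    have "m \<sqsubset> m'" using less.prems(3) m' cover_lt lt_le_trans by blast
    then have "{z. m' \<sqsubset> z} \<subset> {z. m \<sqsubset> z}" using lt_trans lt_irrefl by blast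
    moreover have "finite {z. m \<sqsubset> z}" 
      by (rule finite_subset[OF _ finite_carrier]) (auto dest: lt_carrier)
    ultimately have c: "card {z. m' \<sqsubset> z} < card {z. m \<sqsubset> z}" by (rule psubset_card_mono[rotated])
    have IHx: "(m' < p \<longrightarrow> m' < x) \<and> (p < m' \<longrightarrow> x < m')"
      using less.hyps[OF c xs m'(2) p] .
    have IHs: "(m' < q \<longrightarrow> m' < s) \<and> (q < m' \<longrightarrow> s < m')"
      using less.hyps[OF c par_sym[OF xs] max_lb_sym[OF m'(2)] q] .
    have "p \<noteq> q"
      using max_lb_greatest[OF interpolating m'(2), of p] p q cover_lt lt_not_le by blast
    then have bpq: "btw m' p q" using covers_btw p q by blast
    have "m' \<noteq> s" "x \<noteq> m" using m's my by (auto simp: less_P_def)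
    \<comment> \<open>Say \<open>m < m1\<close>. Then \<open>m2 < m\<close> and so
      \<open>m < m'\<close>. If \<open>p < m'\<close>, then \<open>m' < q\<close>, and the
      hypothesis for \<open>s\<close> gives \<open>m' < s\<close>, impossible because
      \<open>s\<close> is at most \<open>m + 1\<close>. So \<open>m' < p\<close>, and the hypothesis
      for \<open>x\<close> gives \<open>m < m' < x\<close>.\<close>
    then show ?thesis using IHx IHs bpq bm' b0 s(4) unfolding btw_def by linarith
  qed
qed

text \<open>The covers of \<open>m\<close> towards \<open>x\<close> and towards \<open>y\<close>
  have labels on different sides of \<open>m\<close>, and by \<open>side_of_meet\<close> each
  element is on the side of its cover.\<close>

lemma meet_btw:
  assumes "x \<parallel> y" "max_lb m x y" shows "btw m x y"
proof -
  have my: "m \<sqsubset> x" "m \<sqsubset> y" using assms by (auto simp: max_lb_def par_def less_P_def)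
  obtain m1 where m1: "covers_P r m m1" "m1 \<sqsubseteq> x" using upper_cover[OF my(1)] by blast
  obtain m2 where m2: "covers_P r m m2" "m2 \<sqsubseteq> y" using upper_cover[OF my(2)] by blast
  have "m1 \<noteq> m2"
    using max_lb_greatest[OF interpolating assms(2), of m1] m1 m2 cover_lt lt_not_le by blast
  then have "btw m m1 m2" using covers_btw m1 m2 by blast
  then show ?thesis
    using side_of_meet[OF assms m1] side_of_meet[OF par_sym[OF assms(1)] max_lb_sym[OF assms(2)] m2]
    by (auto simp: btw_def)
qed

lemma join_btw:
  assumes "x \<parallel> y" "min_ub m x y" shows "btw m x y"
  using ordered_facet_lattice.meet_btw[OF dual_lattice, of x y m] assms
  by (simp add: par_converse max_lb_converse)

text \<open>If \<open>k\<close> is above \<open>a\<close> but not above \<open>d\<close>, then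
  \<open>a\<close> is the meet of \<open>k\<close> and \<open>d\<close>, so \<open>a\<close> and not
  \<open>k\<close> would be the middle label; \<open>below\<close> is the dual. If \<open>k\<close>
  is incomparable to both ends, its meet \<open>q\<close> with \<open>d\<close> takes over the role
  of \<open>k\<close> in \<open>below\<close>.\<close>

lemma cover_gap:
  assumes cov: "covers_P r a d" and k: "btw k a d" "k \<in> A"
  shows "k \<sqsubset> a \<or> d \<sqsubset> k"
proof (rule ccontr)
  assume not: "\<not> ?thesis"
  have ad: "a \<sqsubset> d" "a \<in> A" "d \<in> A" using cov cover_lt lt_carrier by blast+
  have above: False if k: "btw k a d" "k \<in> A" "a \<sqsubset> k" "\<not> d \<sqsubset> k" for k
  proof -
    have kd: "k \<parallel> d" using cases_le[of k d] k ad cov by (auto simp: covers_P_def btw_def)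
    have "max_lb a k d"
      using k ad cov kd lt_le unfolding max_lb_def par_def covers_P_def less_P_def by metis
    then have "btw a k d" by (rule meet_btw[OF kd])
    then show False using k(1) by (auto simp: btw_def)
  qed
  have below: False if k: "btw k a d" "k \<in> A" "k \<sqsubset> d" "\<not> k \<sqsubset> a" for k
  proof -
    have ka: "k \<parallel> a" using cases_le[of k a] k ad cov by (auto simp: covers_P_def btw_def)
    have "min_ub d k a"
      using k ad cov ka lt_le unfolding min_ub_def par_def covers_P_def less_P_def by metis
    then have "btw d k a" by (rule join_btw[OF ka])
    then show False using k(1) by (auto simp: btw_def)
  qed
  have "k \<noteq> a" "k \<noteq> d" using k by (auto simp: btw_def)
  then have par: "k \<parallel> a" "k \<parallel> d"
    using cases_le[of k a] cases_le[of k d] above below k not ad by blast+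
  obtain z where z: "z \<in> A" "\<And>x. x \<in> A \<Longrightarrow> z \<sqsubseteq> x" by (rule bot_exists[OF bounded]) blast
  obtain p where p: "max_lb p k a" using ex_max_lb[of z k a] z k ad by blast
  obtain q where q: "max_lb q k d" using ex_max_lb[of z k d] z k ad by blast
  have bp: "btw p k a" and bq: "btw q k d" using meet_btw par p q by blast+
  have qd: "q \<sqsubset> d" "q \<in> A" "q \<sqsubseteq> k" using q par le_carrier by (auto simp: max_lb_def par_def less_P_def)
  have "\<not> q \<sqsubset> a"
  proof
    assume "q \<sqsubset> a"
    then have "q \<sqsubseteq> p" using max_lb_greatest[OF interpolating p] qd lt_le by blast
    moreover have "p \<sqsubseteq> q" using max_lb_greatest[OF interpolating q, of p] p ad lt_le le_trans
      unfolding max_lb_def by blast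
    ultimately have "p = q" by (rule le_antisym[rotated])
    \<comment> \<open>Seen from the label \<open>k\<close>, \<open>p\<close> lies on the side of
      \<open>a\<close> and \<open>q\<close> on the side of \<open>d\<close>.\<close>
    then show False using bp bq k by (auto simp: btw_def)
  qed
  moreover have "btw q a d" using bq k by (auto simp: btw_def)
  ultimately show False using below qd by blast
qed

end

section \<open>Posets whose covers have uniform gaps\<close>

locale uniform_gap_poset = nat_poset +
  assumes gap: "covers_P r x y \<Longrightarrow>
    (\<forall>k\<in>A. btw k x y \<longrightarrow> k \<sqsubset> x) \<or> (\<forall>k\<in>A. btw k x y \<longrightarrow> y \<sqsubset> k)"
begin

lemma dual_gap: "uniform_gap_poset A (r\<inverse>)"
proof -
  interpret d: finite_poset A "r\<inverse>" by (rule dual)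
  show ?thesis
  proof
    fix x y assume "covers_P (r\<inverse>) x y"
    then show "(\<forall>k\<in>A. btw k x y \<longrightarrow> less_P (r\<inverse>) k x) \<or> (\<forall>k\<in>A. btw k x y \<longrightarrow> less_P (r\<inverse>) y k)"
      using gap[of y x] btw_sym[of _ x y] by auto
  qed
qed

text \<open>The map \<open>f\<close> is an orientation of the number line, so that mirror images are covered.\<close>

lemma jump:
  fixes f :: "nat \<Rightarrow> int"
  assumes f: "inj f" and xz: "x \<sqsubset> z" and k: "f x < f k" "f k < f z"
  shows "(x \<sqsubset> k \<and> k \<sqsubset> z) \<or>
    (\<exists>u w. covers_P r u w \<and> x \<sqsubseteq> u \<and> w \<sqsubseteq> z \<and> f u < f k \<and> f k < f w)"
proof -
  let ?S = "{u. x \<sqsubseteq> u \<and> u \<sqsubset> z \<and> f u < f k}"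
  have "x \<in> ?S" using xz k le_refl lt_carrier by auto
  \<comment> \<open>\<open>u\<close> is a last element with label before \<open>k\<close> on the way
    to \<open>z\<close>, so the next cover \<open>w\<close> either jumps over \<open>k\<close> or
    equals \<open>k\<close>.\<close>
  then obtain u where u: "u \<in> ?S" "\<And>v. v \<in> ?S \<Longrightarrow> \<not> u \<sqsubset> v"
    by - (rule ex_maximal[of ?S], auto dest: lt_carrier)
  then obtain w where w: "covers_P r u w" "w \<sqsubseteq> z" by (auto elim: upper_cover)
  have xw: "x \<sqsubset> w" using u w cover_lt le_lt_trans by blast
  have nw: "w \<notin> ?S" using u(2) w cover_lt by blast
  consider "f k < f w" | "f w < f k" | "f w = f k" by linarith
  then show ?thesis
  proof cases
    case 1 then show ?thesis using u w by blast
  next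
    case 2
    then have "w \<noteq> z" using k by auto
    then show ?thesis using nw xw w 2 lt_le by (auto simp: less_P_def)
  next
    case 3
    then have "w = k" using f by (simp add: inj_eq)
    moreover have "w \<noteq> z" using 3 k by auto
    ultimately show ?thesis using xw w by (auto simp: less_P_def)
  qed
qed

definition orientation :: "(nat \<Rightarrow> int) \<Rightarrow> bool" where
  "orientation f \<longleftrightarrow> f = int \<or> f = (\<lambda>x. - int x)"

lemma orientation_inj: "orientation f \<Longrightarrow> inj f"
  by (auto simp: orientation_def inj_def)

lemma btw_orientation:
  "orientation f \<Longrightarrow> btw k x y \<longleftrightarrow> f x < f k \<and> f k < f y \<or> f y < f k \<and> f k < f x"
  by (auto simp: orientation_def btw_def)

lemma orientation_ex:
  assumes "x \<noteq> y" obtains f where "orientation f" "f x < f y"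
proof (cases "x < y")
  case True then show ?thesis using that[of int] by (simp add: orientation_def)
next
  case False
  then show ?thesis using that[of "\<lambda>x. - int x"] assms by (simp add: orientation_def)
qed

lemma jump_btw:
  assumes xz: "x \<sqsubset> z" and k: "btw k x z" "k \<in> A"
  shows "(x \<sqsubset> k \<and> k \<sqsubset> z) \<or>
    (\<exists>u w. covers_P r u w \<and> x \<sqsubseteq> u \<and> w \<sqsubseteq> z \<and> btw k u w \<and> (k \<sqsubset> u \<or> w \<sqsubset> k))"
proof -
  obtain f where f: "orientation f" "f x < f z" using orientation_ex lt_neq[OF xz] by blast
  then have "f x < f k" "f k < f z" using k btw_orientation by auto
  from jump[OF orientation_inj[OF f(1)] xz this] show ?thesis
    using gap btw_orientation[OF f(1)] k by blast
qed

text \<open>A cover that jumps over \<open>k\<close> on the way from \<open>x\<close> to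
  \<open>z\<close> compares \<open>k\<close> with one of its ends, and this passes on to
  \<open>x\<close> or \<open>z\<close>. It is the form in which uniformity enters the linear
  extensions below.\<close>

lemma gap_comparable:
  assumes "x \<sqsubset> z" "btw k x z" "k \<in> A" shows "x \<sqsubset> k \<or> k \<sqsubset> z"
  using jump_btw[OF assms]
proof (elim disjE exE conjE)
  fix u w assume u: "covers_P r u w" "x \<sqsubseteq> u" "w \<sqsubseteq> z"
  show ?thesis if "k \<sqsubset> u"
    using lt_trans[OF that lt_le_trans[OF cover_lt[OF u(1)] u(3)]] by blast
  show ?thesis if "w \<sqsubset> k"
    using lt_trans[OF le_lt_trans[OF u(2) cover_lt[OF u(1)]] that] by blast
qed blast

text \<open>Otherwise a cover on the way from \<open>a\<close> to \<open>s\<close> jumps over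
  \<open>c\<close>. If \<open>c\<close> is above the cover, then \<open>a\<close> is below
  \<open>c\<close>; if \<open>c\<close> is below it, the lower end of the cover is an upper bound of
  \<open>a\<close> and \<open>c\<close> smaller than \<open>s\<close>.\<close>

lemma min_ub_not_beyond:
  assumes "a \<parallel> c" "min_ub s a c" shows "\<not> btw c a s"
proof
  assume b: "btw c a s"
  have as: "a \<sqsubset> s" using assms by (auto simp: min_ub_def par_def less_P_def)
  have c: "c \<in> A" "\<not> a \<sqsubset> c" using assms lt_le by (auto simp: par_def)
  then obtain u w where uw: "covers_P r u w" "a \<sqsubseteq> u" "w \<sqsubseteq> s" "c \<sqsubset> u \<or> w \<sqsubset> c"
    using jump_btw[OF as b] by blast
  have "\<not> w \<sqsubset> c" using uw c cover_lt le_lt_trans lt_trans by blast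
  then have "c \<sqsubseteq> u" using uw lt_le by blast
  moreover have "u \<sqsubset> s" using uw cover_lt lt_le_trans by blast
  ultimately show False using assms uw by (auto simp: min_ub_def)
qed

lemma min_ub_btw:
  assumes "a \<parallel> c" "min_ub s a c" shows "btw s a c"
proof -
  have "s \<noteq> a" "s \<noteq> c" "a \<noteq> c" using assms par_neq by (auto simp: min_ub_def par_def)
  then show ?thesis
    using min_ub_not_beyond[OF assms] min_ub_not_beyond[OF par_sym[OF assms(1)] min_ub_sym[OF assms(2)]]
    by (auto simp: btw_def)
qed

lemma max_lb_btw:
  assumes "a \<parallel> c" "max_lb s a c" shows "btw s a c"
  using uniform_gap_poset.min_ub_btw[OF dual_gap, of a c s] assms
  by (simp add: par_converse min_ub_converse)

text \<open>For two minimal upper bounds \<open>s\<close>, \<open>s'\<close>, choose maximal lower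
  bounds of them, \<open>t\<close> above \<open>a\<close> and \<open>t'\<close> above
  \<open>c\<close>. A minimal upper bound \<open>j\<close> of \<open>t\<close> and \<open>t'\<close>
  below \<open>s\<close> has its label between theirs, thus strictly between \<open>s\<close> and
  \<open>s'\<close>. So \<open>j\<close> differs from \<open>s\<close> and is a smaller upper bound
  of \<open>a\<close> and \<open>c\<close>.\<close>

lemma min_ub_unique:
  assumes ac: "a \<parallel> c" and s: "min_ub s a c" "min_ub s' a c" shows "s = s'"
proof (rule ccontr)
  assume ne: "s \<noteq> s'"
  have "s \<in> A" "s' \<in> A" using s le_carrier by (auto simp: min_ub_def)
  then have par: "s \<parallel> s'" using cases_le[of s s'] ne s by (auto simp: min_ub_def)
  obtain t where t: "a \<sqsubseteq> t" "max_lb t s s'"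
    using ex_max_lb[of a s s'] s unfolding min_ub_def by blast
  obtain t' where t': "c \<sqsubseteq> t'" "max_lb t' s s'"
    using ex_max_lb[of c s s'] s unfolding min_ub_def by blast
  have lt: "t \<sqsubset> s" "t' \<sqsubset> s" using t t' par by (auto simp: max_lb_def par_def less_P_def)
  have "t \<noteq> t'" using s(1) t t' lt unfolding min_ub_def by blast
  then have tt: "t \<parallel> t'"
    using cases_le[of t t'] lt t t' lt_carrier unfolding max_lb_def by blast
  obtain j where j: "j \<sqsubseteq> s" "min_ub j t t'"
    using ex_min_ub[of t s t'] lt lt_le by blast
  have "btw j t t'" "btw t s s'" "btw t' s s'"
    using min_ub_btw[OF tt j(2)] max_lb_btw[OF par] t t' by blast+
  then have "j \<noteq> s" by (auto simp: btw_def)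
  then have "j \<sqsubset> s" using j by (simp add: less_P_def)
  moreover have "a \<sqsubseteq> j" "c \<sqsubseteq> j" using j t t' le_trans unfolding min_ub_def by blast+
  ultimately show False using s by (auto simp: min_ub_def)
qed

lemma interpolating: interpolating
proof (rule interpolatingI)
  fix a b c d assume *: "a \<parallel> c" "a \<sqsubseteq> b" "a \<sqsubseteq> d" "c \<sqsubseteq> b" "c \<sqsubseteq> d"
  obtain s where s: "s \<sqsubseteq> b" "min_ub s a c" using ex_min_ub * by blast
  obtain s' where s': "s' \<sqsubseteq> d" "min_ub s' a c" using ex_min_ub * by blast
  have "s = s'" using min_ub_unique * s s' by blast
  then show "\<exists>j. a \<sqsubseteq> j \<and> c \<sqsubseteq> j \<and> j \<sqsubseteq> b \<and> j \<sqsubseteq> d"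
    using s s' unfolding min_ub_def by blast
qed

lemma card_upper_covers: "card {y. covers_P r x y} \<le> 2"
proof (rule ccontr)
  assume "\<not> ?thesis"
  then have "3 \<le> card {y. covers_P r x y}" by simp
  then obtain T where "T \<subseteq> {y. covers_P r x y}" "card T = 3"
    by (meson obtain_subset_with_card_n)
  then obtain a b c where abc: "covers_P r x a" "covers_P r x b" "covers_P r x c"
      "a \<noteq> b" "a \<noteq> c" "b \<noteq> c" by (auto simp: card_3_iff)
  have "btw x y z" if yz: "covers_P r x y" "covers_P r x z" "y \<noteq> z" for y z
  proof -
    have par: "y \<parallel> z" using covers_antichain yz by blast
    have "\<not> x \<sqsubset> l" if "l \<sqsubseteq> y" "l \<sqsubseteq> z" for l
      using that yz par le_imp_lt_or_eq[of l y] unfolding covers_P_def par_def by blast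
    then have "max_lb x y z" using yz cover_lt lt_le unfolding max_lb_def by blast
    then show ?thesis using max_lb_btw par by blast
  qed
  \<comment> \<open>Of three labels, two lie on the same side of \<open>x\<close>.\<close>
  then have "btw x a b" "btw x a c" "btw x b c" using abc by blast+
  then show False by (auto simp: btw_def)
qed

lemma card_lower_covers: "card {y. covers_P r y x} \<le> 2"
  using uniform_gap_poset.card_upper_covers[OF dual_gap, of x] by simp

text \<open>By \<open>inside\<close>, no element of the open interval has its label between
  \<open>x\<close> and \<open>y\<close>; this forces \<open>k\<close> above \<open>y\<close> or
  below \<open>x\<close>. Then some cover in the interval jumps over both \<open>k\<close> and one
  of \<open>x\<close>, \<open>y\<close>, with one of these two below the cover and the other above
  it, which uniformity forbids.\<close>

lemma facet_no_gap_aux: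
  fixes f :: "nat \<Rightarrow> int"
  assumes f: "orientation f"
    and w: "w \<in> open_interval r x y" and z: "z \<in> open_interval r x y"
    and wz: "\<not> same_component r (open_interval r x y) w z"
    and ord: "f w < f x" "f x < f k" "f k < f y" "f y < f z" and k: "k \<in> A"
  shows False
proof -
  have lts: "x \<sqsubset> w" "w \<sqsubset> y" "x \<sqsubset> z" "z \<sqsubset> y" using w z by (auto simp: open_interval_def)
  have xy: "x \<sqsubset> y" using lts lt_trans by blast
  note b = btw_orientation[OF f]
  have inside: False if t: "x \<sqsubset> t" "t \<sqsubset> y" "f x < f t" "f t < f y" for t
  proof -
    have tI: "t \<in> open_interval r x y" using t by (simp add: open_interval_def)
    \<comment> \<open>\<open>t\<close> misses the component of \<open>w\<close> or that of
      \<open>z\<close>. In the first case \<open>y\<close> would separate \<open>w\<close> from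
      \<open>t\<close>, in the second \<open>x\<close> would separate \<open>t\<close> from
      \<open>z\<close>; both contradict the order of the labels.\<close>
    consider "\<not> same_component r (open_interval r x y) w t"
      | "\<not> same_component r (open_interval r x y) t z"
      using wz same_component_trans by blast
    then show False
    proof cases
      case 1
      then have "btw y w t"
        using min_ub_btw[OF diff_component_par diff_component_min_ub] w tI by blast
      then show False using b t ord by auto
    next
      case 2
      then have "btw x t z"
        using max_lb_btw[OF diff_component_par diff_component_max_lb] z tI by blast
      then show False using b t ord by auto
    qed
  qed
  have kneq: "k \<noteq> x" "k \<noteq> y" using ord by auto
  have "y \<sqsubset> k \<or> k \<sqsubset> x"
  proof (cases "x \<sqsubset> k")
    case True
    then have nky: "\<not> k \<sqsubset> y" using inside ord by blast
    then have wk: "w \<sqsubset> k" using gap_comparable[OF lts(2), of k] b k ord by auto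
    have "\<not> k \<parallel> y"
    proof
      assume par: "k \<parallel> y"
      obtain t where t: "w \<sqsubseteq> t" "max_lb t k y" using ex_max_lb wk lts lt_le by blast
      have "btw t k y" using max_lb_btw[OF par t(2)] .
      then have "f x < f t" "f t < f y" using b ord by auto
      moreover have "t \<sqsubset> y" using t par by (auto simp: max_lb_def par_def less_P_def)
      ultimately show False using inside lt_le_trans[OF lts(1) t(1)] by blast
    qed
    then show ?thesis using cases_le[of k y] k nky kneq xy lt_carrier by blast
  next
    case False
    then have kz: "k \<sqsubset> z" using gap_comparable[OF lts(3), of k] b k ord by auto
    have "\<not> k \<parallel> x"
    proof
      assume par: "k \<parallel> x"
      obtain t where t: "t \<sqsubseteq> z" "min_ub t k x" using ex_min_ub kz lts lt_le by blast
      have "btw t k x" using min_ub_btw[OF par t(2)] .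
      then have "f x < f t" "f t < f y" using b ord by auto
      moreover have "x \<sqsubset> t" using t par by (auto simp: min_ub_def par_def less_P_def)
      ultimately show False using inside le_lt_trans[OF t(1) lts(4)] by blast
    qed
    then show ?thesis using cases_le[of k x] k False kneq xy lt_carrier by blast
  qed
  then show False
  proof
    assume yk: "y \<sqsubset> k"
    have "\<not> (w \<sqsubset> k \<and> k \<sqsubset> y)" using yk lt_not_le lt_le by blast
    then obtain u v where uv: "covers_P r u v" "w \<sqsubseteq> u" "v \<sqsubseteq> y" "f u < f k" "f k < f v"
      using jump[OF orientation_inj[OF f] lts(2), of k] ord by auto
    have xu: "x \<sqsubset> u" using uv lts lt_le_trans by blast
    have uy: "u \<sqsubset> y" using uv cover_lt lt_le_trans by blast
    have "\<not> f x < f u" using inside[OF xu uy] uv ord by auto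
    moreover have "f x \<noteq> f u" using xu orientation_inj[OF f] lt_neq by (auto simp: inj_eq)
    ultimately have "btw x u v" "btw k u v" using b uv ord by auto
    then have "x \<sqsubset> u \<and> k \<sqsubset> u \<or> v \<sqsubset> x \<and> v \<sqsubset> k" using gap[OF uv(1)] k lt_carrier(1)[OF xy] by blast
    then show False
      using lt_trans[OF xu cover_lt[OF uv(1)]] lt_trans[OF uy yk] lt_not_le lt_le by blast
  next
    assume kx: "k \<sqsubset> x"
    have "\<not> (x \<sqsubset> k \<and> k \<sqsubset> z)" using kx lt_not_le lt_le by blast
    then obtain u v where uv: "covers_P r u v" "x \<sqsubseteq> u" "v \<sqsubseteq> z" "f u < f k" "f k < f v"
      using jump[OF orientation_inj[OF f] lts(3), of k] ord by auto
    have vy: "v \<sqsubset> y" using uv lts le_lt_trans by blast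
    have xv: "x \<sqsubset> v" using uv cover_lt le_lt_trans by blast
    have "\<not> f v < f y" using inside[OF xv vy] uv ord by auto
    moreover have "f v \<noteq> f y" using vy orientation_inj[OF f] lt_neq by (auto simp: inj_eq)
    ultimately have "btw y u v" "btw k u v" using b uv ord by auto
    then have "y \<sqsubset> u \<and> k \<sqsubset> u \<or> v \<sqsubset> y \<and> v \<sqsubset> k" using gap[OF uv(1)] k lt_carrier(2)[OF xy] by blast
    then show False
      using lt_trans[OF cover_lt[OF uv(1)] vy] lt_trans[OF kx xv] lt_not_le lt_le by blast
  qed
qed

lemma facet_btw:
  assumes "w \<in> open_interval r x y" "z \<in> open_interval r x y"
    "\<not> same_component r (open_interval r x y) w z"
  shows "btw x w z" "btw y w z"
  using max_lb_btw[OF diff_component_par diff_component_max_lb]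
    min_ub_btw[OF diff_component_par diff_component_min_ub] assms by blast+

lemma facet_no_gap:
  assumes I: "w \<in> open_interval r x y" "z \<in> open_interval r x y"
    "\<not> same_component r (open_interval r x y) w z" and "k \<in> A"
  shows "\<not> btw k x y"
proof
  assume k: "btw k x y"
  then obtain f where f: "orientation f" "f x < f y"
    by - (rule orientation_ex[of x y], auto simp: btw_def)
  note b = btw_orientation[OF f(1)]
  have I': "\<not> same_component r (open_interval r x y) z w" using I same_component_sym by blast
  have k': "f x < f k" "f k < f y" using k b f by auto
  have "btw x w z" "btw y w z" using facet_btw I by blast+
  then consider "f w < f x" "f y < f z" | "f z < f x" "f y < f w" using b f by auto
  then show False
  proof cases
    case 1 then show False using facet_no_gap_aux[OF f(1) I _ k'] assms by blast
  next
    case 2 then show False using facet_no_gap_aux[OF f(1) I(2,1) I' _ k'] assms by blast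
  qed
qed

subsection \<open>The dominance drawing\<close>

text \<open>The two linear extensions in which incomparable elements are ordered by increasing and by
  decreasing label form a realizer.\<close>

definition before :: "(nat \<Rightarrow> int) \<Rightarrow> nat \<Rightarrow> nat \<Rightarrow> bool" where
  "before f x y \<longleftrightarrow> x \<sqsubset> y \<or> x \<parallel> y \<and> f x < f y"

text \<open>In each critical case two of the three elements are comparable while the third is
  incomparable to both and has its label between theirs, contrary to
  \<open>gap_comparable\<close>.\<close>

lemma before_trans:
  assumes f: "orientation f" and xy: "before f x y" and yz: "before f y z"
  shows "before f x z"
proof -
  note b = btw_orientation[OF f]
  have mem: "x \<in> A" "y \<in> A" "z \<in> A"
    using xy yz lt_carrier by (auto simp: before_def par_def)
  have "x \<noteq> z" using xy yz lt_not_le lt_le by (auto simp: before_def par_def)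
  moreover have "\<not> z \<sqsubset> x"
  proof
    assume zx: "z \<sqsubset> x"
    show False
    proof (cases "x \<sqsubset> y \<or> y \<sqsubset> z")
      case True
      then show False
        using zx xy yz lt_trans[of z x y] lt_trans[of y z x] lt_not_le lt_le
        unfolding before_def par_def by blast
    next
      case False
      then have "x \<parallel> y" "y \<parallel> z" "btw y z x" using xy yz b by (auto simp: before_def)
      then show False using gap_comparable[OF zx] mem lt_le by (auto simp: par_def)
    qed
  qed
  moreover have "f x < f z" if par: "x \<parallel> z"
  proof (rule ccontr)
    assume "\<not> f x < f z"
    moreover have "f x \<noteq> f z" using \<open>x \<noteq> z\<close> orientation_inj[OF f] by (simp add: inj_eq)
    ultimately have zx: "f z < f x" by simp
    consider "x \<sqsubset> y" "y \<parallel> z" "f y < f z" | "x \<parallel> y" "f x < f y" "y \<sqsubset> z" | "x \<sqsubset> y" "y \<sqsubset> z"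
      | "f x < f y" "f y < f z"
      using xy yz unfolding before_def by blast
    then show False
    proof cases
      case 1
      then have "btw z x y" using zx b by auto
      then show False using gap_comparable[OF 1(1)] mem 1 par lt_le by (auto simp: par_def)
    next
      case 2
      then have "btw x y z" using zx b by auto
      then show False using gap_comparable[OF 2(3)] mem 2 par lt_le by (auto simp: par_def)
    next
      case 3 then show False using lt_trans par lt_le unfolding par_def by blast
    next
      case 4 then show False using zx by simp
    qed
  qed
  ultimately show ?thesis using cases_le[OF mem(1,3)] by (auto simp: before_def)
qed

section \<open>Ranks in the two linear extensions as coordinates\<close>

definition rank :: "(nat \<Rightarrow> int) \<Rightarrow> nat \<Rightarrow> real" where
  "rank f x = real (card {y. before f y x})"

lemma rank_less:
  assumes "orientation f" "before f x y" shows "rank f x < rank f y"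
proof -
  have "{z. before f z x} \<subset> {z. before f z y}"
  proof
    show "{z. before f z x} \<subseteq> {z. before f z y}" using before_trans assms by blast
    show "{z. before f z x} \<noteq> {z. before f z y}"
      using assms(2) lt_irrefl by (auto simp: before_def)
  qed
  moreover have "finite {z. before f z y}"
    by (rule finite_subset[OF _ finite_carrier]) (auto simp: before_def par_def dest: lt_carrier)
  ultimately show ?thesis unfolding rank_def by (simp add: psubset_card_mono)
qed

definition left_rank where "left_rank = rank int"
definition right_rank where "right_rank = rank (\<lambda>x. - int x)"

lemma ranks_lt: "x \<sqsubset> y \<Longrightarrow> left_rank x < left_rank y" "x \<sqsubset> y \<Longrightarrow> right_rank x < right_rank y"
  using rank_less[of int x y] rank_less[of "\<lambda>x. - int x" x y]
  by (auto simp: left_rank_def right_rank_def before_def orientation_def)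

lemma ranks_par:
  assumes "x \<parallel> y" "x < y"
  shows "left_rank x < left_rank y" "right_rank y < right_rank x"
  using rank_less[of int x y] rank_less[of "\<lambda>x. - int x" y x] assms par_sym[OF assms(1)]
  by (auto simp: left_rank_def right_rank_def before_def orientation_def)

lemma ranks_le:
  "x \<sqsubseteq> y \<Longrightarrow> left_rank x \<le> left_rank y" "x \<sqsubseteq> y \<Longrightarrow> right_rank x \<le> right_rank y"
  using ranks_lt le_imp_lt_or_eq by fastforce+

lemma le_iff_ranks:
  assumes "x \<in> A" "y \<in> A"
  shows "x \<sqsubseteq> y \<longleftrightarrow> left_rank x \<le> left_rank y \<and> right_rank x \<le> right_rank y"
proof
  assume "x \<sqsubseteq> y" then show "left_rank x \<le> left_rank y \<and> right_rank x \<le> right_rank y"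
    using ranks_le by blast
next
  assume le: "left_rank x \<le> left_rank y \<and> right_rank x \<le> right_rank y"
  have "\<not> y \<sqsubset> x" using ranks_lt(1)[of y x] le by auto
  moreover have "\<not> x \<parallel> y"
  proof
    assume par: "x \<parallel> y"
    then have "x < y \<or> y < x" using par_neq[OF par] by auto
    then show False using ranks_par[OF par] ranks_par[OF par_sym[OF par]] le by auto
  qed
  ultimately show "x \<sqsubseteq> y" using cases_le[OF assms] le_refl lt_le assms by blast
qed

text \<open>The point with coordinates \<open>left_rank\<close> and \<open>right_rank\<close>,
  turned by 45 degrees and scaled: the height grows along the order, and among incomparable elements
  the horizontal coordinate grows with the label.\<close>

definition dpos :: "nat \<Rightarrow> real \<times> real" where
  "dpos x = (left_rank x - right_rank x, left_rank x + right_rank x)"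

text \<open>\<open>cl\<close> and \<open>cr\<close> undo the rotation and give rank coordinates to
  every point of the plane, in particular to points inside edges.\<close>

definition cl :: "real \<times> real \<Rightarrow> real" where "cl p = (snd p + fst p) / 2"
definition cr :: "real \<times> real \<Rightarrow> real" where "cr p = (snd p - fst p) / 2"

lemma c_dpos [simp]: "cl (dpos x) = left_rank x" "cr (dpos x) = right_rank x"
  by (auto simp: cl_def cr_def dpos_def)

lemma c_eqI: "cl p = cl q \<Longrightarrow> cr p = cr q \<Longrightarrow> p = q"
  by (auto simp: cl_def cr_def prod_eq_iff)

lemma c_combination:
  "cl ((1 - t) *\<^sub>R p + t *\<^sub>R q) = cl p + t * (cl q - cl p)"
  "cr ((1 - t) *\<^sub>R p + t *\<^sub>R q) = cr p + t * (cr q - cr p)"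
  by (simp_all add: cl_def cr_def field_simps)

lemma edge_c:
  assumes "p \<in> edge dpos x y"
  obtains t where "0 \<le> t" "t \<le> 1"
    "cl p = left_rank x + t * (left_rank y - left_rank x)"
    "cr p = right_rank x + t * (right_rank y - right_rank x)"
proof -
  obtain t where t: "0 \<le> t" "t \<le> 1" "p = (1 - t) *\<^sub>R dpos x + t *\<^sub>R dpos y"
    using assms by (auto simp: edge_def in_segment)
  show ?thesis by (rule that[OF t(1,2)]) (simp_all add: t(3) c_combination)
qed

lemma edge_bounds:
  assumes "p \<in> edge dpos x y" "x \<sqsubset> y"
  shows "left_rank x \<le> cl p" "cl p \<le> left_rank y" "right_rank x \<le> cr p" "cr p \<le> right_rank y"
proof -
  obtain t where t: "0 \<le> t" "t \<le> 1"
    "cl p = left_rank x + t * (left_rank y - left_rank x)"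
    "cr p = right_rank x + t * (right_rank y - right_rank x)" by (rule edge_c[OF assms(1)])
  note lt = ranks_lt[OF assms(2)]
  show "left_rank x \<le> cl p" "right_rank x \<le> cr p" using t lt by auto
  have "t * (left_rank y - left_rank x) \<le> left_rank y - left_rank x"
    "t * (right_rank y - right_rank x) \<le> right_rank y - right_rank x"
    using t lt by (auto intro!: mult_left_le_one_le)
  then show "cl p \<le> left_rank y" "cr p \<le> right_rank y" using t by auto
qed

text \<open>Two rays from one point with directions \<open>(a, b)\<close> and
  \<open>(a', b')\<close> of different slope meet only at their origin.\<close>

lemma directions_differ:
  fixes a b a' b' s t :: real
  assumes "0 < a" "a < a'" "0 < b'" "b' < b" "t * a = s * a'" "t * b = s * b'" "0 \<le> t"
  shows "t = 0"
proof (rule ccontr)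
  assume "t \<noteq> 0"
  then have "0 < t" using assms by simp
  then have "0 < s * a'" using assms by (metis mult_pos_pos)
  then have "0 < s" using assms by (simp add: zero_less_mult_iff)
  have "s * a < s * a'" using \<open>0 < s\<close> assms(2) by simp
  then have "s * a < t * a" using assms(5) by linarith
  then have "s < t" using assms(1) by (meson mult_less_cancel_right_pos)
  then have "s * b' < t * b'" using assms(3) by simp
  also have "\<dots> < t * b" using \<open>0 < t\<close> assms(4) by simp
  finally show False using assms(6) by simp
qed

text \<open>The sign \<open>s1\<close> treats two edges with a common lower end (\<open>1\<close>)
  and with a common upper end (\<open>-1\<close>) together; \<open>(c, d)\<close> is that end in
  rank coordinates.\<close>

lemma par_directions:
  assumes par: "y \<parallel> z"
    and "0 < s1 * (left_rank y - c)" "0 < s1 * (right_rank y - d)"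
    and "0 < s1 * (left_rank z - c)" "0 < s1 * (right_rank z - d)" and "s1 = 1 \<or> s1 = -1"
    and t: "0 \<le> t" "0 \<le> s"
    and eq: "t * (left_rank y - c) = s * (left_rank z - c)"
      "t * (right_rank y - d) = s * (right_rank z - d)"
  shows "t = 0"
proof -
  let ?a = "s1 * (left_rank y - c)" and ?b = "s1 * (right_rank y - d)"
  let ?a' = "s1 * (left_rank z - c)" and ?b' = "s1 * (right_rank z - d)"
  have e: "t * ?a = s * ?a'" "t * ?b = s * ?b'"
    using eq by (metis mult.left_commute)+
  have "y < z \<or> z < y" using par_neq[OF par] by auto
  then have "left_rank y < left_rank z \<and> right_rank z < right_rank y \<or>
      left_rank z < left_rank y \<and> right_rank y < right_rank z"
    using ranks_par[OF par] ranks_par[OF par_sym[OF par]] by blast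
  then consider "?a < ?a'" "?b' < ?b" | "?a' < ?a" "?b < ?b'" using assms(6) by fastforce
  then show ?thesis
  proof cases
    case 1
    then show ?thesis using directions_differ[of ?a ?a' ?b' ?b t s] assms e by blast
  next
    case 2
    then show ?thesis using directions_differ[of ?b ?b' ?a' ?a t s] assms e by blast
  qed
qed

lemma planar_dpos: "planar_embedding A r dpos"
  unfolding planar_embedding_def hasse_diagram_def
proof (intro conjI allI impI)
  show "inj_on dpos A"
  proof (rule inj_onI)
    fix x y assume "x \<in> A" "y \<in> A" "dpos x = dpos y"
    then show "x = y" using le_iff_ranks le_antisym c_dpos by (metis order_refl)
  qed
  show "snd (dpos x) < snd (dpos y)" if "covers_P r x y" for x y
    using ranks_lt[OF cover_lt[OF that]] by (simp add: dpos_def)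
  show "\<forall>z\<in>A. covers_P r x y \<and> dpos z \<in> edge dpos x y \<longrightarrow> z = x \<or> z = y" for x y
  proof (intro ballI impI)
    fix z assume z: "z \<in> A" "covers_P r x y \<and> dpos z \<in> edge dpos x y"
    have xy: "x \<sqsubset> y" using z cover_lt by blast
    then have "x \<sqsubseteq> z" "z \<sqsubseteq> y"
      using edge_bounds[of "dpos z" x y] z le_iff_ranks lt_carrier by auto
    then show "z = x \<or> z = y" using cover_between z by blast
  qed
  fix x y x' y' assume h: "covers_P r x y \<and> covers_P r x' y' \<and> (x, y) \<noteq> (x', y')"
  show "edge dpos x y \<inter> edge dpos x' y' \<subseteq> dpos ` ({x, y} \<inter> {x', y'})"
  proof
    fix p assume p: "p \<in> edge dpos x y \<inter> edge dpos x' y'"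
    have lt: "x \<sqsubset> y" "x' \<sqsubset> y'" using h cover_lt by auto
    then have mem: "x \<in> A" "y \<in> A" "x' \<in> A" "y' \<in> A" using lt_carrier by auto
    note bd = edge_bounds[OF IntD1[OF p] lt(1)] edge_bounds[OF IntD2[OF p] lt(2)]
    \<comment> \<open>In rank coordinates a crossing point dominates both lower ends and is
      dominated by both upper ends. An interpolant of the two edges must be an end of each, so
      crossing edges share an end.\<close>
    have "x \<sqsubseteq> y'" "x' \<sqsubseteq> y" using bd le_iff_ranks mem by auto
    then obtain j where j: "x \<sqsubseteq> j" "x' \<sqsubseteq> j" "j \<sqsubseteq> y" "j \<sqsubseteq> y'"
      using interpolating lt lt_le unfolding interpolating_def by blast
    have "j = x \<or> j = y" "j = x' \<or> j = y'" using j h cover_between by blast+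
    then consider "x = y'" | "y = x'" | "x = x'" "y \<noteq> y'" | "y = y'" "x \<noteq> x'" using h by auto
    then show "p \<in> dpos ` ({x, y} \<inter> {x', y'})"
    proof cases
      case 1
      then have "p = dpos x" using bd by (intro c_eqI) auto
      then show ?thesis using 1 by blast
    next
      case 2
      then have "p = dpos y" using bd by (intro c_eqI) auto
      then show ?thesis using 2 by blast
    next
      case 3
      then have par: "y \<parallel> y'" using h covers_antichain by blast
      obtain t where t: "0 \<le> t" "cl p = left_rank x + t * (left_rank y - left_rank x)"
        "cr p = right_rank x + t * (right_rank y - right_rank x)"
        using p by (auto elim: edge_c)
      obtain s where s: "0 \<le> s" "cl p = left_rank x + s * (left_rank y' - left_rank x)"
        "cr p = right_rank x + s * (right_rank y' - right_rank x)"
        using p 3 by (auto elim: edge_c)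
      have "t = 0"
        by (rule par_directions[OF par, of 1 "left_rank x" "right_rank x" t s])
          (use t s ranks_lt[OF lt(1)] ranks_lt[OF lt(2)] 3 in auto)
      then have "p = dpos x" using t by (intro c_eqI) auto
      then show ?thesis using 3 by blast
    next
      case 4
      have par: "x \<parallel> x'"
        using finite_poset.covers_antichain[OF dual, of y x x'] h 4 by (simp add: par_converse)
      obtain t where t: "t \<le> 1" "cl p = left_rank x + t * (left_rank y - left_rank x)"
        "cr p = right_rank x + t * (right_rank y - right_rank x)"
        using p by (auto elim: edge_c)
      obtain s where s: "s \<le> 1" "cl p = left_rank x' + s * (left_rank y - left_rank x')"
        "cr p = right_rank x' + s * (right_rank y - right_rank x')"
        using p 4 by (auto elim: edge_c)
      have "1 - t = 0"
        by (rule par_directions[OF par, of "-1" "left_rank y" "right_rank y" "1 - t" "1 - s"])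
          (use t s ranks_lt[OF lt(1)] ranks_lt[OF lt(2)] 4 in \<open>auto simp: algebra_simps\<close>)
      then have "p = dpos y" using t by (intro c_eqI) auto
      then show ?thesis using 4 by blast
    qed
  qed
qed

section \<open>The left-of relation in the dominance drawing\<close>

lemma drawn_through_cone:
  assumes "p \<in> drawn_chains_through r dpos x"
  shows "left_rank x \<le> cl p \<and> right_rank x \<le> cr p \<or> cl p \<le> left_rank x \<and> cr p \<le> right_rank x"
proof -
  obtain C where C: "C \<in> Chains r" "x \<in> C" "p \<in> drawn_chain r dpos C"
    using assms unfolding drawn_chains_through_def by blast
  have ch: "x \<sqsubseteq> u \<or> u \<sqsubseteq> x" if "u \<in> C" for u using C that by (auto simp: Chains_def)
  from C(3) consider u where "u \<in> C" "p = dpos u"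
    | u v where "u \<in> C" "v \<in> C" "covers_P r u v" "p \<in> edge dpos u v"
    unfolding drawn_chain_def by blast
  then show ?thesis
  proof cases
    case 1
    then show ?thesis using ch[of u] ranks_le[of x u] ranks_le[of u x] by auto
  next
    case 2
    note bd = edge_bounds[OF 2(4) cover_lt[OF 2(3)]]
    have "x \<sqsubseteq> u \<or> v \<sqsubseteq> x"
      using ch[OF 2(1)] ch[OF 2(2)] cover_between[OF 2(3), of x] le_refl le_carrier by blast
    then show ?thesis using ranks_le[of x u] ranks_le[of v x] bd by auto
  qed
qed

text \<open>In rank coordinates the chains through \<open>x\<close> stay in the upper and lower
  quadrants at \<open>x\<close>. Along a horizontal segment \<open>cl + cr\<close> is constant, so
  both ends lie in the same one of these, and the segment cannot enter the open left
  quadrant.\<close>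

lemma S_region_cone:
  assumes "p \<in> S_region r dpos x"
  shows "\<not> (cl p < left_rank x \<and> right_rank x < cr p)"
proof
  assume p: "cl p < left_rank x \<and> right_rank x < cr p"
  then have "p \<notin> drawn_chains_through r dpos x" using drawn_through_cone by fastforce
  then obtain q q' where q: "q \<in> drawn_chains_through r dpos x" "q' \<in> drawn_chains_through r dpos x"
      "snd q = snd q'" "p \<in> closed_segment q q'"
    using assms unfolding S_region_def by blast
  obtain t where t: "0 \<le> t" "t \<le> 1" "p = (1 - t) *\<^sub>R q + t *\<^sub>R q'"
    using q by (auto simp: in_segment)
  have conv: "cl p = (1 - t) * cl q + t * cl q'" "cr p = (1 - t) * cr q + t * cr q'"
    unfolding t(3) c_combination by (auto simp: algebra_simps)
  have sum: "cl q + cr q = cl q' + cr q'" using q(3) by (simp add: cl_def cr_def field_simps)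
  note cone = drawn_through_cone[OF q(1)] drawn_through_cone[OF q(2)]
  show False
  proof (cases "left_rank x + right_rank x \<le> cl q + cr q")
    case True
    then have "left_rank x \<le> cl q" "left_rank x \<le> cl q'" using cone sum by auto
    then have "(1 - t) * left_rank x + t * left_rank x \<le> cl p"
      unfolding conv using t by (intro add_mono mult_left_mono) auto
    then show False using p by (simp add: algebra_simps)
  next
    case False
    then have "cr q \<le> right_rank x" "cr q' \<le> right_rank x" using cone sum by auto
    then have "cr p \<le> (1 - t) * right_rank x + t * right_rank x"
      unfolding conv using t by (intro add_mono mult_left_mono) auto
    then show False using p by (simp add: algebra_simps)
  qed
qed

text \<open>An incomparable \<open>y\<close> with smaller label lies in the open left quadrant at
  \<open>x\<close>, and a ray pointing left from it never leaves that quadrant.\<close>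

lemma left_of_less:
  assumes "x \<parallel> y" "left_of r dpos x y" shows "x < y"
proof (rule ccontr)
  assume "\<not> x < y"
  then have "y < x" using par_neq[OF assms(1)] by simp
  then have rk: "left_rank y < left_rank x" "right_rank x < right_rank y"
    using ranks_par[OF par_sym[OF assms(1)]] by auto
  obtain t where t: "0 \<le> t" "(fst (dpos y) - t, snd (dpos y)) \<in> S_region r dpos x"
    using assms by (auto simp: left_of_def)
  have "cl (fst (dpos y) - t, snd (dpos y)) = left_rank y - t / 2"
    "cr (fst (dpos y) - t, snd (dpos y)) = right_rank y + t / 2"
    by (auto simp: cl_def cr_def dpos_def field_simps)
  then show False using S_region_cone[OF t(2)] t(1) rk by auto
qed

end

lemma uniform_gap_imp_baxter:
  assumes P: "uniform_gap_poset {1..n} r" and b: "bounded_poset {1..n} r"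
  shows "baxter_poset n r"
proof -
  interpret uniform_gap_poset "{1..n}" r by (rule P)
  \<comment> \<open>All four forbidden chains have this shape: a cover jumping over two labels, one
    below it and one above it.\<close>
  have no_chain: False
    if h: "covers_P r x y" "btw k x y" "btw l x y" "less_P r k x" "less_P r y l" for x y k l
  proof -
    have "\<not> less_P r y k"
      using lt_trans[OF h(4) cover_lt[OF h(1)]] lt_not_le lt_le by blast
    moreover have "\<not> less_P r l x"
      using lt_trans[OF cover_lt[OF h(1)] h(5)] lt_not_le lt_le by blast
    ultimately show False using gap[OF h(1)] h lt_carrier by blast
  qed
  have chains: "\<nexists>a b c d. chain_2_14_3 r a b c d \<or> chain_3_14_2 r a b c d \<or>
      chain_2_41_3 r a b c d \<or> chain_3_41_2 r a b c d"
  proof (intro notI, elim exE disjE)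
    fix a b c d
    show False if "chain_2_14_3 r a b c d"
      using that no_chain[of a d b c] by (auto simp: chain_2_14_3_def btw_def)
    show False if "chain_3_14_2 r a b c d"
      using that no_chain[of a d c b] by (auto simp: chain_3_14_2_def btw_def)
    show False if "chain_2_41_3 r a b c d"
      using that no_chain[of d a b c] by (auto simp: chain_2_41_3_def btw_def)
    show False if "chain_3_41_2 r a b c d"
      using that no_chain[of d a c b] by (auto simp: chain_3_41_2_def btw_def)
  qed
  have facet: "\<bar>int x - int y\<bar> = 1"
    if xy: "(x, y) \<in> r" "disconnected_subposet r (open_interval r x y)" for x y
  proof -
    obtain w z where wz: "w \<in> open_interval r x y" "z \<in> open_interval r x y"
        "\<not> same_component r (open_interval r x y) w z"
      using xy by (auto simp: disconnected_subposet_def)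
    have "x \<noteq> y" using wz(1) lt_not_le lt_le by (auto simp: open_interval_def)
    have mem: "x \<in> {1..n}" "y \<in> {1..n}" using xy le_carrier by auto
    have no: "\<not> btw k x y" if "k \<in> {1..n}" for k using facet_no_gap[OF wz that] .
    show ?thesis
    proof (cases "x < y")
      case True
      then show ?thesis using no[of "Suc x"] mem by (auto simp: btw_def)
    next
      case False
      then show ?thesis using no[of "Suc y"] mem \<open>x \<noteq> y\<close> by (auto simp: btw_def)
    qed
  qed
  have "w < x \<and> x < z" if "w \<in> open_interval r x y" "z \<in> open_interval r x y"
    "\<not> same_component r (open_interval r x y) w z" "left_of r dpos w z" for w z x y
    using left_of_less[OF diff_component_par[OF that(1-3)] that(4)] facet_btw(1)[OF that(1-3)]
    by (auto simp: btw_def)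
  then show ?thesis
    unfolding baxter_poset_def
    using partial_order b card_upper_covers card_lower_covers chains facet planar_dpos by blast
qed

section \<open>Rectangulations of a grid\<close>

text \<open>Rectangle \<open>i\<close> consists of the unit cells in columns \<open>a i + 1, \<dots>, b i\<close> and rows
  \<open>c i + 1, \<dots>, d i\<close>, where rows are numbered downwards; so the diagonal consists of the cells
  \<open>(i, i)\<close>.\<close>

locale grid_rectangulation =
  fixes n :: nat and a b c d :: "nat \<Rightarrow> nat"
  assumes pos_n: "n \<ge> 1"
    and bounds: "i \<in> {1..n} \<Longrightarrow> a i < i \<and> i \<le> b i \<and> b i \<le> n \<and> c i < i \<and> i \<le> d i \<and> d i \<le> n"
    and covered: "p \<in> {1..n} \<Longrightarrow> q \<in> {1..n} \<Longrightarrow>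
      \<exists>i\<in>{1..n}. a i < p \<and> p \<le> b i \<and> c i < q \<and> q \<le> d i"
    and disjoint: "i \<in> {1..n} \<Longrightarrow> j \<in> {1..n} \<Longrightarrow> a i < p \<Longrightarrow> p \<le> b i \<Longrightarrow> c i < q \<Longrightarrow> q \<le> d i \<Longrightarrow>
      a j < p \<Longrightarrow> p \<le> b j \<Longrightarrow> c j < q \<Longrightarrow> q \<le> d j \<Longrightarrow> i = j"
begin

definition cell :: "nat \<Rightarrow> nat \<Rightarrow> nat \<Rightarrow> bool" where
  "cell i p q \<longleftrightarrow> i \<in> {1..n} \<and> a i < p \<and> p \<le> b i \<and> c i < q \<and> q \<le> d i"

text \<open>Since rows are numbered downwards, the step from \<open>i\<close> to \<open>j\<close>
  goes one cell to the right or one cell up.\<close>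

definition cadj :: "nat rel" where
  "cadj = {(i, j). i \<noteq> j \<and> (\<exists>p q. cell i p q \<and> cell j (Suc p) q \<or> cell i p (Suc q) \<and> cell j p q)}"

lemma cell_ex: "p \<in> {1..n} \<Longrightarrow> q \<in> {1..n} \<Longrightarrow> \<exists>i. cell i p q"
  using covered[of p q] unfolding cell_def by blast

lemma cell_unique: "cell i p q \<Longrightarrow> cell j p q \<Longrightarrow> i = j"
  using disjoint unfolding cell_def by blast

lemma cell_bounds: "cell i p q \<Longrightarrow> i \<in> {1..n} \<and> p \<in> {1..n} \<and> q \<in> {1..n}"
  using bounds[of i] by (auto simp: cell_def)

lemma cell_diag: "i \<in> {1..n} \<Longrightarrow> cell i i i"
  using bounds[of i] by (auto simp: cell_def)

text \<open>Otherwise rectangle \<open>i\<close>, containing the cells \<open>(i, i)\<close> and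
  \<open>(p, q)\<close>, would also contain the diagonal cell \<open>(p, p)\<close> or
  \<open>(q, q)\<close>, which belongs to another rectangle.\<close>

lemma cell_label_below:
  assumes "cell i p q" "p \<le> q" shows "p \<le> i" "i \<le> q"
proof -
  note cb = cell_bounds[OF assms(1)]
  show "p \<le> i"
  proof (rule ccontr)
    assume "\<not> p \<le> i"
    then have "cell i p p" using assms bounds[of i] by (auto simp: cell_def)
    then show False using cell_unique cell_diag[of p] cb \<open>\<not> p \<le> i\<close> by blast
  qed
  show "i \<le> q"
  proof (rule ccontr)
    assume "\<not> i \<le> q"
    then have "cell i q q" using assms bounds[of i] by (auto simp: cell_def)
    then show False using cell_unique cell_diag[of q] cb \<open>\<not> i \<le> q\<close> by blast
  qed
qed

lemma cell_label_above:
  assumes "cell i p q" "q \<le> p" shows "q \<le> i" "i \<le> p"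
proof -
  note cb = cell_bounds[OF assms(1)]
  show "q \<le> i"
  proof (rule ccontr)
    assume "\<not> q \<le> i"
    then have "cell i q q" using assms bounds[of i] by (auto simp: cell_def)
    then show False using cell_unique cell_diag[of q] cb \<open>\<not> q \<le> i\<close> by blast
  qed
  show "i \<le> p"
  proof (rule ccontr)
    assume "\<not> i \<le> p"
    then have "cell i p p" using assms bounds[of i] by (auto simp: cell_def)
    then show False using cell_unique cell_diag[of p] cb \<open>\<not> i \<le> p\<close> by blast
  qed
qed

lemma step_right: "cell i p q \<Longrightarrow> cell j (Suc p) q \<Longrightarrow> (i, j) \<in> Id_on {1..n} \<union> cadj\<^sup>+"
  using cell_bounds[of i p q] by (cases "i = j") (auto simp: cadj_def Id_on_iff intro!: r_into_trancl)

lemma step_up: "cell i p (Suc q) \<Longrightarrow> cell j p q \<Longrightarrow> (i, j) \<in> Id_on {1..n} \<union> cadj\<^sup>+"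
  using cell_bounds[of i p "Suc q"]
  by (cases "i = j") (auto simp: cadj_def Id_on_iff intro!: r_into_trancl)

context
  fixes r assumes r: "r = Id_on {1..n} \<union> cadj\<^sup>+" and po: "partial_order_on {1..n} r"
begin

interpretation nat_poset "{1..n}" r
  by unfold_locales (use po in auto)

text \<open>From the cell \<open>(p, q)\<close> walk to the diagonal cell \<open>(k, k)\<close> by
  steps to the right and upwards; each step ascends in the order. \<open>cell_above_max\<close>
  walks down and to the left instead.\<close>

lemma cell_below_min:
  assumes "cell i p q" "p \<le> k" "k \<le> q" shows "i \<sqsubseteq> k"
  using assms
proof (induction "q - p" arbitrary: i p q rule: less_induct)
  case less
  note cb = cell_bounds[OF less.prems(1)]
  consider "p < k" | "k < q" | "p = k" "q = k" using less.prems by linarith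
  then show ?case
  proof cases
    case 1
    then obtain j where j: "cell j (Suc p) q" using cell_ex[of "Suc p" q] cb less.prems by auto
    then have "j \<sqsubseteq> k" using less.hyps[of q "Suc p" j] 1 less.prems by auto
    moreover have "i \<sqsubseteq> j" using step_right[OF less.prems(1) j] r by simp
    ultimately show ?thesis using le_trans by blast
  next
    case 2
    then obtain q' where q': "q = Suc q'" by (cases q) auto
    then obtain j where j: "cell j p q'" using cell_ex[of p q'] cb less.prems 2 by auto
    then have "j \<sqsubseteq> k" using less.hyps[of q' p j] 2 less.prems q' by auto
    moreover have "i \<sqsubseteq> j" using step_up[of i p q' j] less.prems(1) j q' r by simp
    ultimately show ?thesis using le_trans by blast
  next
    case 3
    then have "i = k" using cell_unique cell_diag cb less.prems by blast
    then show ?thesis using le_refl cb by blast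
  qed
qed

lemma cell_above_max:
  assumes "cell i p q" "q \<le> k" "k \<le> p" shows "k \<sqsubseteq> i"
  using assms
proof (induction "p - q" arbitrary: i p q rule: less_induct)
  case less
  note cb = cell_bounds[OF less.prems(1)]
  consider "q < k" | "k < p" | "p = k" "q = k" using less.prems by linarith
  then show ?case
  proof cases
    case 1
    then obtain j where j: "cell j p (Suc q)" using cell_ex[of p "Suc q"] cb less.prems by auto
    then have "k \<sqsubseteq> j" using less.hyps[of p "Suc q" j] 1 less.prems by auto
    moreover have "j \<sqsubseteq> i" using step_up[OF j less.prems(1)] r by simp
    ultimately show ?thesis using le_trans by blast
  next
    case 2
    then obtain p' where p': "p = Suc p'" by (cases p) auto
    then obtain j where j: "cell j p' q" using cell_ex[of p' q] cb less.prems 2 by auto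
    then have "k \<sqsubseteq> j" using less.hyps[of p' q j] 2 less.prems p' by auto
    moreover have "j \<sqsubseteq> i" using step_right[of j p' q i] less.prems(1) j p' r by simp
    ultimately show ?thesis using le_trans by blast
  next
    case 3
    then have "i = k" using cell_unique cell_diag cb less.prems by blast
    then show ?thesis using le_refl cb by blast
  qed
qed

lemma cover_cadj:
  assumes "covers_P r i j" shows "(i, j) \<in> cadj"
proof -
  have "(i, j) \<in> cadj\<^sup>+" using cover_lt[OF assms] by (auto simp: less_P_def r)
  then consider "(i, j) \<in> cadj" | z where "(i, z) \<in> cadj" "(z, j) \<in> cadj\<^sup>+"
    by (meson converse_tranclE)
  then show ?thesis
  proof cases
    case (2 z)
    have "z \<noteq> i" using 2(1) by (auto simp: cadj_def)
    moreover have "i \<sqsubseteq> z" "z \<sqsubseteq> j" using 2 r by auto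
    ultimately have "z = j" using cover_between[OF assms] by blast
    then show ?thesis using 2 by simp
  qed
qed

lemma lt_of_le: "x \<sqsubseteq> y \<Longrightarrow> x \<noteq> y \<Longrightarrow> x \<sqsubset> y"
  by (simp add: less_P_def)

lemma uniform_gap: "uniform_gap_poset {1..n} r"
proof
  fix i j assume cov: "covers_P r i j"
  have ij: "i \<noteq> j" "\<not> j \<sqsubseteq> i" using cover_lt[OF cov] lt_neq lt_not_le by blast+
  from cover_cadj[OF cov] obtain p q where
    "cell i p q \<and> cell j (Suc p) q \<or> cell i p (Suc q) \<and> cell j p q"
    by (auto simp: cadj_def)
  then consider "cell i p q" "cell j (Suc p) q" "Suc p \<le> q" | "cell i p q" "cell j (Suc p) q" "q \<le> p"
    | "cell i p (Suc q)" "cell j p q" "p \<le> q" | "cell i p (Suc q)" "cell j p q" "Suc q \<le> p"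
    by linarith
  then show "(\<forall>k\<in>{1..n}. btw k i j \<longrightarrow> k \<sqsubset> i) \<or> (\<forall>k\<in>{1..n}. btw k i j \<longrightarrow> j \<sqsubset> k)"
  proof cases
    case 1
    have "p \<le> i" "i \<le> q" "Suc p \<le> j" "j \<le> q" using 1 cell_label_below by fastforce+
    \<comment> \<open>\<open>i\<close> is the minimum of the labels \<open>{p..q}\<close> and
      \<open>j\<close> that of \<open>{Suc p..q}\<close>. Since \<open>j\<close> is not below
      \<open>i\<close>, the two minima can differ only through the label \<open>p\<close>. The other
      three cases are analogous.\<close>
    moreover have "i = p"
      using cell_below_min[OF 1(2), of i] 1 ij \<open>i \<le> q\<close> \<open>p \<le> i\<close> by (cases "i = p") auto
    ultimately have "j \<sqsubset> k" if "btw k i j" for k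
      using cell_below_min[OF 1(2), of k] that by (intro lt_of_le) (auto simp: btw_def)
    then show ?thesis by blast
  next
    case 2
    have "q \<le> i" "i \<le> p" "q \<le> j" "j \<le> Suc p" using 2 cell_label_above by fastforce+
    moreover have "j = Suc p"
      using cell_above_max[OF 2(1), of j] 2 ij \<open>q \<le> j\<close> \<open>j \<le> Suc p\<close> by (cases "j = Suc p") auto
    ultimately have "k \<sqsubset> i" if "btw k i j" for k
      using cell_above_max[OF 2(1), of k] that by (intro lt_of_le) (auto simp: btw_def)
    then show ?thesis by blast
  next
    case 3
    have "p \<le> i" "i \<le> Suc q" "p \<le> j" "j \<le> q" using 3 cell_label_below by fastforce+
    moreover have "i = Suc q"
      using cell_below_min[OF 3(2), of i] 3 ij \<open>p \<le> i\<close> \<open>i \<le> Suc q\<close> by (cases "i = Suc q") auto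
    ultimately have "j \<sqsubset> k" if "btw k i j" for k
      using cell_below_min[OF 3(2), of k] that by (intro lt_of_le) (auto simp: btw_def)
    then show ?thesis by blast
  next
    case 4
    have "Suc q \<le> i" "i \<le> p" "q \<le> j" "j \<le> p" using 4 cell_label_above by fastforce+
    moreover have "j = q"
      using cell_above_max[OF 4(1), of j] 4 ij \<open>q \<le> j\<close> \<open>j \<le> p\<close> by (cases "j = q") auto
    ultimately have "k \<sqsubset> i" if "btw k i j" for k
      using cell_above_max[OF 4(1), of k] that by (intro lt_of_le) (auto simp: btw_def)
    then show ?thesis by blast
  qed
qed

text \<open>The rectangle in the upper right corner holds the maximum of all labels, the one in the
  lower left corner the minimum.\<close>

lemma bounded_cadj: "bounded_poset {1..n} r"
proof -
  obtain t where t: "cell t n 1" using cell_ex[of n 1] pos_n by auto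
  obtain s where s: "cell s 1 n" using cell_ex[of 1 n] pos_n by auto
  have "x \<sqsubseteq> t" "s \<sqsubseteq> x" if "x \<in> {1..n}" for x
    using cell_above_max[OF t, of x] cell_below_min[OF s, of x] that by auto
  then show ?thesis
    using cell_bounds[OF t] cell_bounds[OF s] unfolding bounded_poset_def less_P_def by blast
qed

end

end

text \<open>Cell \<open>(p, q)\<close> belongs to the minimum of the interval \<open>[p, q]\<close> of labels if \<open>p \<le> q\<close>, and to
  the maximum of \<open>[q, p]\<close> if \<open>q \<le> p\<close>.\<close>

locale bounded_uniform_gap_poset = uniform_gap_poset "{1..n}" r for n r +
  assumes bounded: "bounded_poset {1..n} r" and pos_n: "n \<ge> 1"
begin

lemma dual_bounded: "bounded_uniform_gap_poset n (r\<inverse>)"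
  using dual_gap bounded pos_n
  by (simp add: bounded_uniform_gap_poset_def bounded_uniform_gap_poset_axioms_def)

text \<open>Two minimal elements of a label interval would be incomparable, and a maximal lower
  bound of them has a label between theirs, hence inside the interval.\<close>

lemma interval_min:
  assumes "1 \<le> p" "p \<le> q" "q \<le> n"
  obtains m where "m \<in> {p..q}" "\<And>k. k \<in> {p..q} \<Longrightarrow> m \<sqsubseteq> k"
proof -
  have sub: "{p..q} \<subseteq> {1..n}" using assms by auto
  obtain m where m: "m \<in> {p..q}" "\<And>k. k \<in> {p..q} \<Longrightarrow> \<not> k \<sqsubset> m"
    by (rule ex_minimal_below[of "{p..q}" p]) (use sub assms in auto)
  have "m \<sqsubseteq> k" if k: "k \<in> {p..q}" for k
  proof -
    obtain l where l: "l \<in> {p..q}" "l \<sqsubseteq> k" "\<And>j. j \<in> {p..q} \<Longrightarrow> \<not> j \<sqsubset> l"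
      by (rule ex_minimal_below[of "{p..q}" k]) (use sub k in auto)
    have "l = m"
    proof (rule ccontr)
      assume "l \<noteq> m"
      then have par: "par l m" using cases_le[of l m] m l sub by blast
      obtain t where t: "t \<in> {1..n}" "\<And>x. x \<in> {1..n} \<Longrightarrow> t \<sqsubseteq> x"
        by (rule bot_exists[OF bounded]) auto
      have "t \<sqsubseteq> l" "t \<sqsubseteq> m" using t l m sub by auto
      then obtain g where g: "max_lb g l m" by (rule ex_max_lb)
      have "btw g l m" by (rule max_lb_btw[OF par g])
      then have "g \<in> {p..q}" using l m by (auto simp: btw_def)
      moreover have "g \<sqsubset> m" using g par unfolding max_lb_def par_def less_P_def by blast
      ultimately show False using m by blast
    qed
    then show ?thesis using l by simp
  qed
  then show ?thesis using that m by blast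
qed

lemma interval_max:
  assumes "1 \<le> p" "p \<le> q" "q \<le> n"
  obtains m where "m \<in> {p..q}" "\<And>k. k \<in> {p..q} \<Longrightarrow> k \<sqsubseteq> m"
  by (rule bounded_uniform_gap_poset.interval_min[OF dual_bounded assms]) (use that in auto)

text \<open>In row \<open>i\<close>, rectangle \<open>i\<close> extends to the left while
  \<open>i\<close> is the minimum of \<open>{p..i}\<close>, and to the right while it is the maximum
  of \<open>{i..p}\<close>; likewise in column \<open>i\<close> with the roles exchanged.
  \<open>0\<close> and \<open>Suc n\<close> lie outside the carrier and act as sentinels, so each
  set is nonempty.\<close>

definition la :: "nat \<Rightarrow> nat" where "la i = Max {k. k < i \<and> \<not> i \<sqsubseteq> k}"
definition lc :: "nat \<Rightarrow> nat" where "lc i = Max {k. k < i \<and> \<not> k \<sqsubseteq> i}"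
definition lb :: "nat \<Rightarrow> nat" where "lb i = Min {k. i < k \<and> k \<le> Suc n \<and> \<not> k \<sqsubseteq> i} - 1"
definition ld :: "nat \<Rightarrow> nat" where "ld i = Min {k. i < k \<and> k \<le> Suc n \<and> \<not> i \<sqsubseteq> k} - 1"

lemma out: "\<not> i \<sqsubseteq> 0" "\<not> 0 \<sqsubseteq> i" "\<not> i \<sqsubseteq> Suc n" "\<not> Suc n \<sqsubseteq> i"
  using le_carrier[of i 0] le_carrier[of 0 i] le_carrier[of i "Suc n"] le_carrier[of "Suc n" i] by auto

lemma la_less:
  assumes "i \<in> {1..n}" shows "la i < p \<longleftrightarrow> (\<forall>k. p \<le> k \<and> k < i \<longrightarrow> i \<sqsubseteq> k)"
    and "lc i < p \<longleftrightarrow> (\<forall>k. p \<le> k \<and> k < i \<longrightarrow> k \<sqsubseteq> i)"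
proof -
  have "0 \<in> {k. k < i \<and> \<not> i \<sqsubseteq> k}" "0 \<in> {k. k < i \<and> \<not> k \<sqsubseteq> i}" using assms out by auto
  then have "{k. k < i \<and> \<not> i \<sqsubseteq> k} \<noteq> {}" "{k. k < i \<and> \<not> k \<sqsubseteq> i} \<noteq> {}" by blast+
  then show "la i < p \<longleftrightarrow> (\<forall>k. p \<le> k \<and> k < i \<longrightarrow> i \<sqsubseteq> k)"
    "lc i < p \<longleftrightarrow> (\<forall>k. p \<le> k \<and> k < i \<longrightarrow> k \<sqsubseteq> i)"
    unfolding la_def lc_def by (subst Max_less_iff; force simp: not_less)+
qed

lemma le_ld:
  assumes "i \<in> {1..n}" "p \<le> n"
  shows "p \<le> ld i \<longleftrightarrow> (\<forall>k. i < k \<and> k \<le> p \<longrightarrow> i \<sqsubseteq> k)"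
    and "p \<le> lb i \<longleftrightarrow> (\<forall>k. i < k \<and> k \<le> p \<longrightarrow> k \<sqsubseteq> i)" and "ld i \<le> n" and "lb i \<le> n"
proof -
  let ?S = "{k. i < k \<and> k \<le> Suc n \<and> \<not> i \<sqsubseteq> k}" and ?T = "{k. i < k \<and> k \<le> Suc n \<and> \<not> k \<sqsubseteq> i}"
  have mem: "Suc n \<in> ?S" "Suc n \<in> ?T" using assms out by auto
  then have ne: "?S \<noteq> {}" "?T \<noteq> {}" by blast+
  have fin: "finite ?S" "finite ?T" by auto
  have "Min ?S \<in> ?S" "Min ?T \<in> ?T" using Min_in fin ne by blast+
  then have "p \<le> ld i \<longleftrightarrow> p < Min ?S" "p \<le> lb i \<longleftrightarrow> p < Min ?T" unfolding ld_def lb_def by auto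
  moreover have "p < Min ?S \<longleftrightarrow> (\<forall>k\<in>?S. p < k)" "p < Min ?T \<longleftrightarrow> (\<forall>k\<in>?T. p < k)"
    using Min_gr_iff fin ne by blast+
  moreover have "(\<forall>k\<in>?S. p < k) \<longleftrightarrow> (\<forall>k. i < k \<and> k \<le> p \<longrightarrow> i \<sqsubseteq> k)"
    "(\<forall>k\<in>?T. p < k) \<longleftrightarrow> (\<forall>k. i < k \<and> k \<le> p \<longrightarrow> k \<sqsubseteq> i)"
    using assms(2) by (safe; force simp: not_less[symmetric])+
  ultimately show "p \<le> ld i \<longleftrightarrow> (\<forall>k. i < k \<and> k \<le> p \<longrightarrow> i \<sqsubseteq> k)"
    "p \<le> lb i \<longleftrightarrow> (\<forall>k. i < k \<and> k \<le> p \<longrightarrow> k \<sqsubseteq> i)" by simp_all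
  have "Min ?S \<le> Suc n" "Min ?T \<le> Suc n" using Min_le fin mem by blast+
  then show "ld i \<le> n" "lb i \<le> n" unfolding ld_def lb_def by auto
qed

definition cel :: "nat \<Rightarrow> nat \<Rightarrow> nat \<Rightarrow> bool" where
  "cel i p q \<longleftrightarrow> la i < p \<and> p \<le> lb i \<and> lc i < q \<and> q \<le> ld i"

lemma cel_iff:
  assumes "i \<in> {1..n}" "p \<in> {1..n}" "q \<in> {1..n}"
  shows "cel i p q \<longleftrightarrow> (\<forall>k. p \<le> k \<and> k < i \<longrightarrow> i \<sqsubseteq> k) \<and> (\<forall>k. i < k \<and> k \<le> p \<longrightarrow> k \<sqsubseteq> i) \<and>
    (\<forall>k. q \<le> k \<and> k < i \<longrightarrow> k \<sqsubseteq> i) \<and> (\<forall>k. i < k \<and> k \<le> q \<longrightarrow> i \<sqsubseteq> k)"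
  using assms by (simp add: cel_def la_less le_ld)

text \<open>If \<open>i\<close> missed the interval, two of the four wall conditions would place
  \<open>p\<close> or \<open>q\<close> both below and above \<open>i\<close>.\<close>

lemma cel_below:
  assumes "i \<in> {1..n}" "p \<in> {1..n}" "q \<in> {1..n}" "p \<le> q"
  shows "cel i p q \<longleftrightarrow> i \<in> {p..q} \<and> (\<forall>k\<in>{p..q}. i \<sqsubseteq> k)"
proof
  assume "cel i p q"
  then have *: "\<And>k. p \<le> k \<Longrightarrow> k < i \<Longrightarrow> i \<sqsubseteq> k" "\<And>k. i < k \<Longrightarrow> k \<le> p \<Longrightarrow> k \<sqsubseteq> i"
    "\<And>k. q \<le> k \<Longrightarrow> k < i \<Longrightarrow> k \<sqsubseteq> i" "\<And>k. i < k \<Longrightarrow> k \<le> q \<Longrightarrow> i \<sqsubseteq> k"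
    using cel_iff assms by auto
  have "\<not> i < p" using *(2)[of p] *(4)[of p] le_antisym[of p i] assms by auto
  moreover have "\<not> q < i" using *(1)[of q] *(3)[of q] le_antisym[of q i] assms by auto
  moreover have "i \<sqsubseteq> k" if "k \<in> {p..q}" for k
    using *(1)[of k] *(4)[of k] le_refl[of i] that assms(1) by (cases k i rule: linorder_cases) auto
  ultimately show "i \<in> {p..q} \<and> (\<forall>k\<in>{p..q}. i \<sqsubseteq> k)" by auto
next
  assume "i \<in> {p..q} \<and> (\<forall>k\<in>{p..q}. i \<sqsubseteq> k)"
  then show "cel i p q" using cel_iff[OF assms(1-3)] by auto
qed

lemma cel_above:
  assumes "i \<in> {1..n}" "p \<in> {1..n}" "q \<in> {1..n}" "q \<le> p"
  shows "cel i p q \<longleftrightarrow> i \<in> {q..p} \<and> (\<forall>k\<in>{q..p}. k \<sqsubseteq> i)"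
proof
  assume "cel i p q"
  then have *: "\<And>k. p \<le> k \<Longrightarrow> k < i \<Longrightarrow> i \<sqsubseteq> k" "\<And>k. i < k \<Longrightarrow> k \<le> p \<Longrightarrow> k \<sqsubseteq> i"
    "\<And>k. q \<le> k \<Longrightarrow> k < i \<Longrightarrow> k \<sqsubseteq> i" "\<And>k. i < k \<Longrightarrow> k \<le> q \<Longrightarrow> i \<sqsubseteq> k"
    using cel_iff assms by auto
  have "\<not> i < q" using *(2)[of q] *(4)[of q] le_antisym[of q i] assms by auto
  moreover have "\<not> p < i" using *(1)[of p] *(3)[of p] le_antisym[of p i] assms by auto
  moreover have "k \<sqsubseteq> i" if "k \<in> {q..p}" for k
    using *(2)[of k] *(3)[of k] le_refl[of i] that assms(1) by (cases k i rule: linorder_cases) auto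
  ultimately show "i \<in> {q..p} \<and> (\<forall>k\<in>{q..p}. k \<sqsubseteq> i)" by auto
next
  assume "i \<in> {q..p} \<and> (\<forall>k\<in>{q..p}. k \<sqsubseteq> i)"
  then show "cel i p q" using cel_iff[OF assms(1-3)] by auto
qed

lemma grid: "grid_rectangulation n la lb lc ld"
proof
  show "1 \<le> n" by (rule pos_n)
  show "la i < i \<and> i \<le> lb i \<and> lb i \<le> n \<and> lc i < i \<and> i \<le> ld i \<and> ld i \<le> n" if "i \<in> {1..n}" for i
    using that la_less[OF that, of i] le_ld[OF that, of i] by auto
  show "\<exists>i\<in>{1..n}. la i < p \<and> p \<le> lb i \<and> lc i < q \<and> q \<le> ld i"
    if pq: "p \<in> {1..n}" "q \<in> {1..n}" for p q
  proof (cases "p \<le> q")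
    case True
    obtain m where "m \<in> {p..q}" "\<And>k. k \<in> {p..q} \<Longrightarrow> m \<sqsubseteq> k"
      by (rule interval_min[of p q]) (use pq True in auto)
    then show ?thesis using cel_below[of m p q] pq True unfolding cel_def by auto
  next
    case False
    obtain m where "m \<in> {q..p}" "\<And>k. k \<in> {q..p} \<Longrightarrow> k \<sqsubseteq> m"
      by (rule interval_max[of q p]) (use pq False in auto)
    then show ?thesis using cel_above[of m p q] pq False unfolding cel_def by auto
  qed
  show "i = j" if "i \<in> {1..n}" "j \<in> {1..n}" "la i < p" "p \<le> lb i" "lc i < q" "q \<le> ld i"
    "la j < p" "p \<le> lb j" "lc j < q" "q \<le> ld j" for i j p q
  proof -
    have c: "cel i p q" "cel j p q" using that by (auto simp: cel_def)
    have pq: "p \<in> {1..n}" "q \<in> {1..n}" using that le_ld[OF that(1), of 0] by auto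
    show ?thesis
    proof (cases "p \<le> q")
      case True
      then show ?thesis using cel_below[of _ p q] c pq that(1,2) le_antisym by metis
    next
      case False
      then have "q \<le> p" by simp
      then show ?thesis using cel_above[of _ p q] c pq that(1,2) le_antisym by metis
    qed
  qed
qed

section \<open>Adjacent cells of the constructed grid generate the given order\<close>

interpretation g: grid_rectangulation n la lb lc ld by (rule grid)

lemma gcell_iff: "g.cell i p q \<longleftrightarrow> i \<in> {1..n} \<and> cel i p q"
  by (auto simp: g.cell_def cel_def)

lemma cell_below: "p \<le> q \<Longrightarrow> g.cell i p q \<longleftrightarrow> 1 \<le> p \<and> q \<le> n \<and> i \<in> {p..q} \<and> (\<forall>k\<in>{p..q}. i \<sqsubseteq> k)"
  and cell_above: "q \<le> p \<Longrightarrow> g.cell i p q \<longleftrightarrow> 1 \<le> q \<and> p \<le> n \<and> i \<in> {q..p} \<and> (\<forall>k\<in>{q..p}. k \<sqsubseteq> i)"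
proof -
  assume *: "p \<le> q"
  show "g.cell i p q \<longleftrightarrow> 1 \<le> p \<and> q \<le> n \<and> i \<in> {p..q} \<and> (\<forall>k\<in>{p..q}. i \<sqsubseteq> k)"
  proof
    assume c: "g.cell i p q"
    then show "1 \<le> p \<and> q \<le> n \<and> i \<in> {p..q} \<and> (\<forall>k\<in>{p..q}. i \<sqsubseteq> k)"
      using g.cell_bounds[OF c] cel_below[of i p q] * unfolding gcell_iff by auto
  next
    assume c: "1 \<le> p \<and> q \<le> n \<and> i \<in> {p..q} \<and> (\<forall>k\<in>{p..q}. i \<sqsubseteq> k)"
    then have "i \<in> {1..n}" "p \<in> {1..n}" "q \<in> {1..n}" by auto
    from cel_below[OF this *] c this(1) show "g.cell i p q" unfolding gcell_iff by blast
  qed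
next
  assume *: "q \<le> p"
  show "g.cell i p q \<longleftrightarrow> 1 \<le> q \<and> p \<le> n \<and> i \<in> {q..p} \<and> (\<forall>k\<in>{q..p}. k \<sqsubseteq> i)"
  proof
    assume c: "g.cell i p q"
    then show "1 \<le> q \<and> p \<le> n \<and> i \<in> {q..p} \<and> (\<forall>k\<in>{q..p}. k \<sqsubseteq> i)"
      using g.cell_bounds[OF c] cel_above[of i p q] * unfolding gcell_iff by auto
  next
    assume c: "1 \<le> q \<and> p \<le> n \<and> i \<in> {q..p} \<and> (\<forall>k\<in>{q..p}. k \<sqsubseteq> i)"
    then have "i \<in> {1..n}" "p \<in> {1..n}" "q \<in> {1..n}" by auto
    from cel_above[OF this *] c this(1) show "g.cell i p q" unfolding gcell_iff by blast
  qed
qed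

lemma cadj_le:
  assumes "(i, j) \<in> g.cadj" shows "i \<sqsubseteq> j"
proof -
  obtain p q where "g.cell i p q \<and> g.cell j (Suc p) q \<or> g.cell i p (Suc q) \<and> g.cell j p q"
    using assms by (auto simp: g.cadj_def)
  then consider "g.cell i p q" "g.cell j (Suc p) q" "Suc p \<le> q" | "g.cell i p q" "g.cell j (Suc p) q" "q \<le> p"
    | "g.cell i p (Suc q)" "g.cell j p q" "p \<le> q" | "g.cell i p (Suc q)" "g.cell j p q" "Suc q \<le> p"
    by linarith
  then show ?thesis
  proof cases
    case 1
    then show ?thesis using cell_below[of p q i] cell_below[of "Suc p" q j] by auto
  next
    case 2
    then show ?thesis using cell_above[of q p i] cell_above[of q "Suc p" j] by auto
  next
    case 3
    then show ?thesis using cell_below[of p "Suc q" i] cell_below[of p q j] by auto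
  next
    case 4
    then show ?thesis using cell_above[of "Suc q" p i] cell_above[of q p j] by auto
  qed
qed

text \<open>If the labels between \<open>i\<close> and \<open>j\<close> lie above \<open>j\<close>,
  then \<open>i\<close> is the minimum of the whole label interval and \<open>j\<close> the minimum
  once the end \<open>i\<close> is removed. These two intervals name neighbouring cells. If the
  labels lie below \<open>i\<close>, maxima are used instead.\<close>

lemma cover_cadj_poset:
  assumes cov: "covers_P r i j" shows "(i, j) \<in> g.cadj"
proof -
  have ij: "i \<noteq> j" "i \<sqsubseteq> j" "i \<in> {1..n}" "j \<in> {1..n}"
    using cover_lt[OF cov] lt_neq lt_le lt_carrier by blast+
  have refl: "i \<sqsubseteq> i" "j \<sqsubseteq> j" using le_refl ij by auto
  have inside: "btw k i j \<or> k = i \<or> k = j" if "k \<in> {i..j} \<or> k \<in> {j..i}" for k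
    using that by (auto simp: btw_def)
  from gap[OF cov] show ?thesis
  proof
    assume up: "\<forall>k\<in>{1..n}. btw k i j \<longrightarrow> j \<sqsubset> k"
    have le_j: "j \<sqsubseteq> k" if "k \<in> {i..j} \<or> k \<in> {j..i}" "k \<noteq> i" for k
    proof -
      have "k \<in> {1..n}" using that ij by auto
      then show ?thesis using inside[OF that(1)] that(2) up refl lt_le by blast
    qed
    then have le_i: "i \<sqsubseteq> k" if "k \<in> {i..j} \<or> k \<in> {j..i}" for k
      using that refl le_trans[OF ij(2)] by blast
    show ?thesis
    proof (cases "i < j")
      case True
      then have "\<forall>k\<in>{i..j}. i \<sqsubseteq> k" "\<forall>k\<in>{Suc i..j}. j \<sqsubseteq> k" using le_i le_j by auto
      then have "g.cell i i j" "g.cell j (Suc i) j"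
        using ij True cell_below[of i j i] cell_below[of "Suc i" j j] by auto
      then show ?thesis using ij by (auto simp: g.cadj_def)
    next
      case False
      then obtain i' where i': "i = Suc i'" using ij by (cases i) auto
      then have "\<forall>k\<in>{j..i}. i \<sqsubseteq> k" "\<forall>k\<in>{j..i'}. j \<sqsubseteq> k" using le_i le_j by auto
      then have "g.cell i j (Suc i')" "g.cell j j i'"
        using ij False i' cell_below[of j i i] cell_below[of j i' j] by auto
      then show ?thesis using ij by (auto simp: g.cadj_def)
    qed
  next
    assume dn: "\<forall>k\<in>{1..n}. btw k i j \<longrightarrow> k \<sqsubset> i"
    have le_i: "k \<sqsubseteq> i" if "k \<in> {i..j} \<or> k \<in> {j..i}" "k \<noteq> j" for k
    proof -
      have "k \<in> {1..n}" using that ij by auto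
      then show ?thesis using inside[OF that(1)] that(2) dn refl lt_le by blast
    qed
    then have le_j: "k \<sqsubseteq> j" if "k \<in> {i..j} \<or> k \<in> {j..i}" for k
      using that refl le_trans[OF _ ij(2)] by blast
    show ?thesis
    proof (cases "i < j")
      case True
      then obtain j' where j': "j = Suc j'" by (cases j) auto
      then have "\<forall>k\<in>{i..j'}. k \<sqsubseteq> i" "\<forall>k\<in>{i..j}. k \<sqsubseteq> j" using le_i le_j by auto
      then have "g.cell i j' i" "g.cell j (Suc j') i"
        using ij True j' cell_above[of i j' i] cell_above[of i j j] by auto
      then show ?thesis using ij by (auto simp: g.cadj_def)
    next
      case False
      then have "\<forall>k\<in>{Suc j..i}. k \<sqsubseteq> i" "\<forall>k\<in>{j..i}. k \<sqsubseteq> j" using le_i le_j by auto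
      then have "g.cell i i (Suc j)" "g.cell j i j"
        using ij False cell_above[of "Suc j" i i] cell_above[of j i j] by auto
      then show ?thesis using ij by (auto simp: g.cadj_def)
    qed
  qed
qed

lemma r_eq_cadj: "r = Id_on {1..n} \<union> g.cadj\<^sup>+"
proof
  have "g.cadj \<subseteq> r" using cadj_le by auto
  then have "g.cadj\<^sup>+ \<subseteq> r\<^sup>+" using trancl_mono by blast
  then have "g.cadj\<^sup>+ \<subseteq> r" using trancl_id[OF partial_order_onD(2)[OF partial_order]] by simp
  then show "Id_on {1..n} \<union> g.cadj\<^sup>+ \<subseteq> r" using le_refl by auto
  have "(x, y) \<in> g.cadj\<^sup>+" if "x \<sqsubset> y" for x y
    using that
  proof (induction "card {z. x \<sqsubset> z \<and> z \<sqsubset> y}" arbitrary: y rule: less_induct)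
    case less
    obtain u where u: "x \<sqsubseteq> u" "covers_P r u y" using lower_cover[OF less.prems] by blast
    have uy: "u \<sqsubset> y" "(u, y) \<in> g.cadj" using u cover_lt cover_cadj_poset by blast+
    show ?case
    proof (cases "x = u")
      case True then show ?thesis using uy by blast
    next
      case False
      then have xu: "x \<sqsubset> u" using u by (simp add: less_P_def)
      have "{z. x \<sqsubset> z \<and> z \<sqsubset> u} \<subset> {z. x \<sqsubset> z \<and> z \<sqsubset> y}"
      proof
        show "{z. x \<sqsubset> z \<and> z \<sqsubset> u} \<subseteq> {z. x \<sqsubset> z \<and> z \<sqsubset> y}" using lt_trans[OF _ uy(1)] by blast
        show "{z. x \<sqsubset> z \<and> z \<sqsubset> u} \<noteq> {z. x \<sqsubset> z \<and> z \<sqsubset> y}" using xu uy lt_irrefl by blast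
      qed
      moreover have "finite {z. x \<sqsubset> z \<and> z \<sqsubset> y}"
        by (rule finite_subset[OF _ finite_carrier]) (auto dest: lt_carrier)
      ultimately have "card {z. x \<sqsubset> z \<and> z \<sqsubset> u} < card {z. x \<sqsubset> z \<and> z \<sqsubset> y}"
        by (simp add: psubset_card_mono)
      from less.hyps[OF this xu] show ?thesis using uy by (meson trancl_into_trancl)
    qed
  qed
  then show "r \<subseteq> Id_on {1..n} \<union> g.cadj\<^sup>+"
  proof (intro subrelI)
    fix x y assume "x \<sqsubseteq> y" and lt: "\<And>x y. x \<sqsubset> y \<Longrightarrow> (x, y) \<in> g.cadj\<^sup>+"
    then consider "x \<sqsubset> y" | "x = y" "x \<in> {1..n}" using le_imp_lt_or_eq le_carrier by blast
    then show "(x, y) \<in> Id_on {1..n} \<union> g.cadj\<^sup>+" using lt by cases auto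
  qed
qed

end

section \<open>Boxes in the unit square\<close>

lemma cbox_pair: "cbox (x1::real, y1::real) (x2, y2) = {x1..x2} \<times> {y1..y2}"
  unfolding cbox_Pair_eq by (simp add: cbox_interval)

lemma interior_cbox_pair: "interior (cbox (x1::real, y1::real) (x2, y2)) = {x1<..<x2} \<times> {y1<..<y2}"
  unfolding cbox_pair by (simp add: interior_Times)

lemma sides_cbox:
  fixes x1 x2 y1 y2 :: real
  assumes "x1 < x2" "y1 < y2"
  shows "left_side (cbox (x1, y1) (x2, y2)) = {x1} \<times> {y1..y2}"
    and "right_side (cbox (x1, y1) (x2, y2)) = {x2} \<times> {y1..y2}"
    and "bottom_side (cbox (x1, y1) (x2, y2)) = {x1..x2} \<times> {y1}"
    and "top_side (cbox (x1, y1) (x2, y2)) = {x1..x2} \<times> {y2}"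
proof -
  let ?B = "{x1..x2} \<times> {y1..y2}"
  have c1: "(x1, y1) \<in> ?B" and c2: "(x2, y2) \<in> ?B" using assms by auto
  have "(\<forall>q\<in>?B. u \<le> fst q) \<longleftrightarrow> u \<le> x1" "(\<forall>q\<in>?B. u \<le> snd q) \<longleftrightarrow> u \<le> y1" for u
    using bspec[OF _ c1, of "\<lambda>q. u \<le> fst q"] bspec[OF _ c1, of "\<lambda>q. u \<le> snd q"] by fastforce+
  moreover have "(\<forall>q\<in>?B. fst q \<le> u) \<longleftrightarrow> x2 \<le> u" "(\<forall>q\<in>?B. snd q \<le> u) \<longleftrightarrow> y2 \<le> u" for u
    using bspec[OF _ c2, of "\<lambda>q. fst q \<le> u"] bspec[OF _ c2, of "\<lambda>q. snd q \<le> u"] by fastforce+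
  ultimately show "left_side (cbox (x1, y1) (x2, y2)) = {x1} \<times> {y1..y2}"
    "right_side (cbox (x1, y1) (x2, y2)) = {x2} \<times> {y1..y2}"
    "bottom_side (cbox (x1, y1) (x2, y2)) = {x1..x2} \<times> {y1}"
    "top_side (cbox (x1, y1) (x2, y2)) = {x1..x2} \<times> {y2}"
    using assms unfolding left_side_def right_side_def bottom_side_def top_side_def cbox_pair
    by (simp_all only:) auto
qed

lemma rel_interior_sides_cbox:
  fixes x1 x2 y1 y2 :: real
  assumes "x1 < x2" "y1 < y2"
  shows "rel_interior (left_side (cbox (x1, y1) (x2, y2))) = {x1} \<times> {y1<..<y2}"
    and "rel_interior (right_side (cbox (x1, y1) (x2, y2))) = {x2} \<times> {y1<..<y2}"
    and "rel_interior (bottom_side (cbox (x1, y1) (x2, y2))) = {x1<..<x2} \<times> {y1}"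
    and "rel_interior (top_side (cbox (x1, y1) (x2, y2))) = {x1<..<x2} \<times> {y2}"
  using assms by (simp_all add: sides_cbox rel_interior_Times)

lemma open_meets_interior:
  assumes "open U" "p \<in> U" "p \<in> cbox u v" "interior (cbox u v) \<noteq> {}"
  shows "U \<inter> interior (cbox u v) \<noteq> {}"
proof -
  have "closure (interior (cbox u v)) = cbox u v" using assms(4) by (simp add: closure_box)
  then show ?thesis using open_Int_closure_eq_empty[OF assms(1)] assms by blast
qed

lemma main_diagonal_iff: "p \<in> main_diagonal \<longleftrightarrow> (\<exists>t. 0 \<le> t \<and> t \<le> 1 \<and> p = (t, 1 - t))"
  by (auto simp: main_diagonal_def closed_segment_def)

context grid_rectangulation
begin

text \<open>The second coordinate is reversed because rows are counted from the top.\<close>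

definition gbox :: "nat \<Rightarrow> (real \<times> real) set" where
  "gbox i = cbox (real (a i) / n, 1 - real (d i) / n) (real (b i) / n, 1 - real (c i) / n)"

lemma gbox_eq: "gbox i = {real (a i) / n..real (b i) / n} \<times> {1 - real (d i) / n..1 - real (c i) / n}"
  by (simp add: gbox_def cbox_pair)

lemma interior_gbox:
  "interior (gbox i) = {real (a i) / n<..<real (b i) / n} \<times> {1 - real (d i) / n<..<1 - real (c i) / n}"
  unfolding gbox_def interior_cbox_pair by simp

lemma frontier_gbox: "frontier (gbox i) = gbox i - interior (gbox i)"
  by (simp add: frontier_def gbox_def)

lemma proper: "i \<in> {1..n} \<Longrightarrow> a i < b i" "i \<in> {1..n} \<Longrightarrow> c i < d i"
  using bounds[of i] by auto

lemma n_pos: "0 < real n"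
  using pos_n by simp

lemma divn: "x / real n < y / real n \<longleftrightarrow> x < y" "x / real n \<le> y / real n \<longleftrightarrow> x \<le> y"
  using n_pos by (auto simp: divide_less_cancel divide_le_cancel)

lemma overlap_eq:
  assumes "i \<in> {1..n}" "j \<in> {1..n}"
    "max (a i) (a j) < min (b i) (b j)" "max (c i) (c j) < min (d i) (d j)"
  shows "i = j"
  using disjoint[OF assms(1,2), of "Suc (max (a i) (a j))" "Suc (max (c i) (c j))"] assms by auto

lemma gbox_interior_disjoint:
  assumes "i \<in> {1..n}" "j \<in> {1..n}" "interior (gbox i) \<inter> interior (gbox j) \<noteq> {}"
  shows "i = j"
proof -
  obtain x y where xy: "(x, y) \<in> interior (gbox i)" "(x, y) \<in> interior (gbox j)"
    using assms(3) by auto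
  have "real (a i) / n < real (b j) / n" "real (a j) / n < real (b i) / n"
    "real (c i) / n < real (d j) / n" "real (c j) / n < real (d i) / n"
    using xy unfolding interior_gbox by auto
  then have "a i < b j" "a j < b i" "c i < d j" "c j < d i" unfolding divn by auto
  then show ?thesis using overlap_eq[OF assms(1,2)] proper assms by auto
qed

text \<open>Sides that overlap in a segment contain the side of a unit cell, whose midpoint serves
  as witness for the converse direction.\<close>

lemma adjacency_gbox: "adjacency n gbox = cadj"
proof -
  have sides: "rel_interior (left_side (gbox i)) = {real (a i) / n} \<times> {1 - real (d i) / n<..<1 - real (c i) / n}"
    "rel_interior (right_side (gbox i)) = {real (b i) / n} \<times> {1 - real (d i) / n<..<1 - real (c i) / n}"
    "rel_interior (bottom_side (gbox i)) = {real (a i) / n<..<real (b i) / n} \<times> {1 - real (d i) / n}"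
    "rel_interior (top_side (gbox i)) = {real (a i) / n<..<real (b i) / n} \<times> {1 - real (c i) / n}"
    if "i \<in> {1..n}" for i
    unfolding gbox_def using proper[OF that] n_pos
    by (simp_all add: rel_interior_sides_cbox divn)
  have "(i, j) \<in> adjacency n gbox \<longleftrightarrow> (i, j) \<in> cadj" if ij: "i \<in> {1..n}" "j \<in> {1..n}" for i j
  proof
    note pr = proper[OF ij(1)] proper[OF ij(2)]
    assume "(i, j) \<in> adjacency n gbox"
    then obtain x y where
      "(x, y) \<in> rel_interior (bottom_side (gbox j)) \<union> rel_interior (left_side (gbox j))"
      "(x, y) \<in> rel_interior (top_side (gbox i)) \<union> rel_interior (right_side (gbox i))"
      by (auto simp: adjacency_def)
    then consider
        "real (d j) / n = real (c i) / n" "real (a i) / n < real (b j) / n" "real (a j) / n < real (b i) / n"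
      | "real (b i) / n = real (a j) / n" "real (c i) / n < real (d j) / n" "real (c j) / n < real (d i) / n"
      | "real (a j) / n < real (b i) / n" "real (b i) / n < real (b j) / n"
        "real (c i) / n < real (d j) / n" "real (d j) / n < real (d i) / n"
      | "real (a i) / n < real (a j) / n" "real (a j) / n < real (b i) / n"
        "real (c j) / n < real (c i) / n" "real (c i) / n < real (d j) / n"
      unfolding sides[OF ij(1)] sides[OF ij(2)] by auto
    then show "(i, j) \<in> cadj"
    proof cases
      case 1
      then have h: "d j = c i" "a i < b j" "a j < b i" using n_pos unfolding divn by auto
      let ?p = "Suc (max (a i) (a j))"
      have "cell i ?p (Suc (c i))" "cell j ?p (c i)"
        using h pr ij by (auto simp: cell_def)
      moreover have "i \<noteq> j" using h pr by auto
      ultimately show ?thesis by (auto simp: cadj_def)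
    next
      case 2
      then have h: "b i = a j" "c i < d j" "c j < d i" using n_pos unfolding divn by auto
      let ?q = "Suc (max (c i) (c j))"
      have "cell i (b i) ?q" "cell j (Suc (b i)) ?q"
        using h pr ij by (auto simp: cell_def)
      moreover have "i \<noteq> j" using h pr by auto
      ultimately show ?thesis by (auto simp: cadj_def)
    next
      \<comment> \<open>A bottom side crossing a right side. The adjacency relation admits such
        perpendicular pairs formally, here and in the next case, but the two rectangles would then
        share a cell.\<close>
      case 3
      then have h: "a j < b i" "b i < b j" "c i < d j" "d j < d i" unfolding divn by auto
      have "cell i (b i) (d j)" "cell j (b i) (d j)" using h pr ij by (auto simp: cell_def)
      then show ?thesis using cell_unique h by blast
    next
      case 4
      then have h: "a i < a j" "a j < b i" "c j < c i" "c i < d j" unfolding divn by auto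
      have "cell i (Suc (a j)) (Suc (c i))" "cell j (Suc (a j)) (Suc (c i))"
        using h pr ij by (auto simp: cell_def)
      then show ?thesis using cell_unique h by blast
    qed
  next
    assume "(i, j) \<in> cadj"
    then obtain p q where ne: "i \<noteq> j"
      and pq: "cell i p q \<and> cell j (Suc p) q \<or> cell i p (Suc q) \<and> cell j p q"
      by (auto simp: cadj_def)
    from pq show "(i, j) \<in> adjacency n gbox"
    proof
      assume h: "cell i p q \<and> cell j (Suc p) q"
      have "b i = p"
      proof (rule ccontr)
        assume "b i \<noteq> p"
        then have "cell i (Suc p) q" using h by (auto simp: cell_def)
        then show False using cell_unique h ne by blast
      qed
      moreover have "a j = p"
      proof (rule ccontr)
        assume "a j \<noteq> p"
        then have "cell j p q" using h by (auto simp: cell_def)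
        then show False using cell_unique h ne by blast
      qed
      ultimately have
        "(real p / n, 1 - (real q - 1/2) / n) \<in> rel_interior (left_side (gbox j)) \<inter> rel_interior (right_side (gbox i))"
        using h ij n_pos unfolding sides[OF ij(1)] sides[OF ij(2)]
        by (auto simp: cell_def divn)
      then show ?thesis using ij unfolding adjacency_def by blast
    next
      assume h: "cell i p (Suc q) \<and> cell j p q"
      have "d j = q"
      proof (rule ccontr)
        assume "d j \<noteq> q"
        then have "cell j p (Suc q)" using h by (auto simp: cell_def)
        then show False using cell_unique h ne by blast
      qed
      moreover have "c i = q"
      proof (rule ccontr)
        assume "c i \<noteq> q"
        then have "cell i p q" using h by (auto simp: cell_def)
        then show False using cell_unique h ne by blast
      qed
      ultimately have
        "((real p - 1/2) / n, 1 - real q / n) \<in> rel_interior (bottom_side (gbox j)) \<inter> rel_interior (top_side (gbox i))"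
        using h ij n_pos unfolding sides[OF ij(1)] sides[OF ij(2)]
        by (auto simp: cell_def divn)
      then show ?thesis using ij unfolding adjacency_def by blast
    qed
  qed
  moreover have "i \<in> {1..n} \<and> j \<in> {1..n}" if "(i, j) \<in> cadj" for i j
    using that cell_bounds unfolding cadj_def by blast
  moreover have "i \<in> {1..n} \<and> j \<in> {1..n}" if "(i, j) \<in> adjacency n gbox" for i j
    using that by (auto simp: adjacency_def)
  ultimately show ?thesis by (intro equalityI subrelI) blast+
qed

text \<open>Rectangle \<open>i\<close> contains no diagonal cell other than \<open>(i, i)\<close>,
  so on each side of it one of the two walls is right at that cell.\<close>

lemma corner: "i \<in> {1..n} \<Longrightarrow> max (a i) (c i) = i - 1" "i \<in> {1..n} \<Longrightarrow> min (b i) (d i) = i"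
proof -
  assume i: "i \<in> {1..n}"
  note bi = bounds[OF i]
  show "max (a i) (c i) = i - 1"
  proof (rule ccontr)
    assume "max (a i) (c i) \<noteq> i - 1"
    then have "cell i (i - 1) (i - 1)" "i - 1 \<in> {1..n}" using bi i by (auto simp: cell_def)
    then have "i - 1 = i" using cell_unique cell_diag by blast
    then show False using i by auto
  qed
  show "min (b i) (d i) = i"
  proof (rule ccontr)
    assume *: "min (b i) (d i) \<noteq> i"
    then have "cell i (Suc i) (Suc i)" "Suc i \<in> {1..n}" using bi i by (auto simp: cell_def)
    then have "Suc i = i" using cell_unique cell_diag by blast
    then show False by auto
  qed
qed

lemma diagonal_interior:
  assumes "i \<in> {1..n}"
  shows "(t, 1 - t) \<in> interior (gbox i) \<longleftrightarrow> real i - 1 < t * n \<and> t * n < i"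
proof -
  have "(t, 1 - t) \<in> interior (gbox i) \<longleftrightarrow>
      (real (a i) < t * n \<and> real (c i) < t * n) \<and> t * n < real (b i) \<and> t * n < real (d i)"
    unfolding interior_gbox using n_pos by (auto simp: field_simps)
  also have "\<dots> \<longleftrightarrow> real (max (a i) (c i)) < t * n \<and> t * n < real (min (b i) (d i))"
    by (auto simp: max_def min_def)
  also have "\<dots> \<longleftrightarrow> real i - 1 < t * n \<and> t * n < i"
    unfolding corner[OF assms] using assms by (simp add: of_nat_diff)
  finally show ?thesis .
qed

lemma inj_gbox: "inj_on gbox {1..n}"
proof (rule inj_onI)
  fix i j assume ij: "i \<in> {1..n}" "j \<in> {1..n}" "gbox i = gbox j"
  have "((real i - 1/2) / n, 1 - (real i - 1/2) / n) \<in> interior (gbox i)"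
    using diagonal_interior[OF ij(1)] n_pos by simp
  then show "i = j" using gbox_interior_disjoint[OF ij(1,2)] ij(3) by auto
qed

lemma Un_gbox: "\<Union>(gbox ` {1..n}) = unit_square"
proof
  show "\<Union>(gbox ` {1..n}) \<subseteq> unit_square"
  proof
    fix p assume "p \<in> \<Union>(gbox ` {1..n})"
    then obtain i where i: "i \<in> {1..n}" "p \<in> gbox i" by blast
    obtain x y where p: "p = (x, y)" by (cases p)
    have "real (b i) / n \<le> 1" "real (d i) / n \<le> 1" using bounds[OF i(1)] n_pos by auto
    moreover have "0 \<le> real (a i) / n" "0 \<le> real (c i) / n" by auto
    moreover have "real (a i) / n \<le> x" "x \<le> real (b i) / n"
      "1 - real (d i) / n \<le> y" "y \<le> 1 - real (c i) / n"
      using i(2) unfolding gbox_eq p by auto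
    ultimately have "0 \<le> x" "x \<le> 1" "0 \<le> y" "y \<le> 1" by linarith+
    then show "p \<in> unit_square" unfolding p unit_square_def cbox_pair by simp
  qed
  show "unit_square \<subseteq> \<Union>(gbox ` {1..n})"
  proof
    fix z assume z: "z \<in> unit_square"
    obtain x y where xy: "z = (x, y)" "0 \<le> x" "x \<le> 1" "0 \<le> y" "y \<le> 1"
      using z by (cases z) (auto simp: unit_square_def cbox_pair)
    have index: "\<exists>p\<in>{1..n}. (real p - 1) / n \<le> u \<and> u \<le> real p / n" if u: "0 \<le> u" "u \<le> 1" for u
    proof (cases "u = 0")
      \<comment> \<open>For \<open>u = 0\<close> the ceiling used in the other case would give the
        index 0.\<close>
      case True then show ?thesis using pos_n by (intro bexI[of _ 1]) auto
    next
      case False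
      define p where "p = nat \<lceil>u * n\<rceil>"
      have "0 < u * n" using u False n_pos by simp
      then have "0 < \<lceil>u * n\<rceil>" by simp
      then have p: "real p = of_int \<lceil>u * n\<rceil>" "1 \<le> p" unfolding p_def by linarith+
      have "u * n \<le> real p" "real p - 1 \<le> u * n" using p(1) by linarith+
      moreover have "u * n \<le> n" using u n_pos by (simp add: mult_left_le_one_le)
      then have "p \<le> n" unfolding p_def by linarith
      ultimately show ?thesis using p n_pos by (intro bexI[of _ p]) (auto simp: field_simps)
    qed
    obtain p where p: "p \<in> {1..n}" "(real p - 1) / n \<le> x" "x \<le> real p / n" using index xy by blast
    obtain q where q: "q \<in> {1..n}" "(real q - 1) / n \<le> 1 - y" "1 - y \<le> real q / n"
      using index[of "1 - y"] xy by auto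
    obtain i where i: "cell i p q" using cell_ex p q by blast
    have "real (a i) / n \<le> (real p - 1) / n" "real p / n \<le> real (b i) / n"
      "real (c i) / n \<le> (real q - 1) / n" "real q / n \<le> real (d i) / n"
      unfolding divn using i by (auto simp: cell_def)
    then have "z \<in> gbox i" unfolding gbox_eq using xy p q by auto
    then show "z \<in> \<Union>(gbox ` {1..n})" using i by (auto simp: cell_def)
  qed
qed

lemma decomposition_gbox: "decomposition n (gbox ` {1..n})"
  unfolding decomposition_def
proof (intro conjI division_ofI)
  show "card (gbox ` {1..n}) = n" using card_image[OF inj_gbox] by simp
  show int: "\<forall>K\<in>gbox ` {1..n}. interior K \<noteq> {}"
  proof
    fix K assume "K \<in> gbox ` {1..n}"
    then obtain i where i: "i \<in> {1..n}" "K = gbox i" by blast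
    then show "interior K \<noteq> {}" using proper[OF i(1)] by (simp add: interior_gbox divn)
  qed
  show "finite (gbox ` {1..n})" by simp
  show "K \<subseteq> unit_square" if "K \<in> gbox ` {1..n}" for K using that Un_gbox by blast
  show "K \<noteq> {}" if "K \<in> gbox ` {1..n}" for K using that int interior_empty by blast
  show "\<exists>u v. K = cbox u v" if "K \<in> gbox ` {1..n}" for K using that by (auto simp: gbox_def)
  show "interior K \<inter> interior L = {}" if "K \<in> gbox ` {1..n}" "L \<in> gbox ` {1..n}" "K \<noteq> L" for K L
    using that gbox_interior_disjoint by blast
  show "\<Union>(gbox ` {1..n}) = unit_square" by (rule Un_gbox)
qed

lemma gbox_interior_int:
  assumes "i \<in> {1..n}" "j \<in> {1..n}" "p \<in> interior (gbox i)" "p \<in> gbox j" shows "i = j"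
proof -
  have "interior (gbox j) \<noteq> {}" using decomposition_gbox assms unfolding decomposition_def by blast
  then have "interior (gbox i) \<inter> interior (gbox j) \<noteq> {}"
    using open_meets_interior[OF open_interior assms(3)] assms(4) unfolding gbox_def by blast
  then show ?thesis using gbox_interior_disjoint assms by blast
qed

lemma meets_gbox: "meets_all_rectangles (gbox ` {1..n})"
  unfolding meets_all_rectangles_def
proof
  fix K assume "K \<in> gbox ` {1..n}"
  then obtain i where i: "i \<in> {1..n}" "K = gbox i" by blast
  let ?t = "(real i - 1/2) / n"
  have "(?t, 1 - ?t) \<in> interior K" using diagonal_interior[OF i(1)] n_pos i by simp
  moreover have "(?t, 1 - ?t) \<in> main_diagonal"
    unfolding main_diagonal_iff using i n_pos by (intro exI[of _ ?t]) (auto simp: field_simps)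
  ultimately show "main_diagonal \<inter> interior K \<noteq> {}" by blast
qed

text \<open>A diagonal point with non-integral \<open>t * n\<close> is interior to a rectangle, and
  an interior point of one rectangle lies in no other.\<close>

lemma frontier_diagonal:
  "(\<Union>K\<in>gbox ` {1..n}. frontier K) \<inter> main_diagonal = (\<lambda>i. (real i / real n, 1 - real i / real n)) ` {0..n}"
proof
  show "(\<Union>K\<in>gbox ` {1..n}. frontier K) \<inter> main_diagonal \<subseteq> (\<lambda>i. (real i / real n, 1 - real i / real n)) ` {0..n}"
  proof
    fix p assume p: "p \<in> (\<Union>K\<in>gbox ` {1..n}. frontier K) \<inter> main_diagonal"
    then obtain i where i: "i \<in> {1..n}" "p \<in> gbox i" "p \<notin> interior (gbox i)"
      by (auto simp: frontier_gbox)
    obtain t where t: "0 \<le> t" "t \<le> 1" "p = (t, 1 - t)" using p by (auto simp: main_diagonal_iff)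
    have tn: "0 \<le> t * n" "t * n \<le> n" using t n_pos by (simp_all add: mult_left_le_one_le)
    then obtain k :: nat where k: "real k \<le> t * n" "t * n < real k + 1"
      using that[of "nat \<lfloor>t * n\<rfloor>"] by auto
    have "real k = t * n"
    proof (rule ccontr)
      assume ne: "real k \<noteq> t * n"
      then have "real k < n" using k tn by linarith
      then have mem: "Suc k \<in> {1..n}" by simp
      have in_box: "p \<in> interior (gbox (Suc k))"
        using diagonal_interior[OF mem, of t] k t ne by simp
      then have "Suc k = i" using gbox_interior_int[OF mem i(1)] i(2) by blast
      then show False using i in_box by simp
    qed
    then have "real k \<le> real n" "t = real k / n" using tn n_pos by (simp_all add: field_simps)
    then have "k \<le> n" "t = real k / n" by simp_all
    then show "p \<in> (\<lambda>i. (real i / real n, 1 - real i / real n)) ` {0..n}" using t by auto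
  qed
  show "(\<lambda>i. (real i / real n, 1 - real i / real n)) ` {0..n} \<subseteq> (\<Union>K\<in>gbox ` {1..n}. frontier K) \<inter> main_diagonal"
  proof
    fix p assume "p \<in> (\<lambda>i. (real i / real n, 1 - real i / real n)) ` {0..n}"
    then obtain k where k: "k \<le> n" "p = (real k / n, 1 - real k / n)" by auto
    have diag: "p \<in> main_diagonal" using k n_pos by (auto simp: main_diagonal_iff)
    then have "p \<in> unit_square" by (auto simp: main_diagonal_iff unit_square_def cbox_pair)
    then obtain i where i: "i \<in> {1..n}" "p \<in> gbox i" using Un_gbox by blast
    have "\<not> (real i - 1 < real k \<and> real k < i)"
    proof
      assume "real i - 1 < real k \<and> real k < i"
      then have "real i < real (Suc k)" "real k < i" by simp_all
      then show False unfolding of_nat_less_iff by simp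
    qed
    then have "p \<notin> interior (gbox i)"
      using diagonal_interior[OF i(1), of "real k / n"] k n_pos by auto
    then show "p \<in> (\<Union>K\<in>gbox ` {1..n}. frontier K) \<inter> main_diagonal"
      using i diag by (auto simp: frontier_gbox)
  qed
qed

lemma labeling_gbox: "diagonal_labeling n (gbox ` {1..n}) gbox"
  unfolding diagonal_labeling_def
proof (intro conjI ballI impI)
  show "bij_betw gbox {1..n} (gbox ` {1..n})" using inj_gbox by (simp add: bij_betw_def)
  fix i j p q assume ij: "i \<in> {1..n}" "j \<in> {1..n}" "i < j"
    and p: "p \<in> main_diagonal \<inter> interior (gbox i)" and q: "q \<in> main_diagonal \<inter> interior (gbox j)"
  obtain t where t: "p = (t, 1 - t)" using p by (auto simp: main_diagonal_iff)
  obtain s where s: "q = (s, 1 - s)" using q by (auto simp: main_diagonal_iff)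
  have "t * n < i" "real j - 1 < s * n"
    using diagonal_interior[OF ij(1), of t] diagonal_interior[OF ij(2), of s] p q t s by auto
  then have "t * n < s * n" using ij by linarith
  then show "fst p < fst q" using n_pos t s by simp
qed

lemma adjacency_poset_gbox:
  assumes "r = Id_on {1..n} \<union> cadj\<^sup>+"
  shows "\<exists>R. diagonal_rectangulation n R \<and> is_adjacency_poset_of n r R"
proof -
  let ?D = "gbox ` {1..n}"
  let ?R = "{E. decomposition n E \<and> equivalent_decompositions ?D E}"
  have "homeomorphism unit_square unit_square id id" by (simp add: homeomorphism_def)
  then have "equivalent_decompositions ?D ?D"
    unfolding equivalent_decompositions_def by (intro exI[of _ id]) simp
  then have D: "?D \<in> ?R" using decomposition_gbox by simp
  then have "diagonal_rectangulation n ?R"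
    unfolding diagonal_rectangulation_def rectangulation_def
    using decomposition_gbox meets_gbox by blast
  moreover have "distinguished_representative n ?R ?D"
    unfolding distinguished_representative_def using D meets_gbox frontier_diagonal by blast
  ultimately show ?thesis
    unfolding is_adjacency_poset_of_def using labeling_gbox adjacency_gbox assms by metis
qed

end

section \<open>The walls of a diagonal rectangulation\<close>

text \<open>Coordinates are scaled by \<open>n\<close> and rows are measured downwards, so that rectangle \<open>i\<close> is
  \<open>[A i, B i] \<times> [C i, D i]\<close> and the diagonal is \<open>x = y\<close>.\<close>

locale scaled_rectangulation =
  fixes n :: nat and A B C D :: "nat \<Rightarrow> real"
  assumes range: "i \<in> {1..n} \<Longrightarrow> 0 \<le> A i \<and> A i < B i \<and> B i \<le> n \<and> 0 \<le> C i \<and> C i < D i \<and> D i \<le> n"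
    and corner: "i \<in> {1..n} \<Longrightarrow> max (A i) (C i) = real i - 1"
      "i \<in> {1..n} \<Longrightarrow> min (B i) (D i) = i"
    and cover: "0 \<le> x \<Longrightarrow> x \<le> real n \<Longrightarrow> 0 \<le> y \<Longrightarrow> y \<le> real n \<Longrightarrow>
      \<exists>i\<in>{1..n}. A i \<le> x \<and> x \<le> B i \<and> C i \<le> y \<and> y \<le> D i"
    and separate: "i \<in> {1..n} \<Longrightarrow> j \<in> {1..n} \<Longrightarrow> max (A i) (A j) < min (B i) (B j) \<Longrightarrow>
      max (C i) (C j) < min (D i) (D j) \<Longrightarrow> i = j"
begin

lemma swapped: "scaled_rectangulation n C D A B"
proof
  show "0 \<le> C i \<and> C i < D i \<and> D i \<le> n \<and> 0 \<le> A i \<and> A i < B i \<and> B i \<le> n" if "i \<in> {1..n}" for i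
    using range[OF that] by simp
  show "max (C i) (A i) = real i - 1" "min (D i) (B i) = i" if "i \<in> {1..n}" for i
    using corner[OF that] by (simp_all add: max.commute min.commute)
  show "\<exists>i\<in>{1..n}. C i \<le> x \<and> x \<le> D i \<and> A i \<le> y \<and> y \<le> B i"
    if "0 \<le> x" "x \<le> real n" "0 \<le> y" "y \<le> real n" for x y
    using cover[OF that(3,4,1,2)] by blast
  show "i = j" if "i \<in> {1..n}" "j \<in> {1..n}" "max (C i) (C j) < min (D i) (D j)"
    "max (A i) (A j) < min (B i) (B j)" for i j
    using separate that by blast
qed

text \<open>A rectangle just beyond a wall at a non-integral position would lie on the far side of the
  diagonal from its own label.\<close>

lemma right_integral:
  assumes i: "i \<in> {1..n}" shows "B i \<in> \<nat>"
proof (rule ccontr)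
  assume non: "B i \<notin> \<nat>"
  then have "B i \<noteq> i" by auto
  then have Di: "D i = i" "i < B i" using corner(2)[OF i] by (auto simp: min_def split: if_splits)
  have "B i \<noteq> n" using non by auto
  then have Bn: "B i < n" using range[OF i] by simp
  \<comment> \<open>\<open>Min S\<close> is the next left wall beyond \<open>B i\<close>, or the
    border. A rectangle met at \<open>x\<close> before it cannot start between \<open>B i\<close>
    and \<open>x\<close>.\<close>
  define S where "S = insert (real n) {A j |j. j \<in> {1..n} \<and> B i < A j}"
  have S: "finite S" "S \<noteq> {}" by (auto simp: S_def)
  then have "B i < Min S" using Bn by (auto simp: S_def Min_gr_iff)
  then obtain x where x: "B i < x" "x < Min S" using dense by blast
  have xS: "x < s" if "s \<in> S" for s using x Min_le[OF S(1) that] by simp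
  have xn: "x < n" using xS[of "real n"] by (simp add: S_def)
  let ?y = "(C i + D i) / 2"
  have y: "C i < ?y" "?y < D i" using range[OF i] by auto
  obtain j where j: "j \<in> {1..n}" "A j \<le> x" "x \<le> B j" "C j \<le> ?y" "?y \<le> D j"
    using cover[of x ?y] xn x y range[OF i] by auto
  have "\<not> B i < A j" using xS[of "A j"] j by (auto simp: S_def)
  moreover have "\<not> A j < B i"
  proof
    assume "A j < B i"
    then have "i = j"
      using separate[OF i j(1)] range[OF i] range[OF j(1)] x y j by simp
    then show False using j x by simp
  qed
  ultimately have Aj: "A j = B i" by simp
  have "real (j - 1) \<in> \<nat>" by (rule of_nat_in_Nats)
  then have "real j - 1 \<in> \<nat>" using j by (simp add: of_nat_diff)
  then have "A j \<noteq> real j - 1" using Aj non by metis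
  then have "C j = real j - 1" "A j < real j - 1"
    using corner(1)[OF j(1)] by (auto simp: max_def split: if_splits)
  \<comment> \<open>The first bound holds because \<open>?y\<close> lies below row
    \<open>C j\<close> and above \<open>D i = i\<close>, the second because \<open>A j = B i\<close>
    exceeds \<open>i\<close>.\<close>
  then have "real j - 1 < i" "i < real j - 1" using j y Di Aj by auto
  then show False by simp
qed

text \<open>Mirror image of \<open>right_integral\<close> with the nearest right wall before
  \<open>A i\<close>. The symmetry \<open>swapped\<close> exchanges rows and columns only, so the
  reversed direction is argued separately.\<close>

lemma left_integral:
  assumes i: "i \<in> {1..n}" shows "A i \<in> \<nat>"
proof (rule ccontr)
  assume non: "A i \<notin> \<nat>"
  have "real (i - 1) \<in> \<nat>" by (rule of_nat_in_Nats)
  then have "real i - 1 \<in> \<nat>" using i by (simp add: of_nat_diff)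
  then have "A i \<noteq> real i - 1" using non by metis
  then have Ci: "C i = real i - 1" "A i < real i - 1"
    using corner(1)[OF i] by (auto simp: max_def split: if_splits)
  have "A i \<noteq> 0" using non by auto
  then have A0: "0 < A i" using range[OF i] by simp
  define S where "S = insert 0 {B j |j. j \<in> {1..n} \<and> B j < A i}"
  have S: "finite S" "S \<noteq> {}" by (auto simp: S_def)
  then have "Max S < A i" using A0 by (auto simp: S_def Max_less_iff)
  then obtain x where x: "Max S < x" "x < A i" using dense by blast
  have xS: "s < x" if "s \<in> S" for s using x Max_ge[OF S(1) that] by simp
  have x0: "0 < x" using xS[of 0] by (simp add: S_def)
  let ?y = "(C i + D i) / 2"
  have y: "C i < ?y" "?y < D i" using range[OF i] by auto
  obtain j where j: "j \<in> {1..n}" "A j \<le> x" "x \<le> B j" "C j \<le> ?y" "?y \<le> D j"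
    using cover[of x ?y] x0 x y range[OF i] by auto
  have "\<not> B j < A i" using xS[of "B j"] j by (auto simp: S_def)
  moreover have "\<not> A i < B j"
  proof
    assume "A i < B j"
    then have "i = j"
      using separate[OF i j(1)] range[OF i] range[OF j(1)] x y j by simp
    then show False using j x by simp
  qed
  ultimately have Bj: "B j = A i" by simp
  have "B j \<noteq> j" using Bj non by auto
  then have "D j = j" "j < B j"
    using corner(2)[OF j(1)] by (auto simp: min_def split: if_splits)
  then have "real i - 1 < j" "j < real i - 1" using j y Ci Bj by auto
  then show False by simp
qed

lemma grid_rectangulation_exists:
  assumes "n \<ge> 1"
  obtains a b c d where "grid_rectangulation n a b c d"
    "\<And>i. i \<in> {1..n} \<Longrightarrow> A i = real (a i) \<and> B i = real (b i) \<and> C i = real (c i) \<and> D i = real (d i)"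
proof -
  interpret s: scaled_rectangulation n C D A B by (rule swapped)
  define a b c d where "a i = nat \<lfloor>A i\<rfloor>" and "b i = nat \<lfloor>B i\<rfloor>" and "c i = nat \<lfloor>C i\<rfloor>"
    and "d i = nat \<lfloor>D i\<rfloor>" for i
  have eq: "A i = real (a i)" "B i = real (b i)" "C i = real (c i)" "D i = real (d i)"
    if "i \<in> {1..n}" for i
    using left_integral[OF that] right_integral[OF that] s.left_integral[OF that]
      s.right_integral[OF that] by (auto simp: a_def b_def c_def d_def elim!: Nats_cases)
  have "grid_rectangulation n a b c d"
  proof
    show "1 \<le> n" by fact
    show "a i < i \<and> i \<le> b i \<and> b i \<le> n \<and> c i < i \<and> i \<le> d i \<and> d i \<le> n" if i: "i \<in> {1..n}" for i
    proof -
      have "real (a i) \<le> real i - 1" "real (c i) \<le> real i - 1" "real i \<le> real (b i)" "real i \<le> real (d i)"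
        using corner[OF i] eq[OF i] by (auto simp: max_def min_def split: if_splits)
      moreover have "real (b i) \<le> real n" "real (d i) \<le> real n" using range[OF i] eq[OF i] by auto
      ultimately show ?thesis by auto
    qed
    show "\<exists>i\<in>{1..n}. a i < p \<and> p \<le> b i \<and> c i < q \<and> q \<le> d i"
      if pq: "p \<in> {1..n}" "q \<in> {1..n}" for p q
    proof -
      \<comment> \<open>The centre of the unit cell: with integral walls, the weak inequalities
        there become the strict and weak ones required of cells.\<close>
      obtain i where i: "i \<in> {1..n}" "A i \<le> real p - 1/2" "real p - 1/2 \<le> B i"
          "C i \<le> real q - 1/2" "real q - 1/2 \<le> D i"
        using cover[of "real p - 1/2" "real q - 1/2"] pq by auto
      have "real (a i) < p" "real p < real (b i) + 1" "real (c i) < q" "real q < real (d i) + 1"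
        using i(2-5) unfolding eq[OF i(1)] by auto
      then show ?thesis using i(1) by (intro bexI[of _ i]) auto
    qed
    show "i = j" if "i \<in> {1..n}" "j \<in> {1..n}" "a i < p" "p \<le> b i" "c i < q" "q \<le> d i"
      "a j < p" "p \<le> b j" "c j < q" "q \<le> d j" for i j p q
      using separate[OF that(1,2)] that unfolding eq[OF that(1)] eq[OF that(2)] by simp
  qed
  then show ?thesis using that eq by blast
qed

end

text \<open>\<open>n\<close> strictly increasing values below \<open>n\<close> leave no room for a
  skip.\<close>

lemma increasing_between:
  fixes f :: "nat \<Rightarrow> nat"
  assumes "\<And>i j. i \<in> {1..n} \<Longrightarrow> j \<in> {1..n} \<Longrightarrow> i < j \<Longrightarrow> f i < f j"
    and "\<And>i. i \<in> {1..n} \<Longrightarrow> f i < n" and i: "i \<in> {1..n}"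
  shows "Suc (f i) = i"
proof -
  have step: "f i + (j - i) \<le> f j" if "i \<le> j" "1 \<le> i" "j \<le> n" for i j
    using that
  proof (induction j rule: dec_induct)
    case base then show ?case by simp
  next
    case (step j)
    then have "f j < f (Suc j)" using assms(1)[of j "Suc j"] by simp
    then show ?case using step by simp
  qed
  have "f 1 + (i - 1) \<le> f i" "f i + (n - i) \<le> f n" "f n < n"
    using step[of 1 i] step[of i n] assms(2)[of n] i by auto
  then show ?thesis using i by simp
qed

text \<open>After scaling, the diagonal meets walls exactly at the integers. Each rectangle
  therefore cuts out one unit interval of the diagonal, and the order of the labels determines which
  one.\<close>

lemma distinguished_scaled:
  assumes n: "n \<ge> 1" and dec: "decomposition n \<D>" and meets: "meets_all_rectangles \<D>"
    and front: "(\<Union>K\<in>\<D>. frontier K) \<inter> main_diagonal = (\<lambda>i. (real i / real n, 1 - real i / real n)) ` {0..n}"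
    and lab: "diagonal_labeling n \<D> \<rho>"
  obtains A B C D where "scaled_rectangulation n A B C D"
    "\<And>i. i \<in> {1..n} \<Longrightarrow> \<rho> i = cbox (A i / n, 1 - D i / n) (B i / n, 1 - C i / n)"
proof -
  have n0: "0 < real n" using n by simp
  have div: "\<D> division_of unit_square" using dec by (simp add: decomposition_def)
  have bij: "bij_betw \<rho> {1..n} \<D>" using lab by (simp add: diagonal_labeling_def)
  have rho: "\<rho> i \<in> \<D>" if "i \<in> {1..n}" for i using bij that by (auto simp: bij_betw_def)
  have "\<exists>a b c d. \<rho> i = cbox (a / n, 1 - d / n) (b / n, 1 - c / n)" if i: "i \<in> {1..n}" for i
  proof -
    obtain u v where uv: "\<rho> i = cbox u v" using division_ofD(4)[OF div rho[OF i]] by blast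
    show ?thesis
      unfolding uv using n0
      by (intro exI[of _ "n * fst u"] exI[of _ "n * fst v"] exI[of _ "n * (1 - snd v)"]
          exI[of _ "n * (1 - snd u)"]) simp
  qed
  then obtain A B C D where eq: "\<And>i. i \<in> {1..n} \<Longrightarrow> \<rho> i = cbox (A i / n, 1 - D i / n) (B i / n, 1 - C i / n)"
    by metis
  have box: "(x / n, 1 - y / n) \<in> \<rho> i \<longleftrightarrow> A i \<le> x \<and> x \<le> B i \<and> C i \<le> y \<and> y \<le> D i"
    if "i \<in> {1..n}" for i and x y :: real
    unfolding eq[OF that] cbox_pair using n0 by (auto simp: divide_le_cancel)
  have int: "(x / n, 1 - y / n) \<in> interior (\<rho> i) \<longleftrightarrow> A i < x \<and> x < B i \<and> C i < y \<and> y < D i"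
    if "i \<in> {1..n}" for i x y
    unfolding eq[OF that] interior_cbox_pair using n0 by (auto simp: divide_less_cancel)
  have sq: "(x / n, 1 - y / n) \<in> unit_square \<longleftrightarrow> 0 \<le> x \<and> x \<le> n \<and> 0 \<le> y \<and> y \<le> n" for x y :: real
    unfolding unit_square_def cbox_pair using n0 by (auto simp: zero_le_divide_iff)
  have diag: "\<exists>x. 0 \<le> x \<and> x \<le> real n \<and> p = (x / n, 1 - x / n)" if p: "p \<in> main_diagonal" for p
  proof -
    obtain t where "0 \<le> t" "t \<le> 1" "p = (t, 1 - t)" using p by (auto simp: main_diagonal_iff)
    then show ?thesis using n0 by (intro exI[of _ "t * n"]) (simp add: mult_left_le_one_le)
  qed
  have diag': "(x / n, 1 - x / n) \<in> main_diagonal" if "0 \<le> x" "x \<le> real n" for x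
    unfolding main_diagonal_iff using that n0 by (intro exI[of _ "x / n"]) simp
  have proper: "A i < B i \<and> C i < D i" if i: "i \<in> {1..n}" for i
  proof -
    have "interior (\<rho> i) \<noteq> {}" using dec rho[OF i] by (auto simp: decomposition_def)
    then have "A i / n < B i / n" "1 - D i / n < 1 - C i / n"
      unfolding eq[OF i] interior_cbox_pair by (auto simp: times_eq_iff)
    then show ?thesis using n0 by (simp add: divide_less_cancel)
  qed
  have range: "0 \<le> A i \<and> A i < B i \<and> B i \<le> n \<and> 0 \<le> C i \<and> C i < D i \<and> D i \<le> n"
    if i: "i \<in> {1..n}" for i
  proof -
    have "\<rho> i \<subseteq> unit_square" using division_ofD(2)[OF div rho[OF i]] .
    moreover have "(A i / n, 1 - C i / n) \<in> \<rho> i" "(B i / n, 1 - D i / n) \<in> \<rho> i"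
      using box[OF i] proper[OF i] by simp_all
    ultimately show ?thesis using sq proper[OF i] by blast
  qed
  have inter: "i = j" if ij: "i \<in> {1..n}" "j \<in> {1..n}" and p: "p \<in> interior (\<rho> i)" "p \<in> \<rho> j" for i j p
  proof (rule ccontr)
    assume "i \<noteq> j"
    then have ne: "\<rho> i \<noteq> \<rho> j" using inj_onD[OF bij_betw_imp_inj_on[OF bij] _ ij] by blast
    obtain u v where uv: "\<rho> j = cbox u v" using division_ofD(4)[OF div rho[OF ij(2)]] by blast
    have "interior (\<rho> j) \<noteq> {}" using dec rho[OF ij(2)] by (auto simp: decomposition_def)
    then have "interior (\<rho> i) \<inter> interior (\<rho> j) \<noteq> {}"
      using open_meets_interior[OF open_interior p(1)] p(2) unfolding uv by blast
    then show False using division_ofD(5)[OF div rho[OF ij(1)] rho[OF ij(2)] ne] by simp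
  qed
  have on_wall: "\<exists>k. k \<le> n \<and> x = real k" if i: "i \<in> {1..n}"
    and x: "(x / n, 1 - x / n) \<in> \<rho> i" "(x / n, 1 - x / n) \<notin> interior (\<rho> i)" for i x
  proof -
    have "x / n \<le> n / n" "0 \<le> x" using box[OF i] x(1) range[OF i] by (auto simp: divide_right_mono)
    then have "(x / n, 1 - x / n) \<in> main_diagonal" using diag'[of x] n0 by (simp add: divide_le_cancel)
    moreover have "(x / n, 1 - x / n) \<in> frontier (\<rho> i)" using x closure_subset by (auto simp: frontier_def)
    ultimately have "(x / n, 1 - x / n) \<in> (\<lambda>i. (real i / real n, 1 - real i / real n)) ` {0..n}"
      using front rho[OF i] by blast
    then show ?thesis using n0 by auto
  qed
  have off_wall: "(real k / n, 1 - real k / n) \<notin> interior (\<rho> i)" if i: "i \<in> {1..n}" and k: "k \<le> n" for i k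
  proof
    assume int_i: "(real k / n, 1 - real k / n) \<in> interior (\<rho> i)"
    have "(real k / n, 1 - real k / n) \<in> (\<lambda>i. (real i / real n, 1 - real i / real n)) ` {0..n}"
      using k by auto
    then have "(real k / n, 1 - real k / n) \<in> (\<Union>K\<in>\<D>. frontier K)" using front by blast
    then obtain K where K: "K \<in> \<D>" "(real k / n, 1 - real k / n) \<in> frontier K" by blast
    then obtain j where j: "j \<in> {1..n}" "K = \<rho> j" using bij by (auto simp: bij_betw_def)
    have "closed (\<rho> j)" unfolding eq[OF j(1)] by (rule closed_cbox)
    then have "(real k / n, 1 - real k / n) \<in> \<rho> j" "(real k / n, 1 - real k / n) \<notin> interior (\<rho> j)"
      using K j by (auto simp: frontier_def)
    then show False using inter[OF i j(1) int_i] int_i by blast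
  qed
  define lo hi where "lo i = max (A i) (C i)" and "hi i = min (B i) (D i)" for i
  have lohi: "lo i < hi i" if i: "i \<in> {1..n}" for i
  proof -
    have "main_diagonal \<inter> interior (\<rho> i) \<noteq> {}"
      using meets rho[OF i] unfolding meets_all_rectangles_def by blast
    then obtain p where p: "p \<in> main_diagonal" "p \<in> interior (\<rho> i)" by blast
    obtain x where "p = (x / n, 1 - x / n)" using diag[OF p(1)] by blast
    then have "A i < x \<and> x < B i \<and> C i < x \<and> x < D i" using int[OF i, of x x] p by simp
    then show ?thesis by (auto simp: lo_def hi_def)
  qed
  \<comment> \<open>\<open>lo i\<close> and \<open>hi i\<close> are where the diagonal enters and
    leaves rectangle \<open>i\<close>. Both are on walls, hence integers, and no integer lies
    strictly between them, as it would be a wall point in the interior.\<close>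
  have "\<exists>k. lo i = real k \<and> hi i = real k + 1 \<and> k < n" if i: "i \<in> {1..n}" for i
  proof -
    have "(lo i / n, 1 - lo i / n) \<in> \<rho> i" "(lo i / n, 1 - lo i / n) \<notin> interior (\<rho> i)"
      using box[OF i] int[OF i] lohi[OF i] by (auto simp: lo_def hi_def max_def min_def split: if_splits)
    then obtain k where k: "k \<le> n" "lo i = real k" using on_wall[OF i] by blast
    have "(hi i / n, 1 - hi i / n) \<in> \<rho> i" "(hi i / n, 1 - hi i / n) \<notin> interior (\<rho> i)"
      using box[OF i] int[OF i] lohi[OF i] by (auto simp: lo_def hi_def max_def min_def split: if_splits)
    then obtain l where l: "l \<le> n" "hi i = real l" using on_wall[OF i] by blast
    have kl: "k < l" using lohi[OF i] k l by simp
    have "\<not> Suc k < l"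
    proof
      assume "Suc k < l"
      then have "lo i < real (Suc k)" "real (Suc k) < hi i" using k l by auto
      then have "(real (Suc k) / n, 1 - real (Suc k) / n) \<in> interior (\<rho> i)"
        using int[OF i, of "real (Suc k)" "real (Suc k)"] by (auto simp: lo_def hi_def)
      moreover have "Suc k \<le> n" using \<open>Suc k < l\<close> l by simp
      ultimately show False using off_wall[OF i] by blast
    qed
    then have "l = Suc k" using kl by simp
    then show ?thesis using k l by (intro exI[of _ k]) simp
  qed
  then obtain f where f: "\<And>i. i \<in> {1..n} \<Longrightarrow> lo i = real (f i) \<and> hi i = real (f i) + 1 \<and> f i < n"
    by metis
  have mono: "f i < f j" if ij: "i \<in> {1..n}" "j \<in> {1..n}" "i < j" for i j
  proof -
    have mid: "((real (f k) + 1/2) / n, 1 - (real (f k) + 1/2) / n) \<in> main_diagonal \<inter> interior (\<rho> k)"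
      if k: "k \<in> {1..n}" for k
    proof
      show "((real (f k) + 1/2) / n, 1 - (real (f k) + 1/2) / n) \<in> main_diagonal"
      proof (rule diag')
        have "real (f k) + 1 \<le> n" using f[OF k] by (metis Suc_leI add.commute of_nat_Suc of_nat_le_iff)
        then show "real (f k) + 1/2 \<le> n" by simp
      qed simp
      have "lo k < real (f k) + 1/2" "real (f k) + 1/2 < hi k" using f[OF k] by auto
      then show "((real (f k) + 1/2) / n, 1 - (real (f k) + 1/2) / n) \<in> interior (\<rho> k)"
        unfolding int[OF k] by (auto simp: lo_def hi_def)
    qed
    have "\<forall>p\<in>main_diagonal \<inter> interior (\<rho> i). \<forall>q\<in>main_diagonal \<inter> interior (\<rho> j). fst p < fst q"
      using lab ij unfolding diagonal_labeling_def by blast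
    from bspec[OF bspec[OF this mid[OF ij(1)]] mid[OF ij(2)]]
    show ?thesis using n0 by (simp add: divide_less_cancel)
  qed
  have fi: "Suc (f i) = i" if "i \<in> {1..n}" for i
    by (rule increasing_between[of n f, OF mono _ that]) (use f in auto)
  have "scaled_rectangulation n A B C D"
  proof
    show "0 \<le> A i \<and> A i < B i \<and> B i \<le> n \<and> 0 \<le> C i \<and> C i < D i \<and> D i \<le> n"
      if "i \<in> {1..n}" for i by (rule range[OF that])
    show "max (A i) (C i) = real i - 1" "min (B i) (D i) = i" if "i \<in> {1..n}" for i
    proof -
      have "real i = real (f i) + 1" using fi[OF that] by (metis add.commute of_nat_Suc)
      then show "max (A i) (C i) = real i - 1" "min (B i) (D i) = i"
        using f[OF that] unfolding lo_def hi_def by auto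
    qed
    show "\<exists>i\<in>{1..n}. A i \<le> x \<and> x \<le> B i \<and> C i \<le> y \<and> y \<le> D i"
      if "0 \<le> x" "x \<le> real n" "0 \<le> y" "y \<le> real n" for x y
    proof -
      have "(x / n, 1 - y / n) \<in> \<Union>\<D>" using sq that division_ofD(6)[OF div] by simp
      then obtain i where "i \<in> {1..n}" "(x / n, 1 - y / n) \<in> \<rho> i"
        using bij by (auto simp: bij_betw_def)
      then show ?thesis using box by blast
    qed
    show "i = j" if ij: "i \<in> {1..n}" "j \<in> {1..n}" and h: "max (A i) (A j) < min (B i) (B j)"
      "max (C i) (C j) < min (D i) (D j)" for i j
    proof -
      obtain x where x: "max (A i) (A j) < x" "x < min (B i) (B j)" using dense[OF h(1)] by blast
      obtain y where y: "max (C i) (C j) < y" "y < min (D i) (D j)" using dense[OF h(2)] by blast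
      have "(x / n, 1 - y / n) \<in> interior (\<rho> i)" "(x / n, 1 - y / n) \<in> \<rho> j"
        using int[OF ij(1)] box[OF ij(2)] x y by auto
      then show ?thesis using inter ij by blast
    qed
  qed
  then show ?thesis using that eq by blast
qed

lemma adjacency_cong:
  assumes "\<And>i. i \<in> {1..n} \<Longrightarrow> \<rho> i = \<sigma> i" shows "adjacency n \<rho> = adjacency n \<sigma>"
  using assms by (auto simp: adjacency_def)

lemma adjacency_poset_grid:
  assumes n: "n \<ge> 1" and R: "diagonal_rectangulation n R" "is_adjacency_poset_of n r R"
  obtains a b c d where "grid_rectangulation n a b c d"
    "r = Id_on {1..n} \<union> (grid_rectangulation.cadj n a b c d)\<^sup>+"
proof -
  obtain \<D> \<rho> where D: "distinguished_representative n R \<D>" "diagonal_labeling n \<D> \<rho>"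
    and r: "r = Id_on {1..n} \<union> (adjacency n \<rho>)\<^sup>+"
    using R by (auto simp: is_adjacency_poset_of_def)
  have dec: "decomposition n \<D>"
    using R D unfolding diagonal_rectangulation_def rectangulation_def distinguished_representative_def
    by blast
  obtain A B C D where sc: "scaled_rectangulation n A B C D"
    and eq: "\<And>i. i \<in> {1..n} \<Longrightarrow> \<rho> i = cbox (A i / n, 1 - D i / n) (B i / n, 1 - C i / n)"
    by (rule distinguished_scaled[OF n dec _ _ D(2)])
      (use D(1) in \<open>auto simp: distinguished_representative_def\<close>)
  obtain a b c d where g: "grid_rectangulation n a b c d"
    and abcd: "\<And>i. i \<in> {1..n} \<Longrightarrow> A i = real (a i) \<and> B i = real (b i) \<and> C i = real (c i) \<and> D i = real (d i)"
    using scaled_rectangulation.grid_rectangulation_exists[OF sc n] by metis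
  interpret g: grid_rectangulation n a b c d by (rule g)
  have "adjacency n \<rho> = g.cadj"
    unfolding g.adjacency_gbox[symmetric]
    by (rule adjacency_cong) (use eq abcd in \<open>simp add: g.gbox_def\<close>)
  then show ?thesis using that g r by simp
qed

section \<open>Baxter posets have uniform gaps\<close>

lemma baxter_imp_uniform_gap:
  assumes "baxter_poset n r" shows "uniform_gap_poset {1..n} r"
proof -
  interpret nat_poset "{1..n}" r
    by unfold_locales (use assms in \<open>auto simp: baxter_poset_def\<close>)
  obtain pos where pos: "planar_embedding {1..n} r pos" and
    left: "\<And>x y w z. (x, y) \<in> r \<Longrightarrow> disconnected_subposet r (open_interval r x y) \<Longrightarrow>
      w \<in> open_interval r x y \<Longrightarrow> z \<in> open_interval r x y \<Longrightarrow>
      \<not> same_component r (open_interval r x y) w z \<Longrightarrow> left_of r pos w z \<Longrightarrow> w < x \<and> x < z"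
    using assms unfolding baxter_poset_def by blast
  have bounded: "bounded_poset {1..n} r" using assms by (simp add: baxter_poset_def)
  interpret planar_poset "{1..n}" r pos
    by unfold_locales (use pos bounded in auto)
  have "btw x w z" if xy: "(x, y) \<in> r" "disconnected_subposet r (open_interval r x y)"
    and wz: "w \<in> open_interval r x y" "z \<in> open_interval r x y"
      "\<not> same_component r (open_interval r x y) w z" for x y w z
  proof -
    have zw: "\<not> same_component r (open_interval r x y) z w" using wz same_component_sym by blast
    show ?thesis
      using left_of_total[OF diff_component_par[OF wz]] left[OF xy wz] left[OF xy wz(2,1) zw]
      by (auto simp: btw_def)
  qed
  moreover have "\<bar>int x - int y\<bar> = 1"
    if "(x, y) \<in> r" "disconnected_subposet r (open_interval r x y)" for x y
    using assms that unfolding baxter_poset_def by blast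
  ultimately have facets_ordered unfolding facets_ordered_def by blast
  moreover have "card {y. covers_P r x y} \<le> 2 \<and> card {y. covers_P r y x} \<le> 2" if "x \<in> {1..n}" for x
    using assms that unfolding baxter_poset_def by blast
  ultimately interpret ordered_facet_lattice "{1..n}" r
    by unfold_locales (use bounded interpolating in auto)
  have no: "\<not> chain_2_14_3 r a b c d" "\<not> chain_3_14_2 r a b c d"
    "\<not> chain_2_41_3 r a b c d" "\<not> chain_3_41_2 r a b c d" for a b c d
    using assms unfolding baxter_poset_def by blast+
  show ?thesis
  proof
    fix x y assume cov: "covers_P r x y"
    show "(\<forall>k\<in>{1..n}. btw k x y \<longrightarrow> less_P r k x) \<or> (\<forall>k\<in>{1..n}. btw k x y \<longrightarrow> less_P r y k)"
    proof (rule ccontr)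
      assume "\<not> ?thesis"
      then obtain k l where k: "btw k x y" "less_P r y k" and l: "btw l x y" "less_P r l x"
        using cover_gap[OF cov] by blast
      \<comment> \<open>\<open>l\<close> is below and \<open>k\<close> above the same cover. The
        order of the labels \<open>x\<close>, \<open>y\<close> and that of \<open>k\<close>,
        \<open>l\<close> select one of the four forbidden chains.\<close>
      have "less_P r l k" using lt_trans[OF l(2) lt_trans[OF cover_lt[OF cov] k(2)]] .
      then have "l < k \<or> k < l" using lt_neq[of l k] by linarith
      then show False
        using k l cov no(1)[of x l k y] no(2)[of x k l y] no(3)[of y l k x] no(4)[of y k l x]
        unfolding btw_def chain_2_14_3_def chain_3_14_2_def chain_2_41_3_def chain_3_41_2_def
        by auto
    qed
  qed
qed

theorem theorem1p2:
  fixes n :: nat and r :: "nat rel"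
  assumes "n \<ge> 1" and "partial_order_on {1..n} r"
  shows "baxter_poset n r \<longleftrightarrow>
    (\<exists>R. diagonal_rectangulation n R \<and> is_adjacency_poset_of n r R)"
proof
  assume b: "baxter_poset n r"
  then have "bounded_poset {1..n} r" by (simp add: baxter_poset_def)
  then interpret bounded_uniform_gap_poset n r
    using baxter_imp_uniform_gap[OF b] assms(1)
    by (simp add: bounded_uniform_gap_poset_def bounded_uniform_gap_poset_axioms_def)
  show "\<exists>R. diagonal_rectangulation n R \<and> is_adjacency_poset_of n r R"
    by (rule grid_rectangulation.adjacency_poset_gbox[OF grid r_eq_cadj])
next
  assume "\<exists>R. diagonal_rectangulation n R \<and> is_adjacency_poset_of n r R"
  then obtain R where R: "diagonal_rectangulation n R" "is_adjacency_poset_of n r R" by blast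
  obtain a b c d where g: "grid_rectangulation n a b c d"
    and r: "r = Id_on {1..n} \<union> (grid_rectangulation.cadj n a b c d)\<^sup>+"
    by (rule adjacency_poset_grid[OF assms(1) R])
  show "baxter_poset n r"
    by (rule uniform_gap_imp_baxter)
      (rule grid_rectangulation.uniform_gap[OF g r assms(2)],
        rule grid_rectangulation.bounded_cadj[OF g r assms(2)])
qed

end
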